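(* Let $\lambda$ be a nonzero real number. Let $Q\in C^2([0,\infty))$ be complex-valued with $Q(0)=0$, and let $q$ be the unique global classical solution, $q\in C^1([0,\infty);L^2(0,\infty))\cap C^0([0,\infty);H^2(0,\infty))$, of $$\mathrm{i}q_t+q_{xx}-2\lambda|q|^2q=0\quad (x>0,\ t>0),\qquad q(x,0)=0\ (x\ge 0),\qquad q(0,t)=Q(t)\ (t\ge 0).$$ If $\lambda<0$, assume in addition that $\|q(0,\cdot)\|_{L^2(0,t)}^2\le c_2$ uniformly in $t\ge 0$, for some sufficiently small $c_2>0$. Then there are constants $c>0$ and $c_1\ge 0$, independent of $t$, with $c_1=0$ if $\lambda<0$ and $c_1>0$ if $\lambda>0$, such that for every $t\ge 0$ $$\Big(\int_0^t|q_x(0,s)|^2\,ds\Big)^{1/2}=\|q_x(0,\cdot)\|_{L^2(0,t)}\le c\,\|q(0,\cdot)\|_{L^2(0,t)}^{1/2}\,\|q_t(0,\cdot)\|_{L^2(0,t)}^{1/2}+c_1\|q(0,\cdot)\|_{L^4(0,t)}^2 .$$ The inequality also holds with $t$ replaced by $\infty$.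
   Context: For $p\ge 1$, $\|\cdot\|_{L^p(0,t)}$ denotes the $L^p$ norm in the time variable over $(0,t)$. Existence and uniqueness of the global classical solution $q$ is known (Carroll–Bu). "Sufficiently small" means that there is a threshold (depending only on $\lambda$) below which $c_2$ is to be taken. *)

theory Defs
  imports "HOL-Analysis.Analysis"
begin

section \<open>Lebesgue norms with values in \<open>[0,\<infinity>]\<close>\<close>

definition epowr :: "ennreal \<Rightarrow> real \<Rightarrow> ennreal" where
  "epowr x a = (if x = \<infinity> then \<infinity> else ennreal (enn2real x powr a))"

definition Lp_norm :: "real \<Rightarrow> real set \<Rightarrow> (real \<Rightarrow> complex) \<Rightarrow> ennreal" where
  "Lp_norm p A f = epowr (\<integral>\<^sup>+x\<in>A. ennreal (norm (f x) powr p) \<partial>lborel) (1 / p)"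

definition L2_halfline :: "(real \<Rightarrow> complex) set" where
  "L2_halfline = {f. set_borel_measurable lborel {0<..} f \<and> Lp_norm 2 {0<..} f < \<infinity>}"


section \<open>The Sobolev space \<open>H\<^sup>2(0,\<infinity>)\<close>\<close>

text \<open>Test functions are the \<open>C\<^sup>1\<close> functions with compact support in the open half line; for
  first order weak derivatives they are equivalent to smooth ones.\<close>

definition test_function :: "(real \<Rightarrow> real) \<Rightarrow> bool" where
  "test_function \<phi> \<longleftrightarrow> \<phi> C1_differentiable_on UNIV \<and> (\<exists>a b. 0 < a \<and> (\<forall>x. x \<notin> {a..b} \<longrightarrow> \<phi> x = 0))"

definition locally_integrable :: "(real \<Rightarrow> complex) \<Rightarrow> bool" where
  "locally_integrable f \<longleftrightarrow> (\<forall>a b. 0 < a \<longrightarrow> set_integrable lborel {a..b} f)"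

definition has_weak_deriv :: "(real \<Rightarrow> complex) \<Rightarrow> (real \<Rightarrow> complex) \<Rightarrow> bool" where
  "has_weak_deriv f g \<longleftrightarrow> locally_integrable f \<and> locally_integrable g \<and>
     (\<forall>\<phi>. test_function \<phi> \<longrightarrow>
        (LBINT x:{0<..}. deriv \<phi> x *\<^sub>R f x) = - (LBINT x:{0<..}. \<phi> x *\<^sub>R g x))"

text \<open>A weak derivative is unique up to null sets; the choice of representative is immaterial
  below.\<close>

definition weak_deriv :: "(real \<Rightarrow> complex) \<Rightarrow> real \<Rightarrow> complex" where
  "weak_deriv f = (SOME g. has_weak_deriv f g)"

definition H2_halfline :: "(real \<Rightarrow> complex) set" where
  "H2_halfline = {f. f \<in> L2_halfline \<and>
     (\<exists>g\<in>L2_halfline. has_weak_deriv f g \<and> (\<exists>h\<in>L2_halfline. has_weak_deriv g h))}"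

definition H2_norm :: "(real \<Rightarrow> complex) \<Rightarrow> ennreal" where
  "H2_norm f = epowr ((Lp_norm 2 {0<..} f)\<^sup>2 + (Lp_norm 2 {0<..} (weak_deriv f))\<^sup>2
     + (Lp_norm 2 {0<..} (weak_deriv (weak_deriv f)))\<^sup>2) (1 / 2)"


section \<open>Time regularity\<close>

text \<open>Here \<open>u t\<close> is the spatial profile \<open>u(\<cdot>,t)\<close>. All derivatives at time \<open>0\<close> are one-sided.\<close>

definition C0_L2 :: "(real \<Rightarrow> real \<Rightarrow> complex) \<Rightarrow> bool" where
  "C0_L2 u \<longleftrightarrow> (\<forall>t\<ge>0. u t \<in> L2_halfline \<and>
     ((\<lambda>s. Lp_norm 2 {0<..} (\<lambda>x. u s x - u t x)) \<longlongrightarrow> 0) (at t within {0..}))"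

definition C0_H2 :: "(real \<Rightarrow> real \<Rightarrow> complex) \<Rightarrow> bool" where
  "C0_H2 u \<longleftrightarrow> (\<forall>t\<ge>0. u t \<in> H2_halfline \<and>
     ((\<lambda>s. H2_norm (\<lambda>x. u s x - u t x)) \<longlongrightarrow> 0) (at t within {0..}))"

text \<open>\<open>u \<in> C\<^sup>1([0,\<infinity>);L\<^sup>2(0,\<infinity>))\<close> with time derivative \<open>v\<close>.\<close>

definition C1_L2 :: "(real \<Rightarrow> real \<Rightarrow> complex) \<Rightarrow> (real \<Rightarrow> real \<Rightarrow> complex) \<Rightarrow> bool" where
  "C1_L2 u v \<longleftrightarrow> C0_L2 v \<and> (\<forall>t\<ge>0. u t \<in> L2_halfline \<and>
     ((\<lambda>s. Lp_norm 2 {0<..} (\<lambda>x. (u s x - u t x) /\<^sub>R (s - t) - v t x)) \<longlongrightarrow> 0)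
       (at t within {0..}))"

definition C2_halfline :: "(real \<Rightarrow> complex) \<Rightarrow> bool" where
  "C2_halfline Q \<longleftrightarrow> (\<exists>Q1 Q2. continuous_on {0..} Q2 \<and>
     (\<forall>t\<ge>0. (Q has_vector_derivative Q1 t) (at t within {0..}) \<and>
             (Q1 has_vector_derivative Q2 t) (at t within {0..})))"


section \<open>The initial-boundary value problem\<close>

text \<open>Every profile \<open>q(\<cdot>,t) \<in> H\<^sup>2(0,\<infinity>)\<close> is given by its representative that is continuous on
  \<open>[0,\<infinity>)\<close>, so that the initial and boundary values are pointwise values. That representative is
  continuously differentiable up to \<open>x = 0\<close>. The equation holds in \<open>L\<^sup>2(0,\<infinity>)\<close> for every \<open>t\<close>.\<close>

definition classical_solution :: "real \<Rightarrow> (real \<Rightarrow> complex) \<Rightarrow> (real \<Rightarrow> real \<Rightarrow> complex) \<Rightarrow> bool" where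
  "classical_solution lam Q q \<longleftrightarrow>
     (\<forall>t\<ge>0. continuous_on {0..} (\<lambda>x. q x t)) \<and>
     C0_H2 (\<lambda>t x. q x t) \<and>
     (\<exists>v. C1_L2 (\<lambda>t x. q x t) v \<and>
        (\<forall>t\<ge>0. AE x in lborel. 0 < x \<longrightarrow>
           \<i> * v t x + weak_deriv (weak_deriv (\<lambda>y. q y t)) x
             - 2 * complex_of_real lam * complex_of_real ((norm (q x t))\<^sup>2) * q x t = 0)) \<and>
     (\<forall>x\<ge>0. q x 0 = 0) \<and>
     (\<forall>t\<ge>0. q 0 t = Q t)"

text \<open>The boundary values \<open>q\<^sub>x(0,t)\<close> and \<open>q\<^sub>t(0,t)\<close>.\<close>

definition bdry_dx :: "(real \<Rightarrow> real \<Rightarrow> complex) \<Rightarrow> real \<Rightarrow> complex" where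
  "bdry_dx q t = vector_derivative (\<lambda>x. q x t) (at 0 within {0..})"

definition bdry_dt :: "(real \<Rightarrow> real \<Rightarrow> complex) \<Rightarrow> real \<Rightarrow> complex" where
  "bdry_dt q t = vector_derivative (\<lambda>s. q 0 s) (at t within {0..})"

end

theory Submission
  imports Defs
begin

text \<open>Write \<open>P(t) = q\<^sub>x(0,t)\<close>, let \<open>\<parallel>\<cdot>\<parallel>\<close> without index be the norm of \<open>L\<^sup>2(0,t)\<close> in time and
  \<open>n\<close>, \<open>m\<close> the spatial \<open>L\<^sup>2\<close> norms of \<open>q(\<cdot>,t)\<close>, \<open>q\<^sub>x(\<cdot>,t)\<close>. Integrating the balance laws of mass, energy
  and momentum over \<open>(0,t)\<close>, with zero initial data, gives
  \<open>n\<^sup>2 \<le> 2 \<parallel>Q\<parallel> \<parallel>P\<parallel>\<close>, \<open>m\<^sup>2 + \<lambda> \<integral>|q|\<^sup>4 dx \<le> 2 \<parallel>Q'\<parallel> \<parallel>P\<parallel>\<close> and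
  \<open>\<parallel>P\<parallel>\<^sup>2 \<le> \<lambda> \<integral>|Q|\<^sup>4 dt + \<parallel>Q\<parallel> \<parallel>Q'\<parallel> + n m\<close>. For \<open>\<lambda> > 0\<close> the first two bound \<open>n m\<close> by
  \<open>2 (\<parallel>Q\<parallel> \<parallel>Q'\<parallel>)\<^sup>1\<^sup>/\<^sup>2 \<parallel>P\<parallel>\<close>, and the third is a quadratic inequality for \<open>\<parallel>P\<parallel>\<close>. For \<open>\<lambda> < 0\<close> the bound
  \<open>\<integral>|q|\<^sup>4 dx \<le> 2 n\<^sup>3 m\<close>, from \<open>sup |q|\<^sup>2 \<le> 2 n m\<close>, costs the extra term \<open>8 |\<lambda>| \<parallel>Q\<parallel>\<^sup>2 \<parallel>P\<parallel>\<^sup>2\<close>, which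
  is absorbed when \<open>\<parallel>Q\<parallel>\<^sup>2 \<le> 1/(16 |\<lambda>|)\<close>.\<close>

section \<open>\<open>L\<^sup>2\<close> inner products and norms\<close>

text \<open>The increment of each functional between t and s is instead factored into a difference
  and a sum, and where q_x enters, one integration by parts in x at fixed times takes the derivative
  off q_x(s) - q_x(t). What is left contains only the difference quotient of q, which converges in
  L2, that of Q, and factors that converge because q, q_x and q_xx are continuous in L2. Momentum is
  the functional to use because its boundary flux contains |q_x(0,t)|^2 itself; mass and energy
  serve only to control its value at time t. \<open>weak_deriv\<close> is an arbitrary
  representative, whereas the theorem speaks of q_x at the point x = 0. This is bridged by
  absolutely continuous functions on [0,\<infinity>) and the du Bois-Reymond lemma. The constant c =
  5 is rounded up so that one value serves both signs of \<lambda>.\<close>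

lemma borel_measurable_cnj [measurable (raw)]:
  "f \<in> borel_measurable M \<Longrightarrow> (\<lambda>x. cnj (f x)) \<in> borel_measurable M"
  by (rule borel_measurable_continuous_on[where f = cnj]) (auto intro: continuous_intros)

definition square_integrable :: "'a measure \<Rightarrow> ('a \<Rightarrow> complex) \<Rightarrow> bool" where
  "square_integrable M f \<longleftrightarrow> f \<in> borel_measurable M \<and> integrable M (\<lambda>x. (norm (f x))\<^sup>2)"

text \<open>The default value of the Bochner integral makes this 0 when the squared modulus is not
  integrable, so the estimates below carry \<open>square_integrable\<close> hypotheses.\<close>

definition norm_L2 :: "'a measure \<Rightarrow> ('a \<Rightarrow> complex) \<Rightarrow> real" where
  "norm_L2 M f = sqrt (\<integral>x. (norm (f x))\<^sup>2 \<partial>M)"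

text \<open>The real part of the complex L2 pairing: \<open>complex\<close> is taken as a real inner
  product space. In it f and \<i> f are orthogonal, which is what removes terms from the balance
  laws.\<close>

definition inner_L2 :: "'a measure \<Rightarrow> ('a \<Rightarrow> complex) \<Rightarrow> ('a \<Rightarrow> complex) \<Rightarrow> real" where
  "inner_L2 M f g = (\<integral>x. f x \<bullet> g x \<partial>M)"

lemma square_integrable_measurable [measurable_dest]: "square_integrable M f \<Longrightarrow> f \<in> borel_measurable M"
  by (simp add: square_integrable_def)

lemma norm_L2_nonneg [simp]: "0 \<le> norm_L2 M f"
  by (simp add: norm_L2_def)

lemma norm_L2_power2: "(norm_L2 M f)\<^sup>2 = (\<integral>x. (norm (f x))\<^sup>2 \<partial>M)"
  by (simp add: norm_L2_def)

lemma inner_L2_self: "inner_L2 M f f = (norm_L2 M f)\<^sup>2"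
  by (simp add: norm_L2_power2 inner_L2_def power2_norm_eq_inner)

text \<open>From 0 \<le> (|f| - |g|)^2 the product is dominated by |f|^2 + |g|^2.\<close>

lemma square_integrable_integrable_mult_norm:
  assumes "square_integrable M f" "square_integrable M g"
  shows "integrable M (\<lambda>x. norm (f x) * norm (g x))"
proof (rule Bochner_Integration.integrable_bound)
  show "integrable M (\<lambda>x. (norm (f x))\<^sup>2 + (norm (g x))\<^sup>2)"
    using assms by (auto simp: square_integrable_def)
  show "(\<lambda>x. norm (f x) * norm (g x)) \<in> borel_measurable M"
    using assms[THEN square_integrable_measurable] by measurable
  show "AE x in M. norm (norm (f x) * norm (g x)) \<le> norm ((norm (f x))\<^sup>2 + (norm (g x))\<^sup>2)"
  proof (rule AE_I2)
    fix x
    have "0 \<le> (norm (f x) - norm (g x))\<^sup>2 + (norm (f x))\<^sup>2 + (norm (g x))\<^sup>2" by simp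
    then show "norm (norm (f x) * norm (g x)) \<le> norm ((norm (f x))\<^sup>2 + (norm (g x))\<^sup>2)"
      by (simp add: power2_diff)
  qed
qed

lemma square_integrable_integrable_mult:
  assumes "square_integrable M f" "square_integrable M g"
  shows "integrable M (\<lambda>x. f x * g x)"
  using square_integrable_integrable_mult_norm[OF assms]
  by (rule Bochner_Integration.integrable_bound)
     (use assms[THEN square_integrable_measurable] in \<open>auto simp: norm_mult\<close>)

lemma square_integrable_integrable_inner:
  assumes "square_integrable M f" "square_integrable M g"
  shows "integrable M (\<lambda>x. f x \<bullet> g x)"
  using square_integrable_integrable_mult_norm[OF assms]
  by (rule Bochner_Integration.integrable_bound)
     (use assms[THEN square_integrable_measurable] in \<open>auto simp: Cauchy_Schwarz_ineq2\<close>)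

lemma square_integrable_bound:
  assumes "square_integrable M f" and [measurable]: "g \<in> borel_measurable M"
    and "\<And>x. x \<in> space M \<Longrightarrow> norm (g x) \<le> C * norm (f x)"
  shows "square_integrable M g"
  unfolding square_integrable_def
proof
  show "integrable M (\<lambda>x. (norm (g x))\<^sup>2)"
  proof (rule Bochner_Integration.integrable_bound)
    show "integrable M (\<lambda>x. C\<^sup>2 * (norm (f x))\<^sup>2)"
      using assms by (auto simp: square_integrable_def)
    show "AE x in M. norm ((norm (g x))\<^sup>2) \<le> norm (C\<^sup>2 * (norm (f x))\<^sup>2)"
      using assms(3) by (auto simp flip: power_mult_distrib intro!: AE_I2 power_mono)
  qed measurable
qed fact

lemma square_integrable_add:
  assumes "square_integrable M f" "square_integrable M g"
  shows "square_integrable M (\<lambda>x. f x + g x)"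
  unfolding square_integrable_def
proof
  note [measurable] = assms[THEN square_integrable_measurable]
  show "(\<lambda>x. f x + g x) \<in> borel_measurable M" by measurable
  have "integrable M (\<lambda>x. (norm (f x))\<^sup>2 + (norm (g x))\<^sup>2 + 2 * (f x \<bullet> g x))"
    using assms square_integrable_integrable_inner[OF assms] by (auto simp: square_integrable_def)
  then show "integrable M (\<lambda>x. (norm (f x + g x))\<^sup>2)"
    by (simp add: power2_norm_eq_inner inner_add inner_commute algebra_simps)
qed

lemma square_integrable_mult_left: "square_integrable M f \<Longrightarrow> square_integrable M (\<lambda>x. c * f x)"
  by (rule square_integrable_bound[where f = f and C = "norm c"]) (auto simp: norm_mult square_integrable_def)

lemma square_integrable_minus: "square_integrable M f \<Longrightarrow> square_integrable M (\<lambda>x. - f x)"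
  using square_integrable_mult_left[of M f "-1"] by simp

lemma square_integrable_diff: "square_integrable M f \<Longrightarrow> square_integrable M g \<Longrightarrow> square_integrable M (\<lambda>x. f x - g x)"
  using square_integrable_add[of M f "\<lambda>x. - g x"] square_integrable_minus[of M g] by simp

lemma square_integrable_scaleR: "square_integrable M f \<Longrightarrow> square_integrable M (\<lambda>x. c *\<^sub>R f x)"
  using square_integrable_mult_left[of M f "of_real c"] by (simp add: scaleR_conv_of_real)

lemma square_integrable_cnj: "square_integrable M f \<Longrightarrow> square_integrable M (\<lambda>x. cnj (f x))"
  by (rule square_integrable_bound[where f = f and C = 1]) (auto simp: square_integrable_def)

lemmas square_integrable_intros = square_integrable_add square_integrable_mult_left square_integrable_minus square_integrable_diff square_integrable_scaleR square_integrable_cnj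

lemma inner_L2_commute: "inner_L2 M f g = inner_L2 M g f"
  by (simp add: inner_L2_def inner_commute)

lemma inner_L2_add_left:
  "square_integrable M f \<Longrightarrow> square_integrable M g \<Longrightarrow> square_integrable M k \<Longrightarrow> inner_L2 M (\<lambda>x. f x + g x) k = inner_L2 M f k + inner_L2 M g k"
  by (simp add: inner_L2_def inner_add_left square_integrable_integrable_inner)

lemma inner_L2_diff_left:
  "square_integrable M f \<Longrightarrow> square_integrable M g \<Longrightarrow> square_integrable M k \<Longrightarrow> inner_L2 M (\<lambda>x. f x - g x) k = inner_L2 M f k - inner_L2 M g k"
  by (simp add: inner_L2_def inner_diff_left square_integrable_integrable_inner)

lemma inner_L2_add_right:
  "square_integrable M f \<Longrightarrow> square_integrable M g \<Longrightarrow> square_integrable M k \<Longrightarrow> inner_L2 M k (\<lambda>x. f x + g x) = inner_L2 M k f + inner_L2 M k g"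
  by (simp add: inner_L2_def inner_add_right square_integrable_integrable_inner)

lemma inner_L2_diff_right:
  "square_integrable M f \<Longrightarrow> square_integrable M g \<Longrightarrow> square_integrable M k \<Longrightarrow> inner_L2 M k (\<lambda>x. f x - g x) = inner_L2 M k f - inner_L2 M k g"
  by (simp add: inner_L2_def inner_diff_right square_integrable_integrable_inner)

lemma inner_L2_scaleR_left: "inner_L2 M (\<lambda>x. c *\<^sub>R f x) g = c * inner_L2 M f g"
  by (simp add: inner_L2_def)

lemma inner_L2_scaleR_right: "inner_L2 M f (\<lambda>x. c *\<^sub>R g x) = c * inner_L2 M f g"
  by (simp add: inner_L2_def)

lemma inner_L2_cong_AE:
  assumes "AE x in M. f x = f' x" "AE x in M. g x = g' x"
    and "square_integrable M f" "square_integrable M f'" "square_integrable M g" "square_integrable M g'"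
  shows "inner_L2 M f g = inner_L2 M f' g'"
  unfolding inner_L2_def
proof (rule integral_cong_AE)
  note [measurable] = assms(3-6)[THEN square_integrable_measurable]
  show "(\<lambda>x. f x \<bullet> g x) \<in> borel_measurable M" "(\<lambda>x. f' x \<bullet> g' x) \<in> borel_measurable M"
    by measurable
  show "AE x in M. f x \<bullet> g x = f' x \<bullet> g' x"
    using assms(1,2) by eventually_elim simp
qed

text \<open>Cauchy-Schwarz by integrating the square of s |f| - t |g|: the resulting quadratic form
  in (s,t) is nonnegative, and s = \<open>b\<close>, t = \<open>a\<close> gives the bound.\<close>

lemma L2_mult_norm_le:
  assumes "square_integrable M f" "square_integrable M g"
  shows "(\<integral>x. norm (f x) * norm (g x) \<partial>M) \<le> norm_L2 M f * norm_L2 M g"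
proof -
  define a b c where "a = norm_L2 M f" "b = norm_L2 M g" "c = (\<integral>x. norm (f x) * norm (g x) \<partial>M)"
  have int: "integrable M (\<lambda>x. (norm (f x))\<^sup>2)" "integrable M (\<lambda>x. (norm (g x))\<^sup>2)"
    "integrable M (\<lambda>x. norm (f x) * norm (g x))"
    using assms square_integrable_integrable_mult_norm[OF assms] by (auto simp: square_integrable_def)
  have *: "2 * (s * t) * c \<le> s\<^sup>2 * a\<^sup>2 + t\<^sup>2 * b\<^sup>2" for s t :: real
  proof -
    have "0 \<le> (\<integral>x. (s * norm (f x) - t * norm (g x))\<^sup>2 \<partial>M)" by simp
    also have "\<dots> = (\<integral>x. s\<^sup>2 * (norm (f x))\<^sup>2 + t\<^sup>2 * (norm (g x))\<^sup>2 - 2 * (s * t) * (norm (f x) * norm (g x)) \<partial>M)"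
      by (rule Bochner_Integration.integral_cong)
         (simp_all add: power2_eq_square algebra_simps)
    also have "\<dots> = s\<^sup>2 * a\<^sup>2 + t\<^sup>2 * b\<^sup>2 - 2 * (s * t) * c"
      using int by (simp add: a_b_c_def norm_L2_power2)
    finally show ?thesis by simp
  qed
  have nn: "0 \<le> a" "0 \<le> b" "0 \<le> c" by (auto simp: a_b_c_def)
  have "c \<le> a * b"
  proof (cases "a = 0 \<or> b = 0")
    case False
    with nn have "0 < a" "0 < b" by auto
    have "2 * (b * a) * c \<le> 2 * (b * a) * (a * b)"
      using *[of b a] by (simp add: power2_eq_square algebra_simps)
    then show ?thesis using \<open>0 < a\<close> \<open>0 < b\<close> by simp
  next
    case True
    \<comment> \<open>When one norm is zero that choice says nothing. The inequality is then linear
      in the free weight, and the weight (b^2 + 1) / c, or (a^2 + 1) / c, contradicts it unless c =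
      0.\<close>
    have "c = 0"
    proof (rule ccontr)
      assume "c \<noteq> 0"
      then have "0 < c" using nn by simp
      from True show False
      proof
        assume "a = 0"
        then have "2 * ((b\<^sup>2 + 1) / c) * c \<le> b\<^sup>2"
          using *[of "(b\<^sup>2 + 1) / c" 1] by simp
        then have "2 * (b\<^sup>2 + 1) \<le> b\<^sup>2" using \<open>c \<noteq> 0\<close> by simp
        moreover have "0 \<le> b\<^sup>2" by simp
        ultimately show False unfolding distrib_left by linarith
      next
        assume "b = 0"
        then have "2 * ((a\<^sup>2 + 1) / c) * c \<le> a\<^sup>2"
          using *[of 1 "(a\<^sup>2 + 1) / c"] by simp
        then have "2 * (a\<^sup>2 + 1) \<le> a\<^sup>2" using \<open>c \<noteq> 0\<close> by simp
        moreover have "0 \<le> a\<^sup>2" by simp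
        ultimately show False unfolding distrib_left by linarith
      qed
    qed
    then show ?thesis using nn by simp
  qed
  then show ?thesis by (simp add: a_b_c_def)
qed

lemma inner_L2_le:
  assumes "square_integrable M f" "square_integrable M g"
  shows "\<bar>inner_L2 M f g\<bar> \<le> norm_L2 M f * norm_L2 M g"
proof -
  have "\<bar>inner_L2 M f g\<bar> \<le> (\<integral>x. norm (f x \<bullet> g x) \<partial>M)"
    unfolding inner_L2_def using integral_norm_bound[of M "\<lambda>x. f x \<bullet> g x"] by simp
  also have "\<dots> \<le> (\<integral>x. norm (f x) * norm (g x) \<partial>M)"
    using square_integrable_integrable_inner[OF assms] square_integrable_integrable_mult_norm[OF assms]
    by (intro integral_mono) (auto simp: Cauchy_Schwarz_ineq2)
  also have "\<dots> \<le> norm_L2 M f * norm_L2 M g" by (rule L2_mult_norm_le[OF assms])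
  finally show ?thesis .
qed

lemma norm_L2_triangle:
  assumes "square_integrable M f" "square_integrable M g"
  shows "norm_L2 M (\<lambda>x. f x + g x) \<le> norm_L2 M f + norm_L2 M g"
proof (rule power2_le_imp_le)
  have "(norm_L2 M (\<lambda>x. f x + g x))\<^sup>2 = (norm_L2 M f)\<^sup>2 + 2 * inner_L2 M f g + (norm_L2 M g)\<^sup>2"
    using assms by (simp flip: inner_L2_self add: inner_L2_add_left inner_L2_add_right square_integrable_add inner_L2_commute[of M g f])
  also have "\<dots> \<le> (norm_L2 M f + norm_L2 M g)\<^sup>2"
    using inner_L2_le[OF assms] by (simp add: power2_sum)
  finally show "(norm_L2 M (\<lambda>x. f x + g x))\<^sup>2 \<le> (norm_L2 M f + norm_L2 M g)\<^sup>2" .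
qed simp

lemma norm_L2_mono:
  assumes "square_integrable M f" "square_integrable M g" "\<And>x. x \<in> space M \<Longrightarrow> norm (f x) \<le> norm (g x)"
  shows "norm_L2 M f \<le> norm_L2 M g"
  unfolding norm_L2_def
  by (intro real_sqrt_le_mono integral_mono power_mono) (use assms in \<open>auto simp: square_integrable_def\<close>)

lemma norm_L2_cong_AE:
  assumes "AE x in M. f x = g x" "square_integrable M f" "square_integrable M g"
  shows "norm_L2 M f = norm_L2 M g"
  using inner_L2_cong_AE[of f g M f g] assms
  by (simp add: inner_L2_self)

lemma norm_L2_scaleR: "norm_L2 M (\<lambda>x. c *\<^sub>R f x) = \<bar>c\<bar> * norm_L2 M f"
  by (simp add: norm_L2_def power_mult_distrib real_sqrt_mult)

text \<open>Square integrability of \<open>f s\<close> has to be asked for, since otherwise the norm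
  may be 0 by default, but it is asked only eventually. The filter used later is
  \<open>at t within {0..}\<close>, so time 0 is covered.\<close>

definition converges_L2 :: "'a measure \<Rightarrow> 'b filter \<Rightarrow> ('b \<Rightarrow> 'a \<Rightarrow> complex) \<Rightarrow> ('a \<Rightarrow> complex) \<Rightarrow> bool" where
  "converges_L2 M F f f0 \<longleftrightarrow> square_integrable M f0 \<and> (\<forall>\<^sub>F s in F. square_integrable M (f s)) \<and>
     ((\<lambda>s. norm_L2 M (\<lambda>x. f s x - f0 x)) \<longlongrightarrow> 0) F"

lemma converges_L2_const: "square_integrable M f \<Longrightarrow> converges_L2 M F (\<lambda>_. f) f"
  by (simp add: converges_L2_def norm_L2_def)

lemma converges_L2_add:
  assumes "converges_L2 M F f f0" "converges_L2 M F g g0"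
  shows "converges_L2 M F (\<lambda>s x. f s x + g s x) (\<lambda>x. f0 x + g0 x)"
  unfolding converges_L2_def
proof (intro conjI)
  have f: "square_integrable M f0" "\<forall>\<^sub>F s in F. square_integrable M (f s)" and g: "square_integrable M g0" "\<forall>\<^sub>F s in F. square_integrable M (g s)"
    using assms by (auto simp: converges_L2_def)
  show "square_integrable M (\<lambda>x. f0 x + g0 x)" using f g by (simp add: square_integrable_add)
  show "\<forall>\<^sub>F s in F. square_integrable M (\<lambda>x. f s x + g s x)"
    using f(2) g(2) by eventually_elim (simp add: square_integrable_add)
  show "((\<lambda>s. norm_L2 M (\<lambda>x. f s x + g s x - (f0 x + g0 x))) \<longlongrightarrow> 0) F"
  proof (rule tendsto_sandwich[where f = "\<lambda>_. 0"])
    show "((\<lambda>s. norm_L2 M (\<lambda>x. f s x - f0 x) + norm_L2 M (\<lambda>x. g s x - g0 x)) \<longlongrightarrow> 0) F"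
      using assms tendsto_add[of "\<lambda>s. norm_L2 M (\<lambda>x. f s x - f0 x)" 0 F] by (fastforce simp: converges_L2_def)
    show "\<forall>\<^sub>F s in F. norm_L2 M (\<lambda>x. f s x + g s x - (f0 x + g0 x))
        \<le> norm_L2 M (\<lambda>x. f s x - f0 x) + norm_L2 M (\<lambda>x. g s x - g0 x)"
      using f(2) g(2)
    proof eventually_elim
      case (elim s)
      then show ?case
        using norm_L2_triangle[of M "\<lambda>x. f s x - f0 x" "\<lambda>x. g s x - g0 x"] f g
        by (simp add: square_integrable_diff algebra_simps)
    qed
  qed simp_all
qed

text \<open>The difference of the inner products is <f - f0, g - g0> + <f - f0, g0> + <f0, g - g0>,
  and each term tends to 0 by Cauchy-Schwarz.\<close>

lemma converges_L2_inner:
  assumes "converges_L2 M F f f0" "converges_L2 M F g g0"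
  shows "((\<lambda>s. inner_L2 M (f s) (g s)) \<longlongrightarrow> inner_L2 M f0 g0) F"
proof -
  have f: "square_integrable M f0" "\<forall>\<^sub>F s in F. square_integrable M (f s)" and g: "square_integrable M g0" "\<forall>\<^sub>F s in F. square_integrable M (g s)"
    using assms by (auto simp: converges_L2_def)
  define a b where "a s = norm_L2 M (\<lambda>x. f s x - f0 x)" "b s = norm_L2 M (\<lambda>x. g s x - g0 x)" for s
  have lim: "(a \<longlongrightarrow> 0) F" "(b \<longlongrightarrow> 0) F"
    using assms by (auto simp: converges_L2_def a_b_def[abs_def])
  have "((\<lambda>s. inner_L2 M (f s) (g s) - inner_L2 M f0 g0) \<longlongrightarrow> 0) F"
  proof (rule Lim_null_comparison)
    have "((\<lambda>s. a s * b s + a s * norm_L2 M g0 + norm_L2 M f0 * b s) \<longlongrightarrow> 0 * 0 + 0 * norm_L2 M g0 + norm_L2 M f0 * 0) F"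
      by (intro tendsto_intros lim)
    then show "((\<lambda>s. a s * b s + a s * norm_L2 M g0 + norm_L2 M f0 * b s) \<longlongrightarrow> 0) F" by simp
    show "\<forall>\<^sub>F s in F. norm (inner_L2 M (f s) (g s) - inner_L2 M f0 g0) \<le> a s * b s + a s * norm_L2 M g0 + norm_L2 M f0 * b s"
      using f(2) g(2)
    proof eventually_elim
      case (elim s)
      have d: "square_integrable M (\<lambda>x. f s x - f0 x)" "square_integrable M (\<lambda>x. g s x - g0 x)"
        using elim f g by (auto intro: square_integrable_diff)
      have "inner_L2 M (f s) (g s) - inner_L2 M f0 g0 = inner_L2 M (\<lambda>x. f s x - f0 x) (\<lambda>x. g s x - g0 x)
          + inner_L2 M (\<lambda>x. f s x - f0 x) g0 + inner_L2 M f0 (\<lambda>x. g s x - g0 x)"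
        using elim f g d by (simp add: inner_L2_diff_left inner_L2_diff_right)
      then show ?case
        using inner_L2_le[OF d] inner_L2_le[OF d(1) g(1)] inner_L2_le[OF f(1) d(2)]
        unfolding a_b_def real_norm_def by linarith
    qed
  qed
  then show ?thesis by (rule LIM_zero_cancel)
qed

text \<open>Splitting m g - m0 g0 = m (g - g0) + (m - m0) g0: the multiplier m is eventually bounded
  and m - m0 is uniformly small. This handles the nonlinear factor |q(s)|^2 + |q(t)|^2 as well as
  multiplication by \<i>.\<close>

lemma converges_L2_mult_uniform:
  assumes g: "converges_L2 M F g g0"
    and m: "uniform_limit (space M) m m0 F" "bounded (m0 ` space M)"
    and meas: "\<forall>\<^sub>F s in F. m s \<in> borel_measurable M" "m0 \<in> borel_measurable M"
  shows "converges_L2 M F (\<lambda>s x. m s x * g s x) (\<lambda>x. m0 x * g0 x)"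
proof -
  have gs: "square_integrable M g0" "\<forall>\<^sub>F s in F. square_integrable M (g s)" using g by (auto simp: converges_L2_def)
  obtain B where B: "\<And>x. x \<in> space M \<Longrightarrow> norm (m0 x) \<le> B"
    using m(2) unfolding bounded_iff by auto
  have near: "\<forall>\<^sub>F s in F. \<forall>x\<in>space M. norm (m s x - m0 x) < e" if "0 < e" for e
    using uniform_limitD[OF m(1) that] by (simp add: dist_norm)
  have s0: "square_integrable M (\<lambda>x. m0 x * g0 x)"
    by (rule square_integrable_bound[OF gs(1), where C = B])
       (use B meas gs in \<open>auto simp: norm_mult square_integrable_def intro!: mult_right_mono\<close>)
  have bd: "norm (m s x) \<le> B + 1" if "\<forall>x\<in>space M. norm (m s x - m0 x) < 1" "x \<in> space M" for s x
    using that B[of x] norm_triangle_sub[of "m s x" "m0 x"] by fastforce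
  have s1: "\<forall>\<^sub>F s in F. square_integrable M (\<lambda>x. m s x * g s x)"
    using near[of 1, simplified] gs(2) meas(1)
  proof eventually_elim
    case (elim s)
    show ?case
      by (rule square_integrable_bound[of M "g s" _ "B + 1"])
         (use elim bd in \<open>auto simp: norm_mult square_integrable_def intro!: mult_right_mono\<close>)
  qed
  have "((\<lambda>s. norm_L2 M (\<lambda>x. m s x * g s x - m0 x * g0 x)) \<longlongrightarrow> 0) F"
  proof (rule tendstoI)
    fix e :: real assume "0 < e"
    \<comment> \<open>The extra 1 keeps the quotient meaningful when \<open>g0\<close> has norm 0
      and makes the bound by e / 2 strict.\<close>
    define d where "d = e / (2 * (norm_L2 M g0 + 1))"
    have "0 < norm_L2 M g0 + 1" using norm_L2_nonneg[of M g0] by linarith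
    then have d: "0 < d" "d * norm_L2 M g0 < e / 2"
      using \<open>0 < e\<close> by (auto simp: d_def field_simps)
    have "((\<lambda>s. (\<bar>B\<bar> + 1) * norm_L2 M (\<lambda>x. g s x - g0 x)) \<longlongrightarrow> (\<bar>B\<bar> + 1) * 0) F"
      using g by (intro tendsto_intros) (simp add: converges_L2_def)
    then have "\<forall>\<^sub>F s in F. (\<bar>B\<bar> + 1) * norm_L2 M (\<lambda>x. g s x - g0 x) < e / 2"
      using order_tendstoD(2)[of _ 0 F "e / 2"] \<open>0 < e\<close> by simp
    then show "\<forall>\<^sub>F s in F. dist (norm_L2 M (\<lambda>x. m s x * g s x - m0 x * g0 x)) 0 < e"
      using near[of 1, simplified] near[OF d(1)] gs(2) meas(1) s1
    proof eventually_elim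
      case (elim s)
      note [measurable] = square_integrable_measurable[OF elim(4)] square_integrable_measurable[OF gs(1)] elim(5) meas(2)
      let ?u = "\<lambda>x. m s x * (g s x - g0 x)" and ?w = "\<lambda>x. (m s x - m0 x) * g0 x"
      have dg: "square_integrable M (\<lambda>x. g s x - g0 x)" using elim gs by (intro square_integrable_diff)
      have le: "norm (?u x) \<le> (\<bar>B\<bar> + 1) * norm (g s x - g0 x)" "norm (?w x) \<le> d * norm (g0 x)"
        if "x \<in> space M" for x
      proof -
        have "norm (m s x) \<le> \<bar>B\<bar> + 1" "norm (m s x - m0 x) \<le> d"
          using bd[OF elim(2) that] bspec[OF elim(3) that] by linarith+
        then show "norm (?u x) \<le> (\<bar>B\<bar> + 1) * norm (g s x - g0 x)" "norm (?w x) \<le> d * norm (g0 x)"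
          by (auto simp: norm_mult intro!: mult_right_mono)
      qed
      have u: "square_integrable M ?u" and w: "square_integrable M ?w"
        by (rule square_integrable_bound[OF dg _ le(1)], measurable) (rule square_integrable_bound[OF gs(1) _ le(2)], measurable)
      have "norm_L2 M (\<lambda>x. m s x * g s x - m0 x * g0 x) = norm_L2 M (\<lambda>x. ?u x + ?w x)"
        by (simp add: algebra_simps)
      also have "\<dots> \<le> norm_L2 M ?u + norm_L2 M ?w" by (rule norm_L2_triangle[OF u w])
      also have "norm_L2 M ?u \<le> norm_L2 M (\<lambda>x. (\<bar>B\<bar> + 1) *\<^sub>R (g s x - g0 x))"
        by (rule norm_L2_mono[OF u square_integrable_scaleR[OF dg]]) (use le(1) in auto)
      also have "norm_L2 M ?w \<le> norm_L2 M (\<lambda>x. d *\<^sub>R g0 x)"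
        by (rule norm_L2_mono[OF w square_integrable_scaleR[OF gs(1)]]) (use le(2) d(1) in auto)
      finally show ?case
        using elim(1) d by (simp add: norm_L2_scaleR)
    qed
  qed
  with s0 s1 show ?thesis by (simp add: converges_L2_def)
qed


section \<open>Absolutely continuous functions on the half line\<close>

text \<open>Restricting the measure, rather than multiplying by indicators, lets the L2 lemmas for
  an arbitrary measure apply to the half line in x and later to bounded intervals in t.\<close>

definition half :: "real measure" where
  "half = restrict_space lborel {0<..}"

lemma space_half [simp]: "space half = {0<..}"
  by (simp add: half_def space_restrict_space)

lemma measurable_half: "f \<in> borel_measurable borel \<Longrightarrow> f \<in> borel_measurable half"
  unfolding half_def by (rule measurable_restrict_space1) simp

lemma sets_half: "A \<in> sets borel \<Longrightarrow> A \<subseteq> {0<..} \<Longrightarrow> A \<in> sets half"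
  by (auto simp: half_def sets_restrict_space)

lemma continuous_on_measurable_half:
  assumes "continuous_on {0..} f"
  shows "f \<in> borel_measurable half"
proof -
  have "f \<in> borel_measurable (restrict_space borel {0<..})"
    by (rule borel_measurable_continuous_on_restrict) (rule continuous_on_subset[OF assms], auto)
  moreover have "sets half = sets (restrict_space borel {0<..})"
    by (simp add: half_def sets_restrict_space)
  ultimately show ?thesis
    using measurable_cong_sets by blast
qed

lemma indicator_measurable_half [measurable]:
  "(indicator {..b} :: real \<Rightarrow> real) \<in> borel_measurable half"
  by (rule measurable_half) measurable

lemma sigma_finite_half: "sigma_finite_measure half"
  unfolding half_def
  by (rule sigma_finite_measure_restrict_space[OF lborel.sigma_finite_measure_axioms]) simp

interpretation half: sigma_finite_measure half
  by (rule sigma_finite_half)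

interpretation half: pair_sigma_finite half half ..

lemma AE_half_iff: "(AE x in half. P x) \<longleftrightarrow> (AE x in lborel. 0 < x \<longrightarrow> P x)"
  unfolding half_def by (subst AE_restrict_space_iff) auto

lemma AE_half_neq: "AE x in half. x \<noteq> a"
  unfolding AE_half_iff using AE_lborel_singleton[of a] by eventually_elim auto

lemma emeasure_half_Icc: "0 < a \<Longrightarrow> a \<le> b \<Longrightarrow> emeasure half {a..b} = ennreal (b - a)"
  unfolding half_def by (subst emeasure_restrict_space) auto

lemma integrable_indicator_half: "integrable half (indicator {..b} :: real \<Rightarrow> real)"
proof -
  have *: "indicator {0<..} x *\<^sub>R indicator {..b} x = (indicator {0<..b} x :: real)" for x
    by (auto simp: indicator_def)
  have "integrable lborel (indicator {0<..b} :: real \<Rightarrow> real)"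
    by (rule integrable_real_indicator) (cases "0 \<le> b"; simp)+
  then show ?thesis
    by (simp add: half_def integrable_restrict_space * del: scaleR_conv_of_real real_scaleR_def)
qed

text \<open>Integrability up to the endpoint 0, which is what gives antiderivatives a value at 0;
  \<open>locally_integrable\<close> only controls intervals [a,b] with a > 0.\<close>

definition loc_integrable_half :: "(real \<Rightarrow> complex) \<Rightarrow> bool" where
  "loc_integrable_half f \<longleftrightarrow> (\<forall>b. integrable half (\<lambda>x. indicator {..b} x *\<^sub>R f x))"

definition cumul :: "(real \<Rightarrow> complex) \<Rightarrow> real \<Rightarrow> complex" where
  "cumul f b = (\<integral>x. indicator {..b} x *\<^sub>R f x \<partial>half)"

text \<open>Absolute continuity on [0,\<infinity>) in integrated form. Nothing is asked of pointwise
  derivatives, since q_xx is only an L2 function.\<close>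

definition antideriv :: "(real \<Rightarrow> complex) \<Rightarrow> (real \<Rightarrow> complex) \<Rightarrow> bool" where
  "antideriv F f \<longleftrightarrow> loc_integrable_half f \<and> (\<forall>x\<ge>0. F x - F 0 = cumul f x)"

lemma antideriv_eq: "antideriv F f \<Longrightarrow> 0 \<le> x \<Longrightarrow> F x = F 0 + cumul f x"
  unfolding antideriv_def by (metis add.commute diff_add_cancel)

lemma antideriv_loc_integrable_half: "antideriv F f \<Longrightarrow> loc_integrable_half f"
  by (simp add: antideriv_def)

lemma cumul_0 [simp]: "cumul f 0 = 0"
proof -
  have "cumul f 0 = (\<integral>x. 0 \<partial>half)"
    unfolding cumul_def by (rule Bochner_Integration.integral_cong) auto
  then show ?thesis by simp
qed

lemma loc_integrable_half_integrable: "integrable half f \<Longrightarrow> loc_integrable_half f"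
  unfolding loc_integrable_half_def
proof
  fix b assume f: "integrable half f"
  note [measurable] = borel_measurable_integrable[OF f]
  show "integrable half (\<lambda>x. indicator {..b} x *\<^sub>R f x)"
    by (rule Bochner_Integration.integrable_bound[OF f], measurable) (auto simp: indicator_def)
qed

lemma loc_integrable_half_add: "loc_integrable_half f \<Longrightarrow> loc_integrable_half g \<Longrightarrow> loc_integrable_half (\<lambda>x. f x + g x)"
  by (simp add: loc_integrable_half_def scaleR_add_right)

lemma loc_integrable_half_diff: "loc_integrable_half f \<Longrightarrow> loc_integrable_half g \<Longrightarrow> loc_integrable_half (\<lambda>x. f x - g x)"
  by (simp add: loc_integrable_half_def scaleR_diff_right)

lemma loc_integrable_half_measurable:
  assumes "loc_integrable_half f"
  shows "f \<in> borel_measurable half"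
proof (rule borel_measurable_LIMSEQ_metric)
  show "(\<lambda>x. indicator {..real n} x *\<^sub>R f x) \<in> borel_measurable half" for n
    using assms borel_measurable_integrable unfolding loc_integrable_half_def by blast
  fix x :: real
  obtain N where "x \<le> real N" using real_arch_simple by blast
  then have "\<forall>\<^sub>F n in sequentially. indicator {..real n} x *\<^sub>R f x = f x"
    by (intro eventually_sequentiallyI[of N]) (auto simp: indicator_def)
  then show "(\<lambda>n. indicator {..real n} x *\<^sub>R f x) \<longlonglongrightarrow> f x"
    by (rule tendsto_eventually)
qed

lemma cumul_add: "loc_integrable_half f \<Longrightarrow> loc_integrable_half g \<Longrightarrow> cumul (\<lambda>x. f x + g x) b = cumul f b + cumul g b"
  by (simp add: loc_integrable_half_def cumul_def scaleR_add_right)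

lemma cumul_diff: "loc_integrable_half f \<Longrightarrow> loc_integrable_half g \<Longrightarrow> cumul (\<lambda>x. f x - g x) b = cumul f b - cumul g b"
  by (simp add: loc_integrable_half_def cumul_def scaleR_diff_right)

lemma square_integrable_indicator: "square_integrable half (\<lambda>x. of_real (indicator {..b} x))"
proof -
  have "(norm (of_real (indicator {..b} x) :: complex))\<^sup>2 = indicator {..b} x" for x :: real
    by (simp add: indicator_def)
  moreover have "(\<lambda>x. of_real (indicator {..b} x) :: complex) \<in> borel_measurable half" by measurable
  ultimately show ?thesis unfolding square_integrable_def using integrable_indicator_half by simp
qed

lemma square_integrable_loc_integrable_half: "square_integrable half f \<Longrightarrow> loc_integrable_half f"
  unfolding loc_integrable_half_def using square_integrable_integrable_mult[OF square_integrable_indicator]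
  by (simp add: scaleR_conv_of_real)

lemma loc_integrable_half_mult_continuous:
  assumes f: "loc_integrable_half f" and g: "continuous_on {0..} g"
  shows "loc_integrable_half (\<lambda>x. f x * g x)"
  unfolding loc_integrable_half_def
proof
  fix b
  note [measurable] = loc_integrable_half_measurable[OF f] continuous_on_measurable_half[OF g]
  have "compact (g ` {0..b})"
    by (intro compact_continuous_image continuous_on_subset[OF g]) auto
  then obtain B where B: "\<And>x. 0 \<le> x \<Longrightarrow> x \<le> b \<Longrightarrow> norm (g x) \<le> B"
    using compact_imp_bounded[of "g ` {0..b}"] unfolding bounded_iff by (metis atLeastAtMost_iff image_eqI)
  show "integrable half (\<lambda>x. indicator {..b} x *\<^sub>R (f x * g x))"
  proof (rule Bochner_Integration.integrable_bound)
    show "integrable half (\<lambda>x. B * norm (indicator {..b} x *\<^sub>R f x))"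
      using f unfolding loc_integrable_half_def by (intro integrable_mult_right integrable_norm) blast
    show "AE x in half. norm (indicator {..b} x *\<^sub>R (f x * g x)) \<le> norm (B * norm (indicator {..b} x *\<^sub>R f x))"
    proof (rule AE_I2)
      fix x assume "x \<in> space half"
      then have x: "0 < x" by simp
      show "norm (indicator {..b} x *\<^sub>R (f x * g x)) \<le> norm (B * norm (indicator {..b} x *\<^sub>R f x))"
      proof (cases "x \<le> b")
        case True
        have "norm (g x) \<le> \<bar>B\<bar>" using B[of x] x True by linarith
        then have "norm (g x) * norm (f x) \<le> \<bar>B\<bar> * norm (f x)" by (intro mult_right_mono) auto
        then show ?thesis using True by (simp add: norm_mult abs_mult mult.commute)
      qed simp
    qed
  qed measurable
qed

text \<open>The diagonal splits the square into two triangles.\<close>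

lemma integral_mult_triangles:
  assumes f: "integrable half f" and g: "integrable half g"
  shows "(\<integral>x. f x \<partial>half) * (\<integral>x. g x \<partial>half)
    = (\<integral>x. f x * cumul g x \<partial>half) + (\<integral>x. g x * cumul f x \<partial>half)"
proof -
  note [measurable] = borel_measurable_integrable[OF f] borel_measurable_integrable[OF g]
  define k :: "real \<Rightarrow> real \<Rightarrow> complex" where "k x y = f x * g y" for x y
  have k: "integrable (half \<Otimes>\<^sub>M half) (case_prod k)"
  proof (rule half.Fubini_integrable)
    show "case_prod k \<in> borel_measurable (half \<Otimes>\<^sub>M half)"
      unfolding k_def by measurable
    show "integrable half (\<lambda>x. \<integral>y. norm (case_prod k (x, y)) \<partial>half)"
      using f by (simp add: k_def norm_mult)
    show "AE x in half. integrable half (\<lambda>y. case_prod k (x, y))"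
      using g by (simp add: k_def)
  qed
  have le_meas: "{z \<in> space (half \<Otimes>\<^sub>M half). snd z \<le> fst z} \<in> sets (half \<Otimes>\<^sub>M half)"
  proof -
    have [measurable]: "(\<lambda>x::real. x) \<in> borel_measurable half" by (rule measurable_half) simp
    show ?thesis by measurable
  qed
  define k1 where "k1 x y = (if y \<le> x then k x y else 0)" for x y
  define k2 where "k2 x y = (if y \<le> x then 0 else k x y)" for x y
  have k1: "integrable (half \<Otimes>\<^sub>M half) (case_prod k1)"
  proof -
    have "integrable (half \<Otimes>\<^sub>M half) (\<lambda>z. indicator {z \<in> space (half \<Otimes>\<^sub>M half). snd z \<le> fst z} z *\<^sub>R case_prod k z)"
      by (rule integrable_mult_indicator[OF le_meas k])
    also have "?this \<longleftrightarrow> ?thesis"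
      by (rule Bochner_Integration.integrable_cong) (auto simp: k1_def indicator_def)
    finally show ?thesis .
  qed
  have k2: "integrable (half \<Otimes>\<^sub>M half) (case_prod k2)"
  proof -
    have "case_prod k2 = (\<lambda>z. case_prod k z - case_prod k1 z)"
      by (auto simp: k1_def k2_def)
    then show ?thesis by (simp only: Bochner_Integration.integrable_diff[OF k k1])
  qed
  have e1: "(\<integral>y. k1 x y \<partial>half) = f x * cumul g x" for x
  proof -
    have "(\<integral>y. k1 x y \<partial>half) = (\<integral>y. f x * (indicator {..x} y *\<^sub>R g y) \<partial>half)"
      by (rule Bochner_Integration.integral_cong) (auto simp: k1_def k_def indicator_def)
    then show ?thesis by (simp add: cumul_def del: mult_scaleR_right)
  qed
  have e2: "(\<integral>x. k2 x y \<partial>half) = g y * cumul f y" for y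
  proof -
    have "(\<integral>x. k2 x y \<partial>half) = (\<integral>x. g y * (indicator {..y} x *\<^sub>R f x) \<partial>half)"
    proof (rule integral_cong_AE)
      \<comment> \<open>\<open>k2\<close> leaves out the diagonal, whereas \<open>cumul f y\<close>
        includes the point x = y; this is a null set.\<close>
      show "AE x in half. k2 x y = g y * (indicator {..y} x *\<^sub>R f x)"
        using AE_half_neq[of y] by eventually_elim (auto simp: k2_def k_def indicator_def)
      show "(\<lambda>x. g y * (indicator {..y} x *\<^sub>R f x)) \<in> borel_measurable half" by measurable
      have "k2 x y = (1 - indicator {y..} x) *\<^sub>R (f x * g y)" for x
        by (auto simp: k2_def k_def indicator_def)
      moreover have "(indicator {y..} :: real \<Rightarrow> real) \<in> borel_measurable half"
        by (rule measurable_half) measurable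
      ultimately show "(\<lambda>x. k2 x y) \<in> borel_measurable half" by simp
    qed
    then show ?thesis by (simp add: cumul_def del: mult_scaleR_right)
  qed
  have "(\<integral>x. f x \<partial>half) * (\<integral>x. g x \<partial>half) = (\<integral>x. (\<integral>y. k x y \<partial>half) \<partial>half)"
    by (simp add: k_def)
  also have "\<dots> = integral\<^sup>L (half \<Otimes>\<^sub>M half) (case_prod k)"
    using half.integral_fst[OF k] by simp
  also have "\<dots> = integral\<^sup>L (half \<Otimes>\<^sub>M half) (\<lambda>z. case_prod k1 z + case_prod k2 z)"
    by (rule Bochner_Integration.integral_cong) (auto simp: k1_def k2_def)
  also have "\<dots> = integral\<^sup>L (half \<Otimes>\<^sub>M half) (case_prod k1) + integral\<^sup>L (half \<Otimes>\<^sub>M half) (case_prod k2)"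
    by (rule Bochner_Integration.integral_add[OF k1 k2])
  also have "integral\<^sup>L (half \<Otimes>\<^sub>M half) (case_prod k1) = (\<integral>x. f x * cumul g x \<partial>half)"
    using half.integral_fst[OF k1] by (simp add: e1)
  also have "integral\<^sup>L (half \<Otimes>\<^sub>M half) (case_prod k2) = (\<integral>x. g x * cumul f x \<partial>half)"
    using half.integral_snd[OF k2] by (simp add: e2)
  finally show "(\<integral>x. f x \<partial>half) * (\<integral>x. g x \<partial>half)
    = (\<integral>x. f x * cumul g x \<partial>half) + (\<integral>x. g x * cumul f x \<partial>half)" .
qed

text \<open>Dominated convergence along sequences: a convergent sequence is bounded by some
  \<open>B\<close>, and the indicators of \<open>{..u n}\<close> converge at every point except
  possibly \<open>a\<close>, a null set.\<close>

lemma continuous_on_cumul: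
  assumes "loc_integrable_half f"
  shows "continuous_on A (cumul f)"
proof (rule continuous_on_sequentiallyI)
  fix u :: "nat \<Rightarrow> real" and a assume u: "u \<longlonglongrightarrow> a"
  note [measurable] = loc_integrable_half_measurable[OF assms]
  obtain B where B: "\<And>n. u n \<le> B"
    using convergent_imp_Bseq[OF convergentI[OF u]] unfolding Bseq_def
    by (metis abs_le_D1 real_norm_def)
  show "(\<lambda>n. cumul f (u n)) \<longlonglongrightarrow> cumul f a"
    unfolding cumul_def
  proof (rule integral_dominated_convergence)
    show "integrable half (\<lambda>x. norm (indicator {..B} x *\<^sub>R f x))"
      using assms unfolding loc_integrable_half_def by (intro integrable_norm) blast
    show "AE x in half. norm (indicator {..u n} x *\<^sub>R f x) \<le> norm (indicator {..B} x *\<^sub>R f x)" for n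
      using B[of n] by (auto simp: indicator_def)
    show "AE x in half. (\<lambda>n. indicator {..u n} x *\<^sub>R f x) \<longlonglongrightarrow> indicator {..a} x *\<^sub>R f x"
      using AE_half_neq[of a]
    proof eventually_elim
      case (elim x)
      have "\<forall>\<^sub>F n in sequentially. indicator {..u n} x = (indicator {..a} x :: real)"
      proof (cases "x < a")
        case True
        show ?thesis using order_tendstoD(1)[OF u True] True by (auto elim!: eventually_mono)
      next
        case False
        with elim have "a < x" by simp
        show ?thesis using order_tendstoD(2)[OF u \<open>a < x\<close>] \<open>a < x\<close> by (auto elim!: eventually_mono)
      qed
      then have "\<forall>\<^sub>F n in sequentially. indicator {..u n} x *\<^sub>R f x = indicator {..a} x *\<^sub>R f x"
        by eventually_elim simp
      then show ?case by (rule tendsto_eventually)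
    qed
  qed measurable
qed

lemma antideriv_cumul: "loc_integrable_half f \<Longrightarrow> antideriv (\<lambda>x. c + cumul f x) f"
  by (simp add: antideriv_def)

lemma antideriv_continuous:
  assumes "antideriv F f"
  shows "continuous_on {0..} F"
proof -
  have "continuous_on {0..} (\<lambda>x. F 0 + cumul f x)"
    using assms by (intro continuous_intros continuous_on_cumul) (simp add: antideriv_def)
  also have "?this \<longleftrightarrow> ?thesis"
    by (rule continuous_on_cong) (auto simp: antideriv_eq[OF assms, symmetric])
  finally show ?thesis .
qed

text \<open>The product rule without pointwise derivatives: after cutting f and g off at b, the
  product of the increments of F and G is an integral over a square, and its two triangles give f (G
  - G 0) and g (F - F 0).\<close>

lemma antideriv_mult:
  assumes F: "antideriv F f" and G: "antideriv G g"
  shows "antideriv (\<lambda>x. F x * G x) (\<lambda>x. f x * G x + g x * F x)"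
  unfolding antideriv_def
proof (intro conjI allI impI)
  have lf: "loc_integrable_half f" "loc_integrable_half g" using F G by (auto simp: antideriv_def)
  have c: "continuous_on {0..} F" "continuous_on {0..} G" using F G by (auto intro: antideriv_continuous)
  have l: "loc_integrable_half (\<lambda>x. f x * G x)" "loc_integrable_half (\<lambda>x. g x * F x)"
    using lf c by (auto intro: loc_integrable_half_mult_continuous)
  then show "loc_integrable_half (\<lambda>x. f x * G x + g x * F x)" by (rule loc_integrable_half_add)
  fix b :: real assume b: "0 \<le> b"
  define f1 g1 where "f1 x = indicator {..b} x *\<^sub>R f x" "g1 x = indicator {..b} x *\<^sub>R g x" for x
  have int: "integrable half f1" "integrable half g1"
    using lf by (auto simp: loc_integrable_half_def f1_g1_def[abs_def])
  have cum1: "cumul f1 x = cumul f x" "cumul g1 x = cumul g x" if "x \<le> b" for x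
    unfolding cumul_def f1_g1_def by (rule Bochner_Integration.integral_cong; use that in \<open>auto simp: indicator_def\<close>)+
  \<comment> \<open>One triangle: \<open>cumul w\<close> is W - W 0, and the constant
    \<open>W 0\<close> splits off.\<close>
  have part: "(\<integral>x. u1 x * cumul w1 x \<partial>half) = cumul (\<lambda>x. u x * W x) b - W 0 * cumul u b"
    if u1: "\<And>x. u1 x = indicator {..b} x *\<^sub>R u x" and w1: "\<And>x. x \<le> b \<Longrightarrow> cumul w1 x = cumul w x"
      and W: "antideriv W w" and u: "loc_integrable_half u" for u1 w1 u w W
  proof -
    have "(\<integral>x. u1 x * cumul w1 x \<partial>half)
      = (\<integral>x. indicator {..b} x *\<^sub>R (u x * W x) - W 0 * (indicator {..b} x *\<^sub>R u x) \<partial>half)"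
    proof (rule Bochner_Integration.integral_cong)
      fix x assume "x \<in> space half"
      then have W0: "cumul w x = W x - W 0" using antideriv_eq[OF W, of x] by simp
      then show "u1 x * cumul w1 x = indicator {..b} x *\<^sub>R (u x * W x) - W 0 * (indicator {..b} x *\<^sub>R u x)"
        by (cases "x \<le> b") (auto simp: u1 w1 W0 algebra_simps)
    qed simp
    also have "\<dots> = cumul (\<lambda>x. u x * W x) b - W 0 * cumul u b"
      unfolding cumul_def
      using u loc_integrable_half_mult_continuous[OF u antideriv_continuous[OF W]]
      by (subst Bochner_Integration.integral_diff) (auto simp: loc_integrable_half_def simp del: mult_scaleR_right)
    finally show ?thesis .
  qed
  have "cumul f b * cumul g b = (cumul (\<lambda>x. f x * G x) b - G 0 * cumul f b)
      + (cumul (\<lambda>x. g x * F x) b - F 0 * cumul g b)"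
    using integral_mult_triangles[OF int] part[OF f1_g1_def(1) cum1(2) G lf(1)] part[OF f1_g1_def(2) cum1(1) F lf(2)]
    by (simp add: cumul_def f1_g1_def)
  moreover have "cumul f b = F b - F 0" "cumul g b = G b - G 0"
    using antideriv_eq[OF F b] antideriv_eq[OF G b] by simp_all
  ultimately show "F b * G b - F 0 * G 0 = cumul (\<lambda>x. f x * G x + g x * F x) b"
    using l by (simp add: cumul_add algebra_simps)
qed

lemma antideriv_cnj:
  assumes "antideriv F f"
  shows "antideriv (\<lambda>x. cnj (F x)) (\<lambda>x. cnj (f x))"
proof -
  have e: "indicat_real {..b} x *\<^sub>R cnj (f x) = cnj (indicat_real {..b} x *\<^sub>R f x)" for b x
    by simp
  have "loc_integrable_half (\<lambda>x. cnj (f x))"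
    unfolding loc_integrable_half_def e complex_integrable_cnj
    using antideriv_loc_integrable_half[OF assms] by (simp add: loc_integrable_half_def)
  moreover have "cumul (\<lambda>x. cnj (f x)) b = cnj (cumul f b)" for b
    unfolding cumul_def e by (rule Bochner_Integration.integral_cnj)
  ultimately show ?thesis
    using assms by (simp add: antideriv_def flip: complex_cnj_diff)
qed

lemma antideriv_diff:
  "antideriv F f \<Longrightarrow> antideriv G g \<Longrightarrow> antideriv (\<lambda>x. F x - G x) (\<lambda>x. f x - g x)"
  by (simp add: antideriv_def loc_integrable_half_diff cumul_diff) (metis add_diff_add diff_add_eq diff_diff_eq2 diff_diff_add add.commute)

text \<open>Passage to the gauge integral, through which the fundamental theorem of calculus becomes
  available; the endpoint 0, absent from \<open>half\<close>, is a null set.\<close>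

lemma cumul_continuous_eq_integral:
  assumes f: "continuous_on {0..} f" and "0 \<le> b"
  shows "cumul f b = integral {0..b} f"
proof -
  have s: "set_integrable lborel {0..b} f"
    by (rule borel_integrable_atLeastAtMost') (rule continuous_on_subset[OF f], auto)
  have "cumul f b = (\<integral>x. indicator {0<..} x *\<^sub>R (indicator {..b} x *\<^sub>R f x) \<partial>lborel)"
    unfolding cumul_def half_def by (rule integral_restrict_space) simp
  also have "\<dots> = (LBINT x:{0<..b}. f x)"
    unfolding set_lebesgue_integral_def by (rule Bochner_Integration.integral_cong) (auto simp: indicator_def)
  also have "\<dots> = (LBINT x:{0..b}. f x)"
  proof (rule set_integral_cong_set)
    have m: "set_borel_measurable lborel {0..b} f"
      using s by (auto simp: set_integrable_def set_borel_measurable_def)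
    then show "set_borel_measurable lborel {0..b} f" .
    show "set_borel_measurable lborel {0<..b} f"
      by (rule set_borel_measurable_subset[OF m]) auto
    show "AE x in lborel. (x \<in> {0..b}) = (x \<in> {0<..b})"
      using AE_lborel_singleton[of 0] by eventually_elim auto
  qed
  also have "\<dots> = integral {0..b} f" by (rule set_borel_integral_eq_integral(2)[OF s])
  finally show ?thesis .
qed

lemma loc_integrable_half_continuous:
  assumes "continuous_on {0..} f"
  shows "loc_integrable_half f"
proof -
  have "loc_integrable_half (\<lambda>_. 1 :: complex)"
    using square_integrable_integrable_mult[OF square_integrable_indicator square_integrable_indicator] integrable_indicator_half
    unfolding loc_integrable_half_def by (simp add: scaleR_conv_of_real complex_of_real_integrable_eq)
  from loc_integrable_half_mult_continuous[OF this assms] show ?thesis by simp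
qed

lemma antideriv_C1:
  assumes "continuous_on {0..} f"
    and F: "\<And>x. 0 \<le> x \<Longrightarrow> (F has_vector_derivative f x) (at x within {0..})"
  shows "antideriv F f"
  unfolding antideriv_def
proof (intro conjI allI impI loc_integrable_half_continuous assms(1))
  fix b :: real assume b: "0 \<le> b"
  have "(f has_integral F b - F 0) {0..b}"
    by (rule fundamental_theorem_of_calculus[OF b])
       (auto intro: has_vector_derivative_within_subset[OF F])
  then show "F b - F 0 = cumul f b"
    using cumul_continuous_eq_integral[OF assms(1) b] by (simp add: integral_unique)
qed

text \<open>Continuity of the density is asked for because \<open>bdry_dx\<close> is a classical
  one-sided derivative. For profiles in H2 the density q_x is continuous, being an antiderivative
  itself.\<close>

lemma antideriv_has_vector_derivative_0:
  assumes "antideriv F f" "continuous_on {0..} f"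
  shows "(F has_vector_derivative f 0) (at 0 within {0..})"
proof -
  have c: "continuous_on {0..1} f" by (rule continuous_on_subset[OF assms(2)]) auto
  have "((\<lambda>u. F 0 + integral {0..u} f) has_vector_derivative f 0) (at 0 within {0..1})"
    using has_vector_derivative_add[OF has_vector_derivative_const integral_has_vector_derivative[OF c]] by simp
  then have "(F has_vector_derivative f 0) (at 0 within {0..1})"
  proof (rule has_vector_derivative_transform[rotated -1])
    show "F x = F 0 + integral {0..x} f" if "x \<in> {0..1}" for x
      using that cumul_continuous_eq_integral[OF assms(2), of x] antideriv_eq[OF assms(1), of x] by auto
  qed simp
  moreover have "at 0 within {0..1} = at (0::real) within {0..}"
    by (rule at_within_nhd[where S = "{..<1}"]) auto
  ultimately show ?thesis by simp
qed

text \<open>A nonzero limit keeps |F| above |L| / 2 on a half line, and integrating over intervals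
  of length n exceeds every bound.\<close>

lemma integrable_limit_zero:
  assumes F: "integrable half F" and lim: "(F \<longlongrightarrow> (L::complex)) at_top"
  shows "L = 0"
proof (rule ccontr)
  assume "L \<noteq> 0"
  define c where "c = norm L / 2"
  have "0 < c" using \<open>L \<noteq> 0\<close> by (simp add: c_def)
  have "\<forall>\<^sub>F x in at_top. dist (F x) L < c" by (rule tendstoD[OF lim \<open>0 < c\<close>])
  then obtain X where X: "\<And>x. X \<le> x \<Longrightarrow> dist (F x) L < c"
    by (auto simp: eventually_at_top_linorder)
  have ge: "c \<le> norm (F x)" if "X \<le> x" for x
    using X[OF that] norm_triangle_sub[of L "F x"] by (simp add: c_def dist_norm norm_minus_commute)
  define Y where "Y = max X 1"
  have Y: "0 < Y" "X \<le> Y" by (auto simp: Y_def)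
  have le: "real n * c \<le> (\<integral>x. norm (F x) \<partial>half)" for n
  proof -
    have A: "{Y..Y + real n} \<in> sets half" by (rule sets_half) (use Y in auto)
    have em: "emeasure half {Y..Y + real n} = ennreal (real n)"
      using emeasure_half_Icc[of Y "Y + real n"] Y by simp
    have "real n * c = (\<integral>x. c * indicator {Y..Y + real n} x \<partial>half)"
    proof -
      have "{Y..Y + real n} \<inter> {0<..} = {Y..Y + real n}" using Y by auto
      then show ?thesis using em by (simp add: measure_def)
    qed
    also have "\<dots> \<le> (\<integral>x. norm (F x) \<partial>half)"
    proof (rule integral_mono)
      show "integrable half (\<lambda>x. c * indicator {Y..Y + real n} x)"
        by (intro integrable_mult_right integrable_real_indicator A) (simp add: em)
      show "integrable half (\<lambda>x. norm (F x))" using F by simp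
      show "c * indicator {Y..Y + real n} x \<le> norm (F x)" for x
        using ge[of x] Y by (auto simp: indicator_def)
    qed
    finally show ?thesis .
  qed
  obtain n where "(\<integral>x. norm (F x) \<partial>half) / c < real n" using reals_Archimedean2 by blast
  then show False using le[of n] \<open>0 < c\<close> by (simp add: field_simps)
qed

text \<open>Integrability of f gives F a limit at infinity, and integrability of F forces it to be
  0. This is why integration by parts produces no boundary term at infinity.\<close>

lemma antideriv_integrable:
  assumes F: "antideriv F f" "integrable half F" "integrable half f"
  shows "(\<integral>x. f x \<partial>half) = - F 0"
proof -
  note [measurable] = borel_measurable_integrable[OF F(3)]
  have "((\<lambda>b. cumul f b) \<longlongrightarrow> (\<integral>x. f x \<partial>half)) at_top"
    unfolding cumul_def
  proof (rule integral_dominated_convergence_at_top)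
    show "integrable half (\<lambda>x. norm (f x))" using F(3) by simp
    show "\<forall>\<^sub>F b in at_top. AE x in half. norm (indicator {..b} x *\<^sub>R f x) \<le> norm (f x)"
      by (auto simp: indicator_def)
    show "AE x in half. ((\<lambda>b. indicator {..b} x *\<^sub>R f x) \<longlongrightarrow> f x) at_top"
    proof (rule AE_I2)
      fix x :: real
      have "\<forall>\<^sub>F b in at_top. indicator {..b} x *\<^sub>R f x = f x"
        using eventually_ge_at_top[of x] by eventually_elim simp
      then show "((\<lambda>b. indicator {..b} x *\<^sub>R f x) \<longlongrightarrow> f x) at_top" by (rule tendsto_eventually)
    qed
  qed measurable
  then have "((\<lambda>b. F 0 + cumul f b) \<longlongrightarrow> F 0 + (\<integral>x. f x \<partial>half)) at_top"
    by (intro tendsto_intros)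
  then have "(F \<longlongrightarrow> F 0 + (\<integral>x. f x \<partial>half)) at_top"
  proof (rule Lim_transform_eventually)
    show "\<forall>\<^sub>F b in at_top. F 0 + cumul f b = F b"
      using eventually_ge_at_top[of 0] by eventually_elim (simp add: antideriv_eq[OF F(1), symmetric])
  qed
  from integrable_limit_zero[OF F(2) this] show ?thesis
    by (simp only: add_eq_0_iff)
qed

section \<open>H1 functions on the half line: integration by parts and the sup bound\<close>

definition H1 :: "(real \<Rightarrow> complex) \<Rightarrow> (real \<Rightarrow> complex) \<Rightarrow> bool" where
  "H1 F f \<longleftrightarrow> antideriv F f \<and> square_integrable half F \<and> square_integrable half f"

lemma H1_parts_complex:
  assumes F: "H1 F f" and G: "H1 G g"
  shows "(\<integral>x. f x * G x + g x * F x \<partial>half) = - (F 0 * G 0)"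
  by (rule antideriv_integrable[OF antideriv_mult])
     (use F G in \<open>auto simp: H1_def intro!: square_integrable_integrable_mult\<close>)

lemma H1_cnj: "H1 F f \<Longrightarrow> H1 (\<lambda>x. cnj (F x)) (\<lambda>x. cnj (f x))"
  by (simp add: H1_def antideriv_cnj square_integrable_cnj)

lemma H1_diff: "H1 F f \<Longrightarrow> H1 G g \<Longrightarrow> H1 (\<lambda>x. F x - G x) (\<lambda>x. f x - g x)"
  by (simp add: H1_def antideriv_diff square_integrable_diff)

text \<open>The real part of the complex formula for F and the conjugate of G. The sign reflects
  that x = 0 is the lower endpoint; the boundary terms of the balance laws come from here.\<close>

lemma H1_parts:
  assumes F: "H1 F f" and G: "H1 G g"
  shows "inner_L2 half f G + inner_L2 half F g = - (F 0 \<bullet> G 0)"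
proof -
  have i: "integrable half (\<lambda>x. f x * cnj (G x))" "integrable half (\<lambda>x. cnj (g x) * F x)"
    by (rule square_integrable_integrable_mult; use F G in \<open>auto simp: H1_def intro: square_integrable_cnj\<close>)+
  have "- (F 0 \<bullet> G 0) = Re (\<integral>x. f x * cnj (G x) + cnj (g x) * F x \<partial>half)"
    using H1_parts_complex[OF F H1_cnj[OF G]] by (simp add: inner_complex_def)
  also have "\<dots> = (\<integral>x. Re (f x * cnj (G x)) + Re (cnj (g x) * F x) \<partial>half)"
    using i by (subst integral_Re[symmetric]) auto
  also have "\<dots> = (\<integral>x. f x \<bullet> G x + F x \<bullet> g x \<partial>half)"
    by (rule Bochner_Integration.integral_cong) (auto simp: inner_complex_def)
  also have "\<dots> = inner_L2 half f G + inner_L2 half F g"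
    unfolding inner_L2_def by (rule Bochner_Integration.integral_add; rule square_integrable_integrable_inner; use F G in \<open>auto simp: H1_def\<close>)
  finally show ?thesis by simp
qed

text \<open>|F(x)|^2 is minus the integral of its density over (x,\<infinity>), the density is at
  most 2 |F| |f|, and Cauchy-Schwarz finishes. Besides the quartic term this controls boundary
  values and sup norms of differences between two times.\<close>

lemma H1_sup_bound:
  assumes F: "H1 F f" and x: "0 \<le> x"
  shows "(norm (F x))\<^sup>2 \<le> 2 * norm_L2 half F * norm_L2 half f"
proof -
  define k where "k x = f x * cnj (F x) + cnj (f x) * F x" for x
  have s: "square_integrable half F" "square_integrable half f" using F by (auto simp: H1_def)
  have k: "antideriv (\<lambda>x. F x * cnj (F x)) k"
    unfolding k_def using F by (intro antideriv_mult antideriv_cnj) (auto simp: H1_def)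
  have ki: "integrable half k"
    unfolding k_def using s by (intro Bochner_Integration.integrable_add square_integrable_integrable_mult square_integrable_cnj)
  note [measurable] = borel_measurable_integrable[OF ki]
  have "F x * cnj (F x) = F 0 * cnj (F 0) + cumul k x"
    by (rule antideriv_eq[OF k x])
  also have "F 0 * cnj (F 0) = - (\<integral>x. k x \<partial>half)"
    unfolding k_def using H1_parts_complex[OF F H1_cnj[OF F]] by simp
  also have "- (\<integral>x. k x \<partial>half) + cumul k x = (\<integral>y. indicator {..x} y *\<^sub>R k y - k y \<partial>half)"
    using loc_integrable_half_integrable[OF ki] ki by (simp add: cumul_def loc_integrable_half_def)
  finally have "(norm (F x))\<^sup>2 = norm (\<integral>y. indicator {..x} y *\<^sub>R k y - k y \<partial>half)"
    by (metis norm_mult complex_mod_cnj power2_eq_square)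
  also have "\<dots> \<le> (\<integral>y. norm (indicator {..x} y *\<^sub>R k y - k y) \<partial>half)"
    by (rule integral_norm_bound)
  also have "\<dots> \<le> (\<integral>y. 2 * (norm (F y) * norm (f y)) \<partial>half)"
  proof (rule integral_mono)
    show "integrable half (\<lambda>y. norm (indicator {..x} y *\<^sub>R k y - k y))"
      using loc_integrable_half_integrable[OF ki] ki by (simp add: loc_integrable_half_def)
    show "integrable half (\<lambda>y. 2 * (norm (F y) * norm (f y)))"
      by (intro integrable_mult_right square_integrable_integrable_mult_norm s)
    fix y
    have "norm (indicator {..x} y *\<^sub>R k y - k y) \<le> norm (k y)" by (auto simp: indicator_def)
    also have "\<dots> \<le> 2 * (norm (F y) * norm (f y))"
      unfolding k_def by (rule order_trans[OF norm_triangle_ineq]) (simp add: norm_mult)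
    finally show "norm (indicator {..x} y *\<^sub>R k y - k y) \<le> 2 * (norm (F y) * norm (f y))" .
  qed
  also have "\<dots> \<le> 2 * (norm_L2 half F * norm_L2 half f)"
    using L2_mult_norm_le[OF s] by simp
  finally show ?thesis by simp
qed

lemma H1_bounded:
  assumes "H1 F f"
  obtains B where "\<And>x. 0 \<le> x \<Longrightarrow> norm (F x) \<le> B" "0 \<le> B"
proof
  show "norm (F x) \<le> sqrt (2 * norm_L2 half F * norm_L2 half f)" if "0 \<le> x" for x
    using H1_sup_bound[OF assms that] by (simp add: real_le_rsqrt)
qed simp

text \<open>Each product has one bounded and one square-integrable factor. It is needed for |q|^2 as
  the product of q and its conjugate.\<close>

lemma H1_mult:
  assumes F: "H1 F f" and G: "H1 G g"
  shows "H1 (\<lambda>x. F x * G x) (\<lambda>x. f x * G x + g x * F x)"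
proof -
  obtain B where B: "\<And>x. 0 \<le> x \<Longrightarrow> norm (F x) \<le> B" using H1_bounded[OF F] by blast
  obtain C where C: "\<And>x. 0 \<le> x \<Longrightarrow> norm (G x) \<le> C" using H1_bounded[OF G] by blast
  have s: "square_integrable half F" "square_integrable half f" "square_integrable half G" "square_integrable half g" using F G by (auto simp: H1_def)
  note [measurable] = s[THEN square_integrable_measurable]
  have "square_integrable half (\<lambda>x. F x * G x)"
    by (rule square_integrable_bound[OF s(3), where C = B]) (use B in \<open>auto simp: norm_mult intro!: mult_right_mono\<close>)
  moreover have "square_integrable half (\<lambda>x. f x * G x)"
    by (rule square_integrable_bound[OF s(2), where C = C]) (use C in \<open>auto simp: norm_mult mult.commute[of C] intro!: mult_left_mono\<close>)
  moreover have "square_integrable half (\<lambda>x. g x * F x)"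
    by (rule square_integrable_bound[OF s(4), where C = B]) (use B in \<open>auto simp: norm_mult mult.commute[of B] intro!: mult_left_mono\<close>)
  ultimately show ?thesis
    using F G by (simp add: H1_def antideriv_mult square_integrable_add)
qed


section \<open>Weak derivatives\<close>

lemma measurable_half_iff:
  fixes f :: "real \<Rightarrow> complex"
  shows "f \<in> borel_measurable half \<longleftrightarrow> set_borel_measurable lborel {0<..} f"
  unfolding half_def set_borel_measurable_def by (rule borel_measurable_restrict_space_iff) simp

lemma integral_half: "(LBINT x:{0<..}. f x) = (\<integral>x. f x \<partial>half)"
  for f :: "real \<Rightarrow> complex"
  unfolding half_def set_lebesgue_integral_def by (rule integral_restrict_space[symmetric]) simp

lemma integrable_half_iff: "integrable half f \<longleftrightarrow> set_integrable lborel {0<..} f"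
  for f :: "real \<Rightarrow> complex"
  unfolding half_def set_integrable_def by (rule integrable_restrict_space) simp

lemma Lp_norm_2_half:
  "Lp_norm 2 {0<..} f = epowr (\<integral>\<^sup>+x. ennreal ((norm (f x))\<^sup>2) \<partial>half) (1 / 2)"
  unfolding Lp_norm_def half_def
  by (subst nn_integral_restrict_space) (auto simp: powr_numeral)

lemma epowr_less_top_iff: "epowr x a < \<infinity> \<longleftrightarrow> x < \<infinity>"
  by (auto simp: epowr_def top.not_eq_extremum)

lemma L2_halfline_iff: "f \<in> L2_halfline \<longleftrightarrow> square_integrable half f"
proof -
  have "(\<lambda>x. (norm (f x))\<^sup>2) \<in> borel_measurable half" if "f \<in> borel_measurable half"
    using that by measurable
  then show ?thesis
    by (auto simp: L2_halfline_def square_integrable_def Lp_norm_2_half epowr_less_top_iff integrable_iff_bounded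
        simp flip: measurable_half_iff infinity_ennreal_def)
qed

lemma epowr_half: "0 \<le> x \<Longrightarrow> epowr (ennreal x) (1 / 2) = ennreal (sqrt x)"
  by (simp add: epowr_def powr_half_sqrt)

lemma Lp_norm_half:
  assumes "square_integrable half f"
  shows "Lp_norm 2 {0<..} f = ennreal (norm_L2 half f)"
proof -
  have "(\<integral>\<^sup>+x. ennreal ((norm (f x))\<^sup>2) \<partial>half) = ennreal (\<integral>x. (norm (f x))\<^sup>2 \<partial>half)"
    using assms by (intro nn_integral_eq_integral) (auto simp: square_integrable_def)
  then show ?thesis by (simp add: Lp_norm_2_half norm_L2_def epowr_half)
qed

lemma square_integrable_cong_AE:
  assumes "AE x in M. f x = g x" "square_integrable M f" and [measurable]: "g \<in> borel_measurable M"
  shows "square_integrable M g"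
proof -
  note [measurable] = square_integrable_measurable[OF assms(2)]
  have "integrable M (\<lambda>x. (norm (f x))\<^sup>2) \<longleftrightarrow> integrable M (\<lambda>x. (norm (g x))\<^sup>2)"
    using assms(1) by (intro integrable_cong_AE, measurable) auto
  then show ?thesis using assms by (simp add: square_integrable_def)
qed

text \<open>\<open>k\<close> is on (0,\<infinity>) the pointwise limit of its restrictions to
  [1/(n+1), n], which are integrable and so measurable.\<close>

lemma locally_integrable_measurable:
  assumes "locally_integrable k"
  shows "k \<in> borel_measurable half"
  unfolding measurable_half_iff set_borel_measurable_def
proof (rule borel_measurable_LIMSEQ_metric)
  show "(\<lambda>x. indicator {inverse (real (Suc n))..real n} x *\<^sub>R k x) \<in> borel_measurable lborel" for n
    using assms borel_measurable_integrable
    unfolding locally_integrable_def set_integrable_def by (metis inverse_positive_iff_positive of_nat_0_less_iff zero_less_Suc)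
  fix x :: real
  show "(\<lambda>n. indicator {inverse (real (Suc n))..real n} x *\<^sub>R k x) \<longlonglongrightarrow> indicator {0<..} x *\<^sub>R k x"
  proof (cases "0 < x")
    case True
    have "\<forall>\<^sub>F n in sequentially. inverse (real (Suc n)) < x"
      using order_tendstoD(2)[OF LIMSEQ_inverse_real_of_nat True] .
    moreover have "\<forall>\<^sub>F n in sequentially. x \<le> real n"
      using filterlim_real_sequentially by (simp add: filterlim_at_top)
    ultimately have "\<forall>\<^sub>F n in sequentially. indicator {inverse (real (Suc n))..real n} x *\<^sub>R k x = indicator {0<..} x *\<^sub>R k x"
      by eventually_elim (use True in \<open>auto simp: indicator_def\<close>)
    then show ?thesis by (rule tendsto_eventually)
  next
    case False
    then have "x \<notin> {inverse (real (Suc n))..real n}" for n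
      using positive_imp_inverse_positive[of "real (Suc n)"] by (auto simp del: of_nat_Suc inverse_positive_iff_positive)
    then show ?thesis using False by simp
  qed
qed

lemma loc_integrable_half_locally_integrable:
  assumes "loc_integrable_half f"
  shows "locally_integrable f"
  unfolding locally_integrable_def
proof (intro allI impI)
  fix a b :: real assume "0 < a"
  have "set_integrable lborel {0<..} (\<lambda>x. indicator {..b} x *\<^sub>R f x)"
    using assms by (simp add: loc_integrable_half_def integrable_half_iff)
  then have "set_integrable lborel {a..b} (\<lambda>x. indicator {..b} x *\<^sub>R f x)"
    by (rule set_integrable_subset) (use \<open>0 < a\<close> in auto)
  also have "?this \<longleftrightarrow> set_integrable lborel {a..b} f"
    by (rule set_integrable_cong) auto
  finally show "set_integrable lborel {a..b} f" .
qed

lemma locally_integrable_diff: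
  "locally_integrable f \<Longrightarrow> locally_integrable g \<Longrightarrow> locally_integrable (\<lambda>x. f x - g x)"
  by (auto simp: locally_integrable_def)

lemma locally_integrable_cong_AE:
  assumes "AE x in half. f x = g x" "locally_integrable f" "g \<in> borel_measurable half"
  shows "locally_integrable g"
  unfolding locally_integrable_def set_integrable_def
proof (intro allI impI)
  fix a b :: real assume "0 < a"
  let ?i = "\<lambda>f x. indicator {a..b} x *\<^sub>R (indicator {0<..} x *\<^sub>R f x)"
  have eq: "(\<lambda>x. indicator {a..b} x *\<^sub>R u x) = ?i u" for u :: "real \<Rightarrow> complex"
    using \<open>0 < a\<close> by (auto simp: indicator_def)
  have m: "(\<lambda>x. indicator {0<..} x *\<^sub>R f x) \<in> borel_measurable lborel"
    "(\<lambda>x. indicator {0<..} x *\<^sub>R g x) \<in> borel_measurable lborel"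
    using locally_integrable_measurable[OF assms(2)] assms(3)
    unfolding measurable_half_iff set_borel_measurable_def by auto
  have "integrable lborel (?i f)"
    using assms(2) \<open>0 < a\<close> unfolding locally_integrable_def set_integrable_def eq[of f, symmetric] by simp
  also have "?this \<longleftrightarrow> integrable lborel (?i g)"
  proof (rule integrable_cong_AE)
    show "?i f \<in> borel_measurable lborel" "?i g \<in> borel_measurable lborel"
      using m by measurable
    show "AE x in lborel. ?i f x = ?i g x"
      using assms(1)[unfolded AE_half_iff] by eventually_elim (auto simp: indicator_def)
  qed
  finally show "integrable lborel (\<lambda>x. indicator {a..b} x *\<^sub>R g x)" by (simp only: eq[of g])
qed

section \<open>Test functions and the fundamental lemma of the calculus of variations\<close>

lemma test_functionE:
  assumes "test_function \<phi>"
  obtains D a b where "0 < a" "a < b" "\<And>x. (\<phi> has_real_derivative D x) (at x)" "continuous_on UNIV D"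
    "\<And>x. x \<notin> {a..b} \<Longrightarrow> \<phi> x = 0" "\<And>x. x \<notin> {a..b} \<Longrightarrow> D x = 0" "deriv \<phi> = D"
proof -
  obtain D where D: "\<And>x. (\<phi> has_real_derivative D x) (at x)" "continuous_on UNIV D"
    using assms by (auto simp: test_function_def C1_differentiable_on_def has_real_derivative_iff_has_vector_derivative)
  obtain a b0 where a: "0 < a" "\<And>x. x \<notin> {a..b0} \<Longrightarrow> \<phi> x = 0"
    using assms by (auto simp: test_function_def)
  \<comment> \<open>The given \<open>b0\<close> may lie below \<open>a\<close>; enlarging it makes
    the interval nondegenerate.\<close>
  define b where "b = max b0 (a + 1)"
  have b: "a < b" "\<And>x. x \<notin> {a..b} \<Longrightarrow> \<phi> x = 0" using a(2) by (force simp: b_def)+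
  have "D x = 0" if "x \<notin> {a..b}" for x
  proof -
    have "(\<phi> has_real_derivative 0) (at x)"
    proof (rule has_field_derivative_transform_within_open)
      show "((\<lambda>_. 0) has_real_derivative 0) (at x)" by simp
      show "open (- {a..b})" by auto
    qed (use b that in auto)
    then show ?thesis using D(1) DERIV_unique by blast
  qed
  moreover have "deriv \<phi> = D" using D(1) DERIV_imp_deriv by blast
  ultimately show ?thesis using that a(1) b D by blast
qed

lemma compact_support_integrable:
  fixes \<psi> :: "real \<Rightarrow> real"
  assumes c: "continuous_on UNIV \<psi>" and "0 < a" and z: "\<And>x. x \<notin> {a..b} \<Longrightarrow> \<psi> x = 0"
    and k: "locally_integrable k"
  shows "integrable half (\<lambda>x. \<psi> x *\<^sub>R k x)"
proof -
  have [measurable]: "\<psi> \<in> borel_measurable borel" by (rule borel_measurable_continuous_onI[OF c])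
  have i: "integrable lborel (\<lambda>x. indicator {a..b} x *\<^sub>R k x)"
    using k \<open>0 < a\<close> by (simp add: locally_integrable_def set_integrable_def)
  note [measurable] = borel_measurable_integrable[OF i]
  have "compact (\<psi> ` {a..b})"
    by (intro compact_continuous_image continuous_on_subset[OF c]) auto
  then obtain B where B: "\<And>x. x \<in> {a..b} \<Longrightarrow> norm (\<psi> x) \<le> B"
    using compact_imp_bounded[of "\<psi> ` {a..b}"] unfolding bounded_iff by (metis image_eqI)
  have "integrable lborel (\<lambda>x. \<psi> x *\<^sub>R (indicator {a..b} x *\<^sub>R k x))"
  proof (rule Bochner_Integration.integrable_bound)
    show "integrable lborel (\<lambda>x. B * norm (indicator {a..b} x *\<^sub>R k x))"
      by (intro integrable_mult_right integrable_norm i)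
    show "(\<lambda>x. \<psi> x *\<^sub>R (indicator {a..b} x *\<^sub>R k x)) \<in> borel_measurable lborel" by measurable
    show "AE x in lborel. norm (\<psi> x *\<^sub>R (indicator {a..b} x *\<^sub>R k x)) \<le> norm (B * norm (indicator {a..b} x *\<^sub>R k x))"
    proof (rule AE_I2)
      fix x
      show "norm (\<psi> x *\<^sub>R (indicator {a..b} x *\<^sub>R k x)) \<le> norm (B * norm (indicator {a..b} x *\<^sub>R k x))"
      proof (cases "x \<in> {a..b}")
        case True
        then have "\<bar>\<psi> x\<bar> \<le> \<bar>B\<bar>" using B[OF True] by simp
        then show ?thesis using True by (simp add: abs_mult mult_right_mono)
      qed simp
    qed
  qed
  also have "(\<lambda>x. \<psi> x *\<^sub>R (indicator {a..b} x *\<^sub>R k x)) = (\<lambda>x. indicator {0<..} x *\<^sub>R (\<psi> x *\<^sub>R k x))"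
    using z \<open>0 < a\<close> by (force simp: indicator_def)
  finally show ?thesis by (simp add: integrable_half_iff set_integrable_def)
qed

lemma test_function_integrable:
  assumes "test_function \<phi>" "locally_integrable k"
  shows "integrable half (\<lambda>x. \<phi> x *\<^sub>R k x)" "integrable half (\<lambda>x. deriv \<phi> x *\<^sub>R k x)"
proof -
  obtain D a b where t: "0 < a" "a < b" "\<And>x. (\<phi> has_real_derivative D x) (at x)" "continuous_on UNIV D"
    "\<And>x. x \<notin> {a..b} \<Longrightarrow> \<phi> x = 0" "\<And>x. x \<notin> {a..b} \<Longrightarrow> D x = 0" "deriv \<phi> = D"
    by (rule test_functionE[OF assms(1)]) (rule that; assumption)
  have c: "continuous_on UNIV \<phi>"
    using t(3) by (meson DERIV_isCont continuous_at_imp_continuous_on)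
  show "integrable half (\<lambda>x. \<phi> x *\<^sub>R k x)" by (rule compact_support_integrable[OF c t(1) t(5) assms(2)])
  show "integrable half (\<lambda>x. deriv \<phi> x *\<^sub>R k x)"
    unfolding t(7) by (rule compact_support_integrable[OF t(4) t(1) t(6) assms(2)])
qed

lemma has_weak_deriv_iff:
  "has_weak_deriv f g \<longleftrightarrow> locally_integrable f \<and> locally_integrable g \<and>
     (\<forall>\<phi>. test_function \<phi> \<longrightarrow> (\<integral>x. deriv \<phi> x *\<^sub>R f x \<partial>half) = - (\<integral>x. \<phi> x *\<^sub>R g x \<partial>half))"
  by (simp add: has_weak_deriv_def integral_half)

text \<open>The squared positive part is the C1 building block of \<open>bump\<close>. The delicate
  point is y = 0, where the quotient (max 0 h)^2 / h equals max 0 h for h different from 0.\<close>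

lemma has_real_derivative_max_square:
  "((\<lambda>y. (max 0 y)\<^sup>2) has_real_derivative 2 * max 0 y) (at (y::real))"
proof -
  consider "y < 0" | "y = 0" | "0 < y" by linarith
  then show ?thesis
  proof cases
    case 1
    have "((\<lambda>y. (max 0 y)\<^sup>2) has_real_derivative 0) (at y)"
      by (rule has_field_derivative_transform_within_open[where f = "\<lambda>_. 0" and S = "{..<0}"]) (use 1 in auto)
    then show ?thesis using 1 by simp
  next
    case 3
    have "((\<lambda>y. (max 0 y)\<^sup>2) has_real_derivative 2 * y) (at y)"
      by (rule has_field_derivative_transform_within_open[where f = "\<lambda>y. y\<^sup>2" and S = "{0<..}"])
         (use 3 in \<open>auto intro!: derivative_eq_intros\<close>)
    then show ?thesis using 3 by simp
  next
    case 2
    have "((\<lambda>h. max 0 h) \<longlongrightarrow> 0) (at (0::real))"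
      using tendsto_max[OF tendsto_const[of 0] tendsto_ident_at[of "0::real" UNIV]] by simp
    then have "((\<lambda>h. (max 0 h)\<^sup>2 / h) \<longlongrightarrow> 0) (at (0::real))"
      by (rule Lim_transform_eventually) (auto simp: eventually_at_filter max_def power2_eq_square)
    then show ?thesis using 2 by (simp add: has_field_derivative_iff)
  qed
qed

text \<open>C1 approximation of the indicator of (a,b), with values in [0,1] and vanishing off
  [a,b]: \<open>m / (1 + m)\<close> cuts off large values, and \<open>m\<close> grows without bound
  in n inside (a,b). The square makes the joining at a and b continuously differentiable.\<close>

definition bump :: "real \<Rightarrow> real \<Rightarrow> real \<Rightarrow> real \<Rightarrow> real" where
  "bump a b n x = (let m = (max 0 (n * ((x - a) * (b - x))))\<^sup>2 in m / (1 + m))"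

lemma bump_bounds: "0 \<le> bump a b n x" "bump a b n x \<le> 1"
  by (auto simp: bump_def Let_def divide_le_eq_1 add_pos_nonneg)

lemma bump_test_function:
  assumes "0 < a" "a < b" "0 < n"
  shows "test_function (bump a b n)"
  unfolding test_function_def
proof
  define y where "y x = n * ((x - a) * (b - x))" for x
  define D where "D x = 2 * max 0 (y x) * (n * ((b - x) - (x - a))) / (1 + (max 0 (y x))\<^sup>2)\<^sup>2" for x
  have pos: "1 + (max 0 z)\<^sup>2 \<noteq> 0" for z :: real
    using zero_le_power2[of "max 0 z"] by linarith
  have "(bump a b n has_real_derivative D x) (at x)" for x
  proof -
    have m: "((\<lambda>x. (max 0 (y x))\<^sup>2) has_real_derivative 2 * max 0 (y x) * (n * ((b - x) - (x - a)))) (at x)"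
      by (rule DERIV_chain2[OF has_real_derivative_max_square])
         (auto simp: y_def[abs_def] algebra_simps intro!: derivative_eq_intros)
    have "((\<lambda>x. (max 0 (y x))\<^sup>2 / (1 + (max 0 (y x))\<^sup>2)) has_real_derivative D x) (at x)"
      unfolding D_def
      by (rule DERIV_cong[OF DERIV_quotient[OF m DERIV_add[OF DERIV_const m] pos]])
         (simp add: algebra_simps numeral_2_eq_2)
    then show ?thesis by (simp add: bump_def[abs_def] Let_def y_def)
  qed
  moreover have "continuous_on UNIV D"
    unfolding D_def[abs_def] y_def by (intro continuous_intros) (use pos in auto)
  ultimately show "bump a b n C1_differentiable_on UNIV"
    by (auto simp: C1_differentiable_on_def has_real_derivative_iff_has_vector_derivative)
  have "bump a b n x = 0" if "x \<notin> {a..b}" for x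
  proof -
    have "(x - a) * (b - x) \<le> 0"
      using that \<open>a < b\<close> by (cases "x < a"; cases "x > b") (auto simp: mult_le_0_iff)
    then have "n * ((x - a) * (b - x)) \<le> 0" using \<open>0 < n\<close> by (simp add: mult_le_0_iff)
    then show ?thesis by (simp add: bump_def Let_def)
  qed
  then show "\<exists>a' b'. 0 < a' \<and> (\<forall>x. x \<notin> {a'..b'} \<longrightarrow> bump a b n x = 0)"
    using \<open>0 < a\<close> by blast
qed

lemma bump_limit:
  assumes "a < b"
  shows "(\<lambda>n. bump a b (real (Suc n)) x) \<longlonglongrightarrow> indicator {a<..<b} x"
proof (cases "x \<in> {a<..<b}")
  case True
  define c where "c = ((x - a) * (b - x))\<^sup>2"
  have c: "0 < c" using True by (simp add: c_def)
  \<comment> \<open>Dividing numerator and denominator by (n + 1)^2 c makes the limit 1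
    visible.\<close>
  have "bump a b (real (Suc n)) x = 1 / (1 + (inverse (real (Suc n)))\<^sup>2 / c)" for n
  proof -
    have nn: "0 \<le> real (Suc n) * ((x - a) * (b - x))" using True by simp
    have "bump a b (real (Suc n)) x = ((real (Suc n))\<^sup>2 * c) / (1 + (real (Suc n))\<^sup>2 * c)"
      unfolding bump_def Let_def max_absorb2[OF nn] c_def by (simp only: power_mult_distrib)
    also have "\<dots> = 1 / (1 + (inverse (real (Suc n)))\<^sup>2 / c)"
    proof -
      have "0 < (real (Suc n))\<^sup>2 * c" using c by simp
      then show ?thesis using c by (simp add: power_inverse field_simps del: of_nat_Suc)
    qed
    finally show ?thesis .
  qed
  moreover have "(\<lambda>n. 1 / (1 + (inverse (real (Suc n)))\<^sup>2 / c)) \<longlonglongrightarrow> 1 / (1 + 0\<^sup>2 / c)"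
    using c by (intro tendsto_intros LIMSEQ_inverse_real_of_nat) auto
  ultimately show ?thesis using True by simp
next
  case False
  have "(x - a) * (b - x) \<le> 0"
    using False \<open>a < b\<close> by (cases "x \<le> a"; cases "x \<ge> b") (auto simp: mult_le_0_iff)
  then have "bump a b (real (Suc n)) x = 0" for n
    by (simp add: bump_def Let_def mult_le_0_iff max_absorb1 del: of_nat_Suc)
  then show ?thesis using False by simp
qed

text \<open>Bumps give zero integrals over open intervals; these form an intersection-stable
  generator, so the integrals over all Borel sets vanish, and a function with that property is 0
  almost everywhere.\<close>

lemma AE_eq_0_of_test:
  assumes k: "locally_integrable k"
    and zero: "\<And>\<phi>. test_function \<phi> \<Longrightarrow> (\<integral>x. \<phi> x *\<^sub>R k x \<partial>half) = 0"
  shows "AE x in half. k x = 0"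
proof -
  have interval: "(LBINT x:{a<..<b}. k x) = 0" if "0 < a" for a b
  proof (cases "a < b")
    case False
    then show ?thesis by (simp add: set_lebesgue_integral_def)
  next
    case True
    have ki: "integrable lborel (\<lambda>x. indicator {a..b} x *\<^sub>R k x)"
      using k that by (auto simp: locally_integrable_def set_integrable_def)
    note [measurable] = borel_measurable_integrable[OF ki]
    have [measurable]: "bump a b n \<in> borel_measurable borel" for n
      unfolding bump_def[abs_def] Let_def by measurable
    have eq: "bump a b n x *\<^sub>R (indicator {a..b} x *\<^sub>R k x) = indicator {0<..} x *\<^sub>R (bump a b n x *\<^sub>R k x)"
      if "0 < n" for n x
    proof (cases "x \<in> {a..b}")
      case x: False
      have "(x - a) * (b - x) \<le> 0"
        using x True by (cases "x < a"; cases "x > b") (auto simp: mult_le_0_iff)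
      then have "bump a b n x = 0"
        using that by (simp add: bump_def Let_def mult_le_0_iff max_absorb1)
      then show ?thesis by simp
    qed (use \<open>0 < a\<close> in auto)
    have "(\<lambda>n. \<integral>x. bump a b (real (Suc n)) x *\<^sub>R (indicator {a..b} x *\<^sub>R k x) \<partial>lborel)
        \<longlonglongrightarrow> (\<integral>x. indicator {a<..<b} x *\<^sub>R (indicator {a..b} x *\<^sub>R k x) \<partial>lborel)"
    proof (rule integral_dominated_convergence)
      show "integrable lborel (\<lambda>x. norm (indicator {a..b} x *\<^sub>R k x))" using ki by (rule integrable_norm)
      show "AE x in lborel. (\<lambda>n. bump a b (real (Suc n)) x *\<^sub>R (indicator {a..b} x *\<^sub>R k x))
          \<longlonglongrightarrow> indicator {a<..<b} x *\<^sub>R (indicator {a..b} x *\<^sub>R k x)"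
        by (intro AE_I2 tendsto_intros bump_limit True)
      show "AE x in lborel. norm (bump a b (real (Suc n)) x *\<^sub>R (indicator {a..b} x *\<^sub>R k x))
          \<le> norm (indicator {a..b} x *\<^sub>R k x)" for n
        using bump_bounds[of a b "real (Suc n)"] by (intro AE_I2) (simp add: mult_left_le_one_le mult.assoc del: of_nat_Suc)
    qed measurable
    moreover have "(\<integral>x. bump a b (real (Suc n)) x *\<^sub>R (indicator {a..b} x *\<^sub>R k x) \<partial>lborel) = 0" for n
    proof -
      have "(\<integral>x. bump a b (real (Suc n)) x *\<^sub>R (indicator {a..b} x *\<^sub>R k x) \<partial>lborel)
        = (\<integral>x. bump a b (real (Suc n)) x *\<^sub>R k x \<partial>half)"
        using integral_half[of "\<lambda>x. bump a b (real (Suc n)) x *\<^sub>R k x"]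
        by (simp only: eq of_nat_0_less_iff zero_less_Suc set_lebesgue_integral_def)
      also have "\<dots> = 0" by (rule zero[OF bump_test_function]) (use that True in auto)
      finally show ?thesis .
    qed
    ultimately have "(\<integral>x. indicator {a<..<b} x *\<^sub>R (indicator {a..b} x *\<^sub>R k x) \<partial>lborel) = 0"
      by (simp add: LIMSEQ_const_iff)
    moreover have "(\<lambda>x. indicator {a<..<b} x *\<^sub>R (indicator {a..b} x *\<^sub>R k x)) = (\<lambda>x. indicator {a<..<b} x *\<^sub>R k x)"
      by (auto simp: indicator_def)
    ultimately show ?thesis by (simp only: set_lebesgue_integral_def)
  qed
  \<comment> \<open>The criterion asks for a globally integrable function, while \<open>k\<close>
    may fail to be integrable near 0 and near infinity. Hence the cutoff to (1/(n+1), n+1), removed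
    at the end by a countable intersection.\<close>
  have AE_N: "AE x in lborel. indicator {1 / real (Suc n)<..<real (Suc n)} x *\<^sub>R k x = 0" for n
  proof (rule sigma_finite_measure.density_zero[OF lborel.sigma_finite_measure_axioms])
    let ?c = "1 / real (Suc n)" and ?d = "real (Suc n)"
    let ?k = "\<lambda>x. indicator {?c<..<?d} x *\<^sub>R k x"
    have "set_integrable lborel {?c..?d} k" using k by (auto simp: locally_integrable_def)
    then have "set_integrable lborel {?c<..<?d} k" by (rule set_integrable_subset) auto
    then show int: "integrable lborel ?k" by (simp add: set_integrable_def)
    have sub: "set_integrable lborel A ?k" if "A \<in> sets borel" for A
      using integrable_mult_indicator[OF _ int, of A] that by (simp add: set_integrable_def)
    have sb: "sets borel = sigma_sets UNIV (range (\<lambda>(a, b). {a<..<b :: real}))"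
      by (subst borel_eq_box) (simp add: box_real case_prod_unfold)
    fix A :: "real set" assume "A \<in> sets lborel"
    then have A: "A \<in> sigma_sets UNIV (range (\<lambda>(a, b). {a<..<b :: real}))"
      by (simp add: sb)
    have sets: "B \<in> sets borel" if "B \<in> sigma_sets UNIV (range (\<lambda>(a, b). {a<..<b :: real}))" for B
      using that by (simp add: sb)
    have basic: "(LBINT x:{a<..<b}. ?k x) = 0" for a b
    proof -
      have "(LBINT x:{a<..<b}. ?k x) = (LBINT x:{max a ?c<..<min b ?d}. k x)"
        unfolding set_lebesgue_integral_def
        by (rule Bochner_Integration.integral_cong) (auto simp: indicator_def)
      also have "\<dots> = 0" by (rule interval) (simp add: less_max_iff_disj)
      finally show ?thesis .
    qed
    have stable: "Int_stable (range (\<lambda>(a, b). {a<..<b :: real}))"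
      by (auto simp: Int_stable_def image_iff)
    show "(LBINT x:A. ?k x) = 0"
      using stable Pow_UNIV[THEN equalityD2, THEN subset_trans[OF subset_UNIV]] A
    proof (induct rule: sigma_sets_induct_disjoint)
      case (basic A)
      then show ?case using \<open>\<And>b a. (LBINT x:{a<..<b}. ?k x) = 0\<close> by auto
    next
      case empty
      then show ?case by (simp add: set_lebesgue_integral_def)
    next
      case (compl A)
      \<comment> \<open>The cut-off function lives on one open interval, so its integral over the
        whole line is already known to be 0, and complements follow by subtraction.\<close>
      have "(LBINT x:UNIV - A. ?k x) + (LBINT x:A. ?k x) = (LBINT x:UNIV. ?k x)"
        using set_integral_Un[of "UNIV - A" A lborel ?k] sub sets[OF compl(1)]
        by (simp add: Un_commute Diff_disjoint[THEN trans[OF Int_commute]] del: of_nat_Suc)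
      also have "\<dots> = (LBINT x:{?c<..<?d}. ?k x)"
        unfolding set_lebesgue_integral_def
        by (rule Bochner_Integration.integral_cong) (auto simp: indicator_def)
      also have "\<dots> = 0" by (rule basic)
      finally show ?case using compl(2) by simp
    next
      case (union A)
      have "(LBINT x:(\<Union>i. A i). ?k x) = (\<Sum>i. (LBINT x:A i. ?k x))"
      proof (rule lebesgue_integral_countable_add)
        show "A i \<in> sets lborel" for i using union(2) sets by auto
        show "A i \<inter> A j = {}" if "i \<noteq> j" for i j using union(1) that by (auto simp: disjoint_family_on_def)
        show "set_integrable lborel (\<Union>i. A i) ?k" by (rule sub) (use union(2) sets in auto)
      qed
      then show ?case using union(3) by simp
    qed
  qed
  have "AE x in lborel. \<forall>n. indicator {1 / real (Suc n)<..<real (Suc n)} x *\<^sub>R k x = 0"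
    using AE_N by (simp only: AE_all_countable) blast
  then show ?thesis
    unfolding AE_half_iff
  proof eventually_elim
    case (elim x)
    show ?case
    proof
      assume "0 < x"
      then obtain m where "max x (1 / x) < real m" using reals_Archimedean2 by blast
      then have "x < real (Suc m)" "1 / x < real (Suc m)" by auto
      then have "x \<in> {1 / real (Suc m)<..<real (Suc m)}"
        using \<open>0 < x\<close> by (simp add: divide_less_eq mult.commute del: of_nat_Suc)
      then show "k x = 0" using elim[rule_format, of m] by simp
    qed
  qed
qed

lemma has_weak_deriv_unique:
  assumes "has_weak_deriv f g" "has_weak_deriv f g'"
  shows "AE x in half. g x = g' x"
proof -
  have l: "locally_integrable g" "locally_integrable g'" using assms by (auto simp: has_weak_deriv_def)
  have "AE x in half. g x - g' x = 0"
  proof (rule AE_eq_0_of_test[OF locally_integrable_diff[OF l]])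
    fix \<phi> assume \<phi>: "test_function \<phi>"
    have "(\<integral>x. \<phi> x *\<^sub>R g x \<partial>half) = (\<integral>x. \<phi> x *\<^sub>R g' x \<partial>half)"
    proof -
      have "(\<integral>x. deriv \<phi> x *\<^sub>R f x \<partial>half) = - (\<integral>x. \<phi> x *\<^sub>R u x \<partial>half)" if "has_weak_deriv f u" for u
        using that \<phi> unfolding has_weak_deriv_iff by blast
      from this[OF assms(1)] this[OF assms(2)] show ?thesis by simp
    qed
    then show "(\<integral>x. \<phi> x *\<^sub>R (g x - g' x) \<partial>half) = 0"
      using test_function_integrable(1)[OF \<phi>] l by (simp add: scaleR_diff_right)
  qed
  then show ?thesis by simp
qed

lemma has_weak_deriv_diff:
  assumes "has_weak_deriv f g" "has_weak_deriv f' g'"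
  shows "has_weak_deriv (\<lambda>x. f x - f' x) (\<lambda>x. g x - g' x)"
  using assms by (auto simp: has_weak_deriv_iff locally_integrable_diff scaleR_diff_right test_function_integrable)

lemma has_weak_deriv_cong_AE:
  assumes "has_weak_deriv f g" "AE x in half. f x = f' x" "AE x in half. g x = g' x"
    and f': "f' \<in> borel_measurable half" and g': "g' \<in> borel_measurable half"
  shows "has_weak_deriv f' g'"
proof -
  have l: "locally_integrable f" "locally_integrable g" using assms by (auto simp: has_weak_deriv_def)
  have l': "locally_integrable f'" "locally_integrable g'"
    using locally_integrable_cong_AE assms l by blast+
  have eq: "(\<integral>x. c x *\<^sub>R u x \<partial>half) = (\<integral>x. c x *\<^sub>R u' x \<partial>half)"
    if "AE x in half. u x = u' x" "integrable half (\<lambda>x. c x *\<^sub>R u x)" "integrable half (\<lambda>x. c x *\<^sub>R u' x)"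
    for c :: "real \<Rightarrow> real" and u u' :: "real \<Rightarrow> complex"
    by (rule integral_cong_AE[OF borel_measurable_integrable[OF that(2)] borel_measurable_integrable[OF that(3)]])
       (use that(1) in eventually_elim, simp)
  show ?thesis
    unfolding has_weak_deriv_iff
  proof (intro conjI l' allI impI)
    fix \<phi> assume \<phi>: "test_function \<phi>"
    show "(\<integral>x. deriv \<phi> x *\<^sub>R f' x \<partial>half) = - (\<integral>x. \<phi> x *\<^sub>R g' x \<partial>half)"
      using eq[OF assms(2) test_function_integrable(2)[OF \<phi> l(1)] test_function_integrable(2)[OF \<phi> l'(1)]]
        eq[OF assms(3) test_function_integrable(1)[OF \<phi> l(2)] test_function_integrable(1)[OF \<phi> l'(2)]]
        assms(1) \<phi> by (simp add: has_weak_deriv_iff)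
  qed
qed

section \<open>Du Bois-Reymond: a vanishing weak derivative forces a constant\<close>

lemma test_function_diff:
  assumes \<phi>: "test_function \<phi>" and \<psi>: "test_function \<psi>"
  shows "test_function (\<lambda>x. \<phi> x - c * \<psi> x)"
  unfolding test_function_def
proof
  show "(\<lambda>x. \<phi> x - c * \<psi> x) C1_differentiable_on UNIV"
    using \<phi> \<psi> unfolding test_function_def by (intro C1_differentiable_on_diff C1_differentiable_on_mult) auto
  obtain a b where a: "0 < a" "\<And>x. x \<notin> {a..b} \<Longrightarrow> \<phi> x = 0" using \<phi> by (auto simp: test_function_def)
  obtain a' b' where a': "0 < a'" "\<And>x. x \<notin> {a'..b'} \<Longrightarrow> \<psi> x = 0" using \<psi> by (auto simp: test_function_def)
  have "\<phi> x - c * \<psi> x = 0" if "x \<notin> {min a a'..max b b'}" for x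
  proof -
    have "x \<notin> {a..b}" "x \<notin> {a'..b'}" using that by auto
    then show ?thesis using a a' by simp
  qed
  then show "\<exists>a b. 0 < a \<and> (\<forall>x. x \<notin> {a..b} \<longrightarrow> \<phi> x - c * \<psi> x = 0)"
    using a(1) a'(1) by (intro exI[of _ "min a a'"] exI[of _ "max b b'"]) auto
qed

lemma cumul_eq_integral:
  assumes "\<And>x. b < x \<Longrightarrow> f x = 0"
  shows "cumul f b = (\<integral>x. f x \<partial>half)"
  unfolding cumul_def
  by (rule Bochner_Integration.integral_cong) (use assms in \<open>auto simp: indicator_def\<close>)

text \<open>To the left of the support the antiderivative is 0 by its normalization at 0, to the
  right because the total integral is 0; mean zero is exactly what compact support requires.\<close>

lemma test_function_antiderivative:
  assumes \<psi>: "test_function \<psi>" and zero: "(\<integral>x. complex_of_real (\<psi> x) \<partial>half) = 0"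
  obtains \<phi> where "test_function \<phi>" "deriv \<phi> = \<psi>"
proof -
  obtain D a b where t: "0 < a" "a < b" "\<And>x. (\<psi> has_real_derivative D x) (at x)" "continuous_on UNIV D"
    "\<And>x. x \<notin> {a..b} \<Longrightarrow> \<psi> x = 0" "\<And>x. x \<notin> {a..b} \<Longrightarrow> D x = 0" "deriv \<psi> = D"
    by (rule test_functionE[OF \<psi>]) (rule that; assumption)
  have c: "isCont \<psi> x" for x using t(3) DERIV_isCont by blast
  have c': "continuous_on A \<psi>" for A using c by (simp add: continuous_at_imp_continuous_on)
  obtain F where F: "\<And>x. (F has_vector_derivative \<psi> x) (at x)"
    using einterval_antiderivative[of "-\<infinity>" "\<infinity>" \<psi>] c by auto
  define \<phi> where "\<phi> x = F x - F 0" for x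
  have \<phi>: "(\<phi> has_real_derivative \<psi> x) (at x)" for x
    unfolding \<phi>_def[abs_def] using F[of x] by (auto simp: has_real_derivative_iff_has_vector_derivative intro!: derivative_eq_intros)
  have anti: "antideriv (\<lambda>x. complex_of_real (\<phi> x)) (\<lambda>x. complex_of_real (\<psi> x))"
  proof (rule antideriv_C1)
    show "continuous_on {0..} (\<lambda>x. complex_of_real (\<psi> x))" by (intro continuous_intros c')
    show "((\<lambda>x. complex_of_real (\<phi> x)) has_vector_derivative complex_of_real (\<psi> x)) (at x within {0..})" for x
      by (rule has_vector_derivative_of_real)
         (use \<phi>[of x] in \<open>auto simp: has_real_derivative_iff_has_vector_derivative intro: has_vector_derivative_at_within\<close>)
  qed
  have z: "\<phi> x = 0" if x: "x \<notin> {a..b}" for x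
  proof -
    \<comment> \<open>Negative arguments need a case of their own, since \<open>cumul\<close> sees
      only the positive axis.\<close>
    consider "x < 0" | "0 \<le> x" "x < a" | "b < x" using x t(1,2) by (metis atLeastAtMost_iff not_le)
    then show ?thesis
    proof cases
      case 1
      have "(\<psi> has_integral F 0 - F x) {x..0}"
        by (rule fundamental_theorem_of_calculus) (use 1 F in \<open>auto intro: has_vector_derivative_at_within\<close>)
      moreover have "(\<psi> has_integral 0) {x..0}"
        by (rule has_integral_is_0) (use t(1,5) in auto)
      ultimately have "F 0 - F x = 0" by (rule has_integral_unique)
      then show ?thesis by (simp add: \<phi>_def)
    next
      case 2
      have "complex_of_real (\<phi> x) = cumul (\<lambda>x. complex_of_real (\<psi> x)) x"
        using antideriv_eq[OF anti 2(1)] by (simp add: \<phi>_def)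
      also have "\<dots> = (\<integral>x. 0 \<partial>half)"
        unfolding cumul_def
        by (rule Bochner_Integration.integral_cong) (use 2 t(5) in \<open>auto simp: indicator_def\<close>)
      finally show ?thesis by simp
    next
      case 3
      then have "complex_of_real (\<phi> x) = cumul (\<lambda>x. complex_of_real (\<psi> x)) x"
        using antideriv_eq[OF anti, of x] t(1,2) by (simp add: \<phi>_def)
      also have "\<dots> = (\<integral>x. complex_of_real (\<psi> x) \<partial>half)"
        by (rule cumul_eq_integral) (use 3 t(5) in auto)
      finally show ?thesis using zero by simp
    qed
  qed
  have "\<phi> C1_differentiable_on UNIV"
    using \<phi> c' by (auto simp: C1_differentiable_on_def has_real_derivative_iff_has_vector_derivative)
  then have "test_function \<phi>" using z t(1) by (auto simp: test_function_def)
  moreover have "deriv \<phi> = \<psi>" using \<phi> DERIV_imp_deriv by blast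
  ultimately show ?thesis by (rule that)
qed

text \<open>Subtracting a multiple of a fixed \<zeta> of nonzero mean turns any test function into
  one of mean zero, which is the derivative of a test function and so annihilates \<open>k\<close>.
  Integration against \<open>k\<close> is therefore a multiple of the mean, as it is for a
  constant.\<close>

lemma AE_const_of_weak_deriv_0:
  assumes w: "has_weak_deriv k (\<lambda>_. 0)"
  obtains C where "AE x in half. k x = C"
proof -
  have k: "locally_integrable k" using w by (simp add: has_weak_deriv_def)
  have li1: "locally_integrable (\<lambda>_. c)" for c
    using loc_integrable_half_locally_integrable[OF loc_integrable_half_continuous[of "\<lambda>_. c"]] by simp
  \<comment> \<open>If all test functions had mean zero, the fundamental lemma would make the
    constant 1 vanish almost everywhere.\<close>
  have "\<exists>\<zeta>. test_function \<zeta> \<and> (\<integral>x. complex_of_real (\<zeta> x) \<partial>half) \<noteq> 0"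
  proof (rule ccontr)
    assume "\<not> ?thesis"
    then have "AE x in half. (1::complex) = 0"
      by (intro AE_eq_0_of_test li1) (auto simp: scaleR_conv_of_real)
    then have "AE x in lborel. \<not> 0 < (x::real)" by (simp add: AE_half_iff)
    then have "emeasure lborel {0<..<1::real} = 0"
    proof -
      have "AE x in lborel. x \<notin> {0<..<1::real}"
        using \<open>AE x in lborel. \<not> 0 < (x::real)\<close> by eventually_elim simp
      then show ?thesis
        using emeasure_eq_0_AE[of "\<lambda>y::real. y \<in> {0<..<1}" lborel]
        by (simp del: greaterThanLessThan_iff emeasure_lborel_Ioo)
    qed
    then show False by simp
  qed
  then obtain \<zeta> where \<zeta>: "test_function \<zeta>" and nz: "(\<integral>x. complex_of_real (\<zeta> x) \<partial>half) \<noteq> 0" by blast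
  \<comment> \<open>The \<zeta>-weighted mean of \<open>k\<close>, the only value for which \<zeta>
    itself annihilates k - C.\<close>
  define C where "C = (\<integral>x. \<zeta> x *\<^sub>R k x \<partial>half) / (\<integral>x. complex_of_real (\<zeta> x) \<partial>half)"
  have int1: "integrable half (\<lambda>x. complex_of_real (\<phi> x))" if "test_function \<phi>" for \<phi>
    using test_function_integrable(1)[OF that li1[of 1]] by (simp add: scaleR_conv_of_real)
  have "AE x in half. k x - C = 0"
  proof (rule AE_eq_0_of_test[OF locally_integrable_diff[OF k li1]])
    fix \<phi> assume \<phi>: "test_function \<phi>"
    define I where "I \<phi> = (\<integral>x. \<phi> x \<partial>half)" for \<phi> :: "real \<Rightarrow> real"
    have I: "(\<integral>x. complex_of_real (\<phi> x) \<partial>half) = complex_of_real (I \<phi>)" if "test_function \<phi>" for \<phi>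
      using int1[OF that] unfolding I_def complex_of_real_integrable_eq by (rule integral_of_real)
    define c where "c = I \<phi> / I \<zeta>"
    have I\<zeta>: "I \<zeta> \<noteq> 0" using nz unfolding I[OF \<zeta>] by simp
    have "(\<integral>x. complex_of_real (\<phi> x - c * \<zeta> x) \<partial>half)
      = (\<integral>x. complex_of_real (\<phi> x) \<partial>half) - c * (\<integral>x. complex_of_real (\<zeta> x) \<partial>half)"
      using int1[OF \<phi>] int1[OF \<zeta>] by simp
    also have "\<dots> = 0" using I\<zeta> unfolding I[OF \<phi>] I[OF \<zeta>] by (simp add: c_def)
    finally obtain \<eta> where \<eta>: "test_function \<eta>" "deriv \<eta> = (\<lambda>x. \<phi> x - c * \<zeta> x)"
      using test_function_antiderivative[OF test_function_diff[OF \<phi> \<zeta>]] by blast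
    have "(\<integral>x. (\<phi> x - c * \<zeta> x) *\<^sub>R k x \<partial>half) = 0"
      using w \<eta> by (simp add: has_weak_deriv_iff) metis
    then have "(\<integral>x. \<phi> x *\<^sub>R k x \<partial>half) = c *\<^sub>R (\<integral>x. \<zeta> x *\<^sub>R k x \<partial>half)"
      using test_function_integrable(1)[OF \<phi> k] test_function_integrable(1)[OF \<zeta> k]
      by (simp add: scaleR_diff_left flip: scaleR_scaleR)
    also have "\<dots> = complex_of_real (I \<phi>) * C"
      using I\<zeta> unfolding C_def I[OF \<zeta>] by (simp add: c_def scaleR_conv_of_real)
    finally show "(\<integral>x. \<phi> x *\<^sub>R (k x - C) \<partial>half) = 0"
      using test_function_integrable(1)[OF \<phi> k] int1[OF \<phi>]
      by (simp add: scaleR_diff_right scaleR_conv_of_real[of _ C] I_def)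
  qed
  then show ?thesis by (intro that[of C]) simp
qed

text \<open>Product rule for \<phi> F on [0, b+1]: both boundary values vanish, at 0 because the
  support starts at a > 0, at b + 1 because that point lies beyond the support.\<close>

lemma has_weak_deriv_antideriv:
  assumes F: "antideriv F f"
  shows "has_weak_deriv F f"
  unfolding has_weak_deriv_iff
proof (intro conjI allI impI)
  have cF: "continuous_on {0..} F" by (rule antideriv_continuous[OF F])
  have l: "locally_integrable F" "locally_integrable f"
    using loc_integrable_half_locally_integrable loc_integrable_half_continuous[OF cF] antideriv_loc_integrable_half[OF F] by blast+
  then show "locally_integrable F" "locally_integrable f" by auto
  fix \<phi> assume \<phi>: "test_function \<phi>"
  obtain D a b where t: "0 < a" "a < b" "\<And>x. (\<phi> has_real_derivative D x) (at x)" "continuous_on UNIV D"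
    "\<And>x. x \<notin> {a..b} \<Longrightarrow> \<phi> x = 0" "\<And>x. x \<notin> {a..b} \<Longrightarrow> D x = 0" "deriv \<phi> = D"
    by (rule test_functionE[OF \<phi>]) (rule that; assumption)
  have anti: "antideriv (\<lambda>x. complex_of_real (\<phi> x)) (\<lambda>x. complex_of_real (D x))"
  proof (rule antideriv_C1)
    show "continuous_on {0..} (\<lambda>x. complex_of_real (D x))"
      by (intro continuous_intros continuous_on_subset[OF t(4)]) auto
    show "((\<lambda>x. complex_of_real (\<phi> x)) has_vector_derivative complex_of_real (D x)) (at x within {0..})" for x
      by (rule has_vector_derivative_of_real)
         (use t(3)[of x] in \<open>auto simp: has_real_derivative_iff_has_vector_derivative intro: has_vector_derivative_at_within\<close>)
  qed
  have "\<phi> (b + 1) * F (b + 1) = \<phi> 0 * F 0 + cumul (\<lambda>x. D x * F x + f x * \<phi> x) (b + 1)"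
    by (rule antideriv_eq[OF antideriv_mult[OF anti F]]) (use t(1,2) in simp)
  then have "0 = cumul (\<lambda>x. D x * F x + f x * \<phi> x) (b + 1)"
    using t(1,5) by simp
  also have "\<dots> = (\<integral>x. D x * F x + f x * \<phi> x \<partial>half)"
    by (rule cumul_eq_integral) (use t(5,6) in auto)
  also have "\<dots> = (\<integral>x. D x *\<^sub>R F x \<partial>half) + (\<integral>x. \<phi> x *\<^sub>R f x \<partial>half)"
    using test_function_integrable(2)[OF \<phi> l(1)] test_function_integrable(1)[OF \<phi> l(2)]
    by (simp add: t(7) scaleR_conv_of_real mult.commute)
  finally show "(\<integral>x. deriv \<phi> x *\<^sub>R F x \<partial>half) = - (\<integral>x. \<phi> x *\<^sub>R f x \<partial>half)"
    by (simp add: t(7) eq_neg_iff_add_eq_0)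
qed

section \<open>Regular representatives of H2 profiles\<close>

lemma has_weak_deriv_imp_cumul:
  assumes fg: "has_weak_deriv f g" and g: "loc_integrable_half g"
  obtains C where "AE x in half. f x = C + cumul g x"
proof -
  have "has_weak_deriv (\<lambda>x. f x - (0 + cumul g x)) (\<lambda>x. g x - g x)"
    by (intro has_weak_deriv_diff fg has_weak_deriv_antideriv antideriv_cumul g)
  then obtain C where "AE x in half. f x - cumul g x = C"
    using AE_const_of_weak_deriv_0[of "\<lambda>x. f x - cumul g x"] by auto
  then show ?thesis by (intro that[of C]) (auto elim!: eventually_mono)
qed

text \<open>Every interval (x, x + 1/(n+1)) contains a point of agreement, as it is not a null set;
  approaching from the right covers x = 0.\<close>

lemma continuous_AE_eq:
  fixes f g :: "real \<Rightarrow> complex"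
  assumes f: "continuous_on {0..} f" and g: "continuous_on {0..} g" and ae: "AE x in half. f x = g x" and "0 \<le> x"
  shows "f x = g x"
proof -
  have "\<exists>y. x < y \<and> y < x + 1 / real (Suc n) \<and> f y = g y" for n
  proof (rule ccontr)
    assume *: "\<not> ?thesis"
    have "AE y in lborel. y \<notin> {x<..<x + 1 / real (Suc n)}"
      using ae[unfolded AE_half_iff] by eventually_elim (use * \<open>0 \<le> x\<close> in auto)
    then have "emeasure lborel {x<..<x + 1 / real (Suc n)} = 0"
      using emeasure_eq_0_AE[of "\<lambda>y. y \<in> {x<..<x + 1 / real (Suc n)}" lborel]
      by (simp del: greaterThanLessThan_iff emeasure_lborel_Ioo of_nat_Suc)
    then show False by (simp del: of_nat_Suc)
  qed
  then obtain y where y: "\<And>n. x < y n" "\<And>n. y n < x + 1 / real (Suc n)" "\<And>n. f (y n) = g (y n)" by metis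
  have lim: "y \<longlonglongrightarrow> x"
  proof (rule tendsto_sandwich)
    show "(\<lambda>n. x) \<longlonglongrightarrow> x" by simp
    show "(\<lambda>n. x + 1 / real (Suc n)) \<longlonglongrightarrow> x"
      using tendsto_add[OF tendsto_const[of x] LIMSEQ_inverse_real_of_nat] by (simp add: inverse_eq_divide)
  qed (use y in \<open>auto intro!: always_eventually less_imp_le\<close>)
  have "(\<lambda>n. f (y n)) \<longlonglongrightarrow> f x" "(\<lambda>n. g (y n)) \<longlonglongrightarrow> g x"
    using f g lim y(1) \<open>0 \<le> x\<close> unfolding continuous_on_sequentially comp_def
    by (meson atLeast_iff less_imp_le order_trans)+
  then show ?thesis using y(3) LIMSEQ_unique by simp
qed

text \<open>The second weak derivative makes the first absolutely continuous after a change on a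
  null set, and then u satisfies the integral relation almost everywhere. Continuity of u extends it
  to all of [0,\<infinity>), the boundary point included.\<close>

lemma H2_halfline_H1:
  assumes u: "u \<in> H2_halfline" and c: "continuous_on {0..} u"
  obtains p h where "H1 u p" "H1 p h"
proof -
  obtain g h where g: "square_integrable half g" "has_weak_deriv u g" and h: "square_integrable half h" "has_weak_deriv g h"
    using u by (auto simp: H2_halfline_def L2_halfline_iff)
  have su: "square_integrable half u" using u by (simp add: H2_halfline_def L2_halfline_iff)
  obtain C where C: "AE x in half. g x = C + cumul h x"
    using has_weak_deriv_imp_cumul[OF h(2) square_integrable_loc_integrable_half[OF h(1)]] by blast
  define p where "p x = C + cumul h x" for x
  have ph: "antideriv p h" unfolding p_def by (rule antideriv_cumul[OF square_integrable_loc_integrable_half[OF h(1)]])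
  have cp: "continuous_on {0..} p" by (rule antideriv_continuous[OF ph])
  have gp: "AE x in half. g x = p x" using C by (simp add: p_def)
  have p_L2: "square_integrable half p" by (rule square_integrable_cong_AE[OF gp g(1) continuous_on_measurable_half[OF cp]])
  have up: "has_weak_deriv u p"
    by (rule has_weak_deriv_cong_AE[OF g(2) _ gp square_integrable_measurable[OF su] square_integrable_measurable[OF p_L2]]) simp
  obtain C' where C': "AE x in half. u x = C' + cumul p x"
    using has_weak_deriv_imp_cumul[OF up square_integrable_loc_integrable_half[OF p_L2]] by blast
  have eq: "u x = C' + cumul p x" if "0 \<le> x" for x
    by (rule continuous_AE_eq[OF c _ C' that]) (intro continuous_intros continuous_on_cumul square_integrable_loc_integrable_half[OF p_L2])
  have "antideriv u p"
    unfolding antideriv_def using eq[of 0] by (auto simp: eq square_integrable_loc_integrable_half[OF p_L2])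
  then show ?thesis using su p_L2 ph h(1) by (intro that[of p h]) (auto simp: H1_def)
qed

text \<open>Whatever the choice operator picks is a weak derivative as soon as one exists, so
  uniqueness up to null sets identifies it with \<open>g\<close>.\<close>

lemma weak_deriv_AE:
  assumes "has_weak_deriv f g"
  shows "AE x in half. weak_deriv f x = g x" "weak_deriv f \<in> borel_measurable half"
proof -
  have w: "has_weak_deriv f (weak_deriv f)"
    unfolding weak_deriv_def using assms someI[of "has_weak_deriv f"] by blast
  show "AE x in half. weak_deriv f x = g x" by (rule has_weak_deriv_unique[OF w assms])
  show "weak_deriv f \<in> borel_measurable half"
    using w locally_integrable_measurable by (auto simp: has_weak_deriv_def)
qed

lemma weak_deriv_H1:
  assumes u: "H1 u p" and p: "H1 p h"
  shows "AE x in half. weak_deriv u x = p x" "AE x in half. weak_deriv (weak_deriv u) x = h x"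
    "weak_deriv u \<in> borel_measurable half" "weak_deriv (weak_deriv u) \<in> borel_measurable half"
proof -
  have up: "has_weak_deriv u p" and ph: "has_weak_deriv p h"
    using u p by (auto simp: H1_def intro: has_weak_deriv_antideriv)
  note w = weak_deriv_AE[OF up]
  have "has_weak_deriv (weak_deriv u) h"
    by (rule has_weak_deriv_cong_AE[OF ph _ _ w(2)])
       (use w(1) p in \<open>auto simp: H1_def square_integrable_def elim: eventually_mono\<close>)
  then show "AE x in half. weak_deriv u x = p x" "AE x in half. weak_deriv (weak_deriv u) x = h x"
    "weak_deriv u \<in> borel_measurable half" "weak_deriv (weak_deriv u) \<in> borel_measurable half"
    using w weak_deriv_AE by auto
qed

text \<open>This removes the chosen weak derivatives: the H2 norm becomes a real expression in three
  L2 norms, so convergence in H2 controls q, q_x and q_xx at once.\<close>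

lemma H2_norm_H1:
  assumes u: "H1 u p" and p: "H1 p h"
  shows "H2_norm u = ennreal (sqrt ((norm_L2 half u)\<^sup>2 + (norm_L2 half p)\<^sup>2 + (norm_L2 half h)\<^sup>2))"
proof -
  note w = weak_deriv_H1[OF u p]
  have s: "square_integrable half u" "square_integrable half p" "square_integrable half h" using u p by (auto simp: H1_def)
  have eq: "Lp_norm 2 {0<..} g = ennreal (norm_L2 half f)"
    if "AE x in half. g x = f x" "square_integrable half f" "g \<in> borel_measurable half" for f g
  proof -
    have "square_integrable half g" by (rule square_integrable_cong_AE[OF _ that(2,3)]) (use that(1) in \<open>auto elim: eventually_mono\<close>)
    then show ?thesis using Lp_norm_half norm_L2_cong_AE that by metis
  qed
  have "H2_norm u = epowr (ennreal ((norm_L2 half u)\<^sup>2 + (norm_L2 half p)\<^sup>2 + (norm_L2 half h)\<^sup>2)) (1 / 2)"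
    unfolding H2_norm_def Lp_norm_half[OF s(1)] eq[OF w(1) s(2) w(3)] eq[OF w(2) s(3) w(4)]
    by (simp add: ennreal_power flip: ennreal_plus)
  then show ?thesis by (simp only: epowr_half add_nonneg_nonneg zero_le_power2)
qed


section \<open>Conservation laws and the boundary estimate\<close>

lemma loc_integrable_half_mult_left: "loc_integrable_half f \<Longrightarrow> loc_integrable_half (\<lambda>x. c * f x)"
  by (simp add: loc_integrable_half_def flip: mult_scaleR_right del: mult_scaleR_right)

lemma cumul_mult_left: "cumul (\<lambda>x. c * f x) b = c * cumul f b"
  by (simp add: cumul_def flip: mult_scaleR_right del: mult_scaleR_right)

lemma H1_mult_left: "H1 F f \<Longrightarrow> H1 (\<lambda>x. c * F x) (\<lambda>x. c * f x)"
  by (simp add: H1_def antideriv_def square_integrable_mult_left loc_integrable_half_mult_left cumul_mult_left flip: right_diff_distrib)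

lemma H1_add:
  assumes "H1 F f" "H1 G g"
  shows "H1 (\<lambda>x. F x + G x) (\<lambda>x. f x + g x)"
  using H1_diff[OF assms(1) H1_mult_left[OF assms(2), of "-1"]] by simp

text \<open>Multiplication by \<i> is skew-symmetric for the real inner product; the cancellations
  in the balance laws rest on this.\<close>

lemma inner_ii_self: "(\<i> * z) \<bullet> z = 0" "z \<bullet> (\<i> * z) = 0"
  by (simp_all add: inner_complex_def)

lemma inner_ii_left: "(\<i> * a) \<bullet> b = - (a \<bullet> (\<i> * b))"
  by (simp add: inner_complex_def)

lemma inner_L2_ii_left: "inner_L2 M (\<lambda>x. \<i> * f x) g = - inner_L2 M f (\<lambda>x. \<i> * g x)"
  by (simp add: inner_L2_def inner_ii_left)

lemma inner_L2_ii_self: "inner_L2 M (\<lambda>x. \<i> * f x) f = 0" "inner_L2 M f (\<lambda>x. \<i> * f x) = 0"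
  by (simp_all add: inner_L2_def inner_ii_self)

lemma eventually_at_within_ne:
  "\<forall>\<^sub>F s in at t within S. s \<in> S \<and> s \<noteq> t"
  by (auto simp: eventually_at_filter)

text \<open>Time is the first argument, unlike in \<open>classical_solution\<close>; \<open>p\<close>, \<open>h\<close> and \<open>v\<close> are
  \<open>q\<^sub>x\<close>, \<open>q\<^sub>x\<^sub>x\<close> and \<open>q\<^sub>t\<close>.\<close>

locale nls_half_line =
  fixes lam :: real and q p h v :: "real \<Rightarrow> real \<Rightarrow> complex" and Q Q' :: "real \<Rightarrow> complex"
  assumes qp: "0 \<le> t \<Longrightarrow> H1 (q t) (p t)"
    and ph: "0 \<le> t \<Longrightarrow> H1 (p t) (h t)"
    and q_conv: "0 \<le> t \<Longrightarrow> converges_L2 half (at t within {0..}) q (q t)"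
    and p_conv: "0 \<le> t \<Longrightarrow> converges_L2 half (at t within {0..}) p (p t)"
    and h_conv: "0 \<le> t \<Longrightarrow> converges_L2 half (at t within {0..}) h (h t)"
    and v_conv: "0 \<le> t \<Longrightarrow>
      converges_L2 half (at t within {0..}) (\<lambda>s x. (q s x - q t x) /\<^sub>R (s - t)) (v t)"
    and eq: "0 \<le> t \<Longrightarrow> AE x in half. \<i> * v t x + h t x
      - 2 * complex_of_real lam * complex_of_real ((norm (q t x))\<^sup>2) * q t x = 0"
    and init: "0 \<le> x \<Longrightarrow> q 0 x = 0"
    and bdry: "0 \<le> t \<Longrightarrow> q t 0 = Q t"
    and Q': "0 \<le> t \<Longrightarrow> (Q has_vector_derivative Q' t) (at t within {0..})"
    and Q'_cont: "continuous_on {0..} Q'"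
begin

definition P :: "real \<Rightarrow> complex" where
  "P t = p t 0"

definition cubic :: "real \<Rightarrow> real \<Rightarrow> complex" where
  "cubic t x = of_real ((norm (q t x))\<^sup>2) * q t x"

section \<open>Continuity in time of boundary values, sup norms and the nonlinearity\<close>

lemma q_L2: "0 \<le> t \<Longrightarrow> square_integrable half (q t)" and p_L2: "0 \<le> t \<Longrightarrow> square_integrable half (p t)"
  and h_L2: "0 \<le> t \<Longrightarrow> square_integrable half (h t)" and v_L2: "0 \<le> t \<Longrightarrow> square_integrable half (v t)"
  using qp[of t] ph[of t] v_conv[of t] by (auto simp: H1_def converges_L2_def)

lemma Q_tendsto: "0 \<le> t \<Longrightarrow> (Q \<longlongrightarrow> Q t) (at t within {0..})"
  using has_vector_derivative_continuous[OF Q', of t] by (simp add: continuous_within)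

lemma Q_cont: "continuous_on {0..} Q"
  unfolding continuous_on_def using Q_tendsto by auto

lemma Q_quotient:
  assumes "0 \<le> t"
  shows "((\<lambda>s. (Q s - Q t) /\<^sub>R (s - t)) \<longlongrightarrow> Q' t) (at t within {0..})"
proof -
  have "((\<lambda>s. norm ((Q s - Q t) /\<^sub>R (s - t) - Q' t)) \<longlongrightarrow> 0) (at t within {0..})"
  proof (rule Lim_transform_eventually)
    show "((\<lambda>s. norm (Q s - Q t - (s - t) *\<^sub>R Q' t) / norm (s - t)) \<longlongrightarrow> 0) (at t within {0..})"
      using Q'[OF assms] by (simp add: has_vector_derivative_def has_derivative_iff_norm)
    show "\<forall>\<^sub>F s in at t within {0..}. norm (Q s - Q t - (s - t) *\<^sub>R Q' t) / norm (s - t)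
        = norm ((Q s - Q t) /\<^sub>R (s - t) - Q' t)"
      using eventually_at_within_ne
    proof eventually_elim
      case (elim s)
      then have "(Q s - Q t) /\<^sub>R (s - t) - Q' t = (Q s - Q t - (s - t) *\<^sub>R Q' t) /\<^sub>R (s - t)"
        by (simp add: scaleR_diff_right)
      then show ?case by (simp add: divide_inverse_commute)
    qed
  qed
  then show ?thesis by (simp add: tendsto_norm_zero_iff LIM_zero_iff)
qed

lemma differences_tendsto_0:
  assumes "0 \<le> t"
  shows "((\<lambda>s. norm_L2 half (\<lambda>x. q s x - q t x)) \<longlongrightarrow> 0) (at t within {0..})"
    and "((\<lambda>s. norm_L2 half (\<lambda>x. p s x - p t x)) \<longlongrightarrow> 0) (at t within {0..})"
    and "((\<lambda>s. norm_L2 half (\<lambda>x. h s x - h t x)) \<longlongrightarrow> 0) (at t within {0..})"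
  using q_conv[OF assms] p_conv[OF assms] h_conv[OF assms] by (auto simp: converges_L2_def)

text \<open>The sup bound at x = 0 for p(s) - p(t) involves q_xx, so continuity in time with values
  in H2, and not only in H1, enters here.\<close>

lemma P_tendsto:
  assumes "0 \<le> t"
  shows "(P \<longlongrightarrow> P t) (at t within {0..})"
proof -
  have "((\<lambda>s. P s - P t) \<longlongrightarrow> 0) (at t within {0..})"
  proof (rule Lim_null_comparison)
    show "((\<lambda>s. sqrt (2 * norm_L2 half (\<lambda>x. p s x - p t x) * norm_L2 half (\<lambda>x. h s x - h t x))) \<longlongrightarrow> 0) (at t within {0..})"
      using tendsto_real_sqrt[OF tendsto_mult[OF tendsto_mult[OF tendsto_const[of 2] differences_tendsto_0(2)[OF assms]] differences_tendsto_0(3)[OF assms]]] by simp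
    show "\<forall>\<^sub>F s in at t within {0..}. norm (P s - P t)
        \<le> sqrt (2 * norm_L2 half (\<lambda>x. p s x - p t x) * norm_L2 half (\<lambda>x. h s x - h t x))"
      using eventually_at_within_ne
    proof eventually_elim
      case (elim s)
      then show ?case
        unfolding P_def using H1_sup_bound[OF H1_diff[OF ph ph], of s t 0] assms by (simp add: real_le_rsqrt)
    qed
  qed
  then show ?thesis by (rule LIM_zero_cancel)
qed

lemma P_cont: "continuous_on {0..} P"
  unfolding continuous_on_def using P_tendsto by auto

text \<open>The sup bound for q(s) - q(t) turns L2 continuity of q and q_x into convergence uniform
  in x, as the multiplier |q|^2 requires.\<close>

lemma q_uniform:
  assumes "0 \<le> t"
  shows "uniform_limit (space half) q (q t) (at t within {0..})"
proof (rule uniform_limitI)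
  fix e :: real assume "0 < e"
  have "((\<lambda>s. sqrt (2 * norm_L2 half (\<lambda>x. q s x - q t x) * norm_L2 half (\<lambda>x. p s x - p t x))) \<longlongrightarrow> 0) (at t within {0..})"
    using tendsto_real_sqrt[OF tendsto_mult[OF tendsto_mult[OF tendsto_const[of 2] differences_tendsto_0(1)[OF assms]] differences_tendsto_0(2)[OF assms]]] by simp
  from order_tendstoD(2)[OF this \<open>0 < e\<close>] eventually_at_within_ne[of "{0..}" t]
  show "\<forall>\<^sub>F s in at t within {0..}. \<forall>x\<in>space half. dist (q s x) (q t x) < e"
  proof eventually_elim
    case (elim s)
    show ?case
    proof
      fix x assume x: "x \<in> space half"
      have "norm (q s x - q t x) \<le> sqrt (2 * norm_L2 half (\<lambda>x. q s x - q t x) * norm_L2 half (\<lambda>x. p s x - p t x))"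
        using H1_sup_bound[OF H1_diff[OF qp qp], of s t x] assms elim x by (simp add: real_le_rsqrt)
      then show "dist (q s x) (q t x) < e" using elim by (simp add: dist_norm)
    qed
  qed
qed

lemma q_bounded: "0 \<le> t \<Longrightarrow> bounded (q t ` space half)"
  using H1_bounded[OF qp, of t] unfolding bounded_iff by (metis greaterThan_iff imageE less_imp_le space_half)

lemma norm_sq_conv:
  assumes "0 \<le> t"
  shows "uniform_limit (space half) (\<lambda>s x. complex_of_real ((norm (q s x))\<^sup>2)) (\<lambda>x. complex_of_real ((norm (q t x))\<^sup>2)) (at t within {0..})"
proof -
  have e: "complex_of_real ((norm z)\<^sup>2) = z * cnj z" for z by (rule complex_norm_square)
  have "uniform_limit (space half) (\<lambda>s x. cnj (q s x)) (\<lambda>x. cnj (q t x)) (at t within {0..})"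
    using q_uniform[OF assms] by (simp add: uniform_limit_iff dist_norm flip: complex_cnj_diff)
  moreover have "bounded ((\<lambda>x. cnj (q t x)) ` space half)"
    using q_bounded[OF assms] by (auto simp: bounded_iff)
  ultimately show ?thesis
    unfolding e by (intro uniform_lim_mult q_uniform q_bounded assms)
qed

lemma norm_sq_bounded: "0 \<le> t \<Longrightarrow> bounded ((\<lambda>x. complex_of_real ((norm (q t x))\<^sup>2)) ` space half)"
proof -
  assume t: "0 \<le> t"
  obtain B where "\<And>x. x \<in> space half \<Longrightarrow> norm (q t x) \<le> B"
    using q_bounded[OF t] by (auto simp: bounded_iff)
  then have "norm (complex_of_real ((norm (q t x))\<^sup>2)) \<le> B\<^sup>2" if "x \<in> space half" for x
    using that by (auto simp: norm_power intro!: power_mono)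
  then show ?thesis by (auto simp: bounded_iff)
qed

lemma cubic_L2: "0 \<le> t \<Longrightarrow> square_integrable half (cubic t)"
proof -
  assume t: "0 \<le> t"
  note [measurable] = square_integrable_measurable[OF q_L2[OF t]]
  obtain B where B: "\<And>x. x \<in> space half \<Longrightarrow> norm (complex_of_real ((norm (q t x))\<^sup>2)) \<le> B"
    using norm_sq_bounded[OF t] by (auto simp: bounded_iff)
  show ?thesis
    by (rule square_integrable_bound[OF q_L2[OF t], where C = B])
       (use B in \<open>auto simp: cubic_def[abs_def] norm_mult intro!: mult_right_mono\<close>)
qed

text \<open>The form in which the functionals are differentiated: only the first factor is a
  difference quotient, and it may be paired with any factor that converges in L2.\<close>

lemma quotient_tendsto:
  assumes t: "0 \<le> t" and b: "converges_L2 half (at t within {0..}) b b0"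
  shows "((\<lambda>s. inner_L2 half (\<lambda>x. q s x - q t x) (b s) / (s - t)) \<longlongrightarrow> inner_L2 half (v t) b0) (at t within {0..})"
  using converges_L2_inner[OF v_conv[OF t] b] by (simp add: inner_L2_scaleR_left divide_inverse_commute)

section \<open>The equation solved for q_t and q_xx, and the balance laws\<close>

lemma v_eq_AE: "0 \<le> t \<Longrightarrow> AE x in half. v t x = \<i> * (h t x - (2 * lam) *\<^sub>R cubic t x)"
proof -
  assume "0 \<le> t"
  from eq[OF this] show ?thesis
  proof eventually_elim
    case (elim x)
    then have "\<i> * v t x = - (h t x - (2 * lam) *\<^sub>R cubic t x)"
      by (simp add: cubic_def scaleR_conv_of_real mult.assoc) (simp add: algebra_simps add_eq_0_iff)
    then have "- \<i> * (\<i> * v t x) = \<i> * (h t x - (2 * lam) *\<^sub>R cubic t x)"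
      by (simp only: minus_mult_minus)
    moreover have "- \<i> * (\<i> * v t x) = v t x" by (simp flip: mult.assoc)
    ultimately show ?case by simp
  qed
qed

lemma h_eq_AE: "0 \<le> t \<Longrightarrow> AE x in half. h t x = (2 * lam) *\<^sub>R cubic t x - \<i> * v t x"
  by (drule v_eq_AE) (auto elim!: eventually_mono simp: right_diff_distrib simp flip: mult.assoc)

text \<open>The cubic term drops because \<i> |q|^2 q is pointwise orthogonal to q; in the other
  term integration by parts leaves <\<i> q_x, q_x> = 0 and the boundary value.\<close>

lemma v_inner_q:
  assumes t: "0 \<le> t"
  shows "inner_L2 half (v t) (q t) = - ((\<i> * P t) \<bullet> Q t)"
proof -
  note s = q_L2[OF t] p_L2[OF t] h_L2[OF t] v_L2[OF t] cubic_L2[OF t]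
  have "inner_L2 half (v t) (q t) = inner_L2 half (\<lambda>x. \<i> * (h t x - (2 * lam) *\<^sub>R cubic t x)) (q t)"
    by (rule inner_L2_cong_AE) (use v_eq_AE[OF t] s in \<open>auto intro!: square_integrable_intros\<close>)
  also have "\<dots> = inner_L2 half (\<lambda>x. \<i> * h t x) (q t) - inner_L2 half (\<lambda>x. \<i> * ((2 * lam) *\<^sub>R cubic t x)) (q t)"
    unfolding right_diff_distrib by (rule inner_L2_diff_left) (intro square_integrable_intros s)+
  also have "inner_L2 half (\<lambda>x. \<i> * ((2 * lam) *\<^sub>R cubic t x)) (q t) = 0"
  proof -
    have "(\<i> * cubic t x) \<bullet> q t x = 0" for x
      by (simp add: cubic_def inner_complex_def)
    then show ?thesis by (simp add: inner_L2_def)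
  qed
  also have "inner_L2 half (\<lambda>x. \<i> * h t x) (q t) = - ((\<i> * P t) \<bullet> Q t)"
    using H1_parts[OF H1_mult_left[OF ph[OF t], of \<i>] qp[OF t]] bdry[OF t] by (simp add: inner_L2_ii_self P_def)
  finally show ?thesis by simp
qed

text \<open>The increment of the squared norm is <q(s) - q(t), q(s) + q(t)>, and the second factor
  tends to 2 q(t).\<close>

lemma mass_derivative:
  assumes t: "0 \<le> t"
  shows "((\<lambda>s. (norm_L2 half (q s))\<^sup>2) has_real_derivative - 2 * ((\<i> * P t) \<bullet> Q t)) (at t within {0..})"
  unfolding has_field_derivative_iff
proof (rule Lim_transform_eventually)
  have "converges_L2 half (at t within {0..}) (\<lambda>s x. q s x + q t x) (\<lambda>x. q t x + q t x)"
    by (intro converges_L2_add q_conv converges_L2_const q_L2 t)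
  from quotient_tendsto[OF t this]
  show "((\<lambda>s. inner_L2 half (\<lambda>x. q s x - q t x) (\<lambda>x. q s x + q t x) / (s - t)) \<longlongrightarrow> - 2 * ((\<i> * P t) \<bullet> Q t)) (at t within {0..})"
    using inner_L2_add_right[OF q_L2[OF t] q_L2[OF t] v_L2[OF t]] v_inner_q[OF t] by simp
  show "\<forall>\<^sub>F s in at t within {0..}. inner_L2 half (\<lambda>x. q s x - q t x) (\<lambda>x. q s x + q t x) / (s - t)
      = ((norm_L2 half (q s))\<^sup>2 - (norm_L2 half (q t))\<^sup>2) / (s - t)"
    using eventually_at_within_ne
  proof eventually_elim
    case (elim s)
    then have s: "0 \<le> s" by auto
    have "inner_L2 half (\<lambda>x. q s x - q t x) (\<lambda>x. q s x + q t x) = (norm_L2 half (q s))\<^sup>2 - (norm_L2 half (q t))\<^sup>2"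
      by (simp add: inner_L2_diff_left inner_L2_add_right q_L2 s t square_integrable_add inner_L2_commute[of half "q t" "q s"] flip: inner_L2_self)
    then show ?case by simp
  qed
qed

text \<open>In <p(s) - p(t), p(s) + p(t)> the first factor is the x-derivative of q(s) - q(t).
  Integration by parts shifts that derivative onto the sum, leaving h(s) + h(t) and the boundary
  increment Q(s) - Q(t).\<close>

lemma gradient_derivative:
  assumes t: "0 \<le> t"
  shows "((\<lambda>s. (norm_L2 half (p s))\<^sup>2) has_real_derivative - 2 * (Q' t \<bullet> P t) - 2 * inner_L2 half (v t) (h t)) (at t within {0..})"
  unfolding has_field_derivative_iff
proof (rule Lim_transform_eventually)
  have "converges_L2 half (at t within {0..}) (\<lambda>s x. h s x + h t x) (\<lambda>x. h t x + h t x)"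
    by (intro converges_L2_add h_conv converges_L2_const h_L2 t)
  from quotient_tendsto[OF t this]
  have 1: "((\<lambda>s. inner_L2 half (\<lambda>x. q s x - q t x) (\<lambda>x. h s x + h t x) / (s - t)) \<longlongrightarrow> 2 * inner_L2 half (v t) (h t)) (at t within {0..})"
    using inner_L2_add_right[OF h_L2[OF t] h_L2[OF t] v_L2[OF t]] by simp
  have 2: "((\<lambda>s. ((Q s - Q t) /\<^sub>R (s - t)) \<bullet> (P s + P t)) \<longlongrightarrow> Q' t \<bullet> (P t + P t)) (at t within {0..})"
    by (intro tendsto_intros Q_quotient P_tendsto t)
  show "((\<lambda>s. - (((Q s - Q t) /\<^sub>R (s - t)) \<bullet> (P s + P t)) - inner_L2 half (\<lambda>x. q s x - q t x) (\<lambda>x. h s x + h t x) / (s - t))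
      \<longlongrightarrow> - 2 * (Q' t \<bullet> P t) - 2 * inner_L2 half (v t) (h t)) (at t within {0..})"
    using tendsto_diff[OF tendsto_minus[OF 2] 1] unfolding inner_add_right by simp
  show "\<forall>\<^sub>F s in at t within {0..}. - (((Q s - Q t) /\<^sub>R (s - t)) \<bullet> (P s + P t)) - inner_L2 half (\<lambda>x. q s x - q t x) (\<lambda>x. h s x + h t x) / (s - t)
      = ((norm_L2 half (p s))\<^sup>2 - (norm_L2 half (p t))\<^sup>2) / (s - t)"
    using eventually_at_within_ne
  proof eventually_elim
    case (elim s)
    then have s: "0 \<le> s" by auto
    have "inner_L2 half (\<lambda>x. p s x - p t x) (\<lambda>x. p s x + p t x) = (norm_L2 half (p s))\<^sup>2 - (norm_L2 half (p t))\<^sup>2"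
      by (simp add: inner_L2_diff_left inner_L2_add_right p_L2 s t square_integrable_add inner_L2_commute[of half "p t" "p s"] flip: inner_L2_self)
    then have "(norm_L2 half (p s))\<^sup>2 - (norm_L2 half (p t))\<^sup>2
      = - ((Q s - Q t) \<bullet> (P s + P t)) - inner_L2 half (\<lambda>x. q s x - q t x) (\<lambda>x. h s x + h t x)"
      using H1_parts[OF H1_diff[OF qp[OF s] qp[OF t]] H1_add[OF ph[OF s] ph[OF t]]] bdry[OF s] bdry[OF t]
      by (simp add: P_def)
    then show ?case by (simp add: divide_inverse_commute right_diff_distrib)
  qed
qed

text \<open>|a|^4 - |b|^4 = <a - b, (|a|^2 + |b|^2)(a + b)> with a = q(s), b = q(t). The second
  factor tends to 4 |q|^2 q in L2, its multiplier converging uniformly.\<close>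

lemma quartic_derivative:
  assumes t: "0 \<le> t"
  shows "((\<lambda>s. inner_L2 half (cubic s) (q s)) has_real_derivative 4 * inner_L2 half (v t) (cubic t)) (at t within {0..})"
  unfolding has_field_derivative_iff
proof (rule Lim_transform_eventually)
  let ?m = "\<lambda>s x. complex_of_real ((norm (q s x))\<^sup>2) + complex_of_real ((norm (q t x))\<^sup>2)"
  have "converges_L2 half (at t within {0..}) (\<lambda>s x. q s x + q t x) (\<lambda>x. q t x + q t x)"
    by (intro converges_L2_add q_conv converges_L2_const q_L2 t)
  moreover have "uniform_limit (space half) ?m (?m t) (at t within {0..})"
    by (intro uniform_limit_add norm_sq_conv uniform_limit_const t)
  moreover have "bounded (?m t ` space half)"
    by (intro bounded_plus_comp norm_sq_bounded t)
  moreover have "\<forall>\<^sub>F s in at t within {0..}. ?m s \<in> borel_measurable half"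
    using eventually_at_within_ne
  proof eventually_elim
    case (elim s)
    then have "0 \<le> s" by auto
    note [measurable] = square_integrable_measurable[OF q_L2[OF t]] square_integrable_measurable[OF q_L2[OF this]]
    show ?case by measurable
  qed
  moreover have "?m t \<in> borel_measurable half"
  proof -
    note [measurable] = square_integrable_measurable[OF q_L2[OF t]]
    show ?thesis by measurable
  qed
  ultimately have "converges_L2 half (at t within {0..}) (\<lambda>s x. ?m s x * (q s x + q t x)) (\<lambda>x. ?m t x * (q t x + q t x))"
    by (rule converges_L2_mult_uniform)
  moreover have "(\<lambda>x. ?m t x * (q t x + q t x)) = (\<lambda>x. 4 *\<^sub>R cubic t x)"
    by (simp add: fun_eq_iff cubic_def scaleR_conv_of_real algebra_simps)
  ultimately have "converges_L2 half (at t within {0..}) (\<lambda>s x. ?m s x * (q s x + q t x)) (\<lambda>x. 4 *\<^sub>R cubic t x)"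
    by simp
  from quotient_tendsto[OF t this]
  show "((\<lambda>s. inner_L2 half (\<lambda>x. q s x - q t x) (\<lambda>x. ?m s x * (q s x + q t x)) / (s - t)) \<longlongrightarrow> 4 * inner_L2 half (v t) (cubic t)) (at t within {0..})"
    by (simp add: inner_L2_scaleR_right)
  show "\<forall>\<^sub>F s in at t within {0..}. inner_L2 half (\<lambda>x. q s x - q t x) (\<lambda>x. ?m s x * (q s x + q t x)) / (s - t)
      = (inner_L2 half (cubic s) (q s) - inner_L2 half (cubic t) (q t)) / (s - t)"
    using eventually_at_within_ne
  proof eventually_elim
    case (elim s)
    then have s: "0 \<le> s" by auto
    have "(a - b) \<bullet> ((complex_of_real ((norm a)\<^sup>2) + complex_of_real ((norm b)\<^sup>2)) * (a + b))
      = (of_real ((norm a)\<^sup>2) * a) \<bullet> a - (of_real ((norm b)\<^sup>2) * b) \<bullet> b" for a b :: complex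
      by (simp add: inner_complex_def cmod_power2 flip: of_real_power of_real_add) (simp add: algebra_simps power2_eq_square)
    then have "inner_L2 half (\<lambda>x. q s x - q t x) (\<lambda>x. ?m s x * (q s x + q t x))
      = (\<integral>x. cubic s x \<bullet> q s x - cubic t x \<bullet> q t x \<partial>half)"
      by (simp add: inner_L2_def cubic_def)
    also have "\<dots> = inner_L2 half (cubic s) (q s) - inner_L2 half (cubic t) (q t)"
      unfolding inner_L2_def by (intro Bochner_Integration.integral_diff square_integrable_integrable_inner cubic_L2 q_L2 s t)
    finally show ?case by simp
  qed
qed

text \<open>With q_xx taken from the equation, q_t is orthogonal to \<i> q_t, and the remaining 2
  \<lambda> <q_t, |q|^2 q> cancels against the quartic term as - 4 \<lambda> + 4 \<lambda> = 0; only
  the boundary flux is left.\<close>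

lemma energy_derivative:
  assumes t: "0 \<le> t"
  shows "((\<lambda>s. (norm_L2 half (p s))\<^sup>2 + lam * inner_L2 half (cubic s) (q s)) has_real_derivative - 2 * (Q' t \<bullet> P t)) (at t within {0..})"
proof -
  note s = q_L2[OF t] p_L2[OF t] h_L2[OF t] v_L2[OF t] cubic_L2[OF t]
  have "inner_L2 half (v t) (h t) = inner_L2 half (v t) (\<lambda>x. (2 * lam) *\<^sub>R cubic t x - \<i> * v t x)"
    by (rule inner_L2_cong_AE) (use h_eq_AE[OF t] s in \<open>auto intro!: square_integrable_intros\<close>)
  also have "\<dots> = 2 * lam * inner_L2 half (v t) (cubic t)"
    by (subst inner_L2_diff_right) (auto intro!: square_integrable_intros s simp: inner_L2_scaleR_right inner_L2_ii_self)
  finally have "- 2 * (Q' t \<bullet> P t) - 2 * inner_L2 half (v t) (h t) + lam * (4 * inner_L2 half (v t) (cubic t)) = - 2 * (Q' t \<bullet> P t)"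
    by simp
  with DERIV_add[OF gradient_derivative[OF t] DERIV_cmult[OF quartic_derivative[OF t], of lam]] show ?thesis
    by (rule DERIV_cong)
qed

text \<open>The integrand 4 <|q|^2 q, q_x> is the x-derivative of |q|^4. Integrating the H1 function
  |q|^2 by parts against its own derivative gives the boundary value directly.\<close>

lemma cubic_inner_p:
  assumes t: "0 \<le> t"
  shows "4 * inner_L2 half (cubic t) (p t) = - ((norm (Q t)) ^ 4)"
proof -
  have H: "H1 (\<lambda>x. q t x * cnj (q t x)) (\<lambda>x. p t x * cnj (q t x) + cnj (p t x) * q t x)" (is "H1 ?F ?f")
    by (intro H1_mult H1_cnj qp t)
  have "?F x \<bullet> ?f x = 2 * (cubic t x \<bullet> p t x)" for x
    unfolding cubic_def complex_norm_square by (simp add: inner_complex_def algebra_simps)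
  then have e: "inner_L2 half ?F ?f = 2 * inner_L2 half (cubic t) (p t)"
    by (simp add: inner_L2_def)
  have "2 * inner_L2 half ?F ?f = - (?F 0 \<bullet> ?F 0)"
    using H1_parts[OF H H] inner_L2_commute[of half ?F ?f] by simp
  moreover have "?F 0 \<bullet> ?F 0 = (norm (Q t)) ^ 4"
    using bdry[OF t] by (simp add: norm_mult power2_eq_square eval_nat_numeral flip: power2_norm_eq_inner)
  ultimately show ?thesis by (simp add: e)
qed

text \<open>Formally the derivative is - 2 <q_t, \<i> q_x> - <\<i> Q, Q'>. Since \<i> q_t = 2
  \<lambda> |q|^2 q - q_xx, the first part consists of x-derivatives of |q|^4 and |q_x|^2, of which
  only |P|^2 - \<lambda> |Q|^4 at the boundary survives.\<close>

lemma momentum_derivative: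
  assumes t: "0 \<le> t"
  shows "((\<lambda>s. inner_L2 half (\<lambda>x. \<i> * q s x) (p s)) has_real_derivative
    (norm (P t))\<^sup>2 - lam * (norm (Q t)) ^ 4 - (\<i> * Q t) \<bullet> Q' t) (at t within {0..})"
  unfolding has_field_derivative_iff
proof (rule Lim_transform_eventually)
  note st = q_L2[OF t] p_L2[OF t] h_L2[OF t] v_L2[OF t] cubic_L2[OF t]
  have ii_p: "converges_L2 half (at t within {0..}) (\<lambda>s x. \<i> * p s x) (\<lambda>x. \<i> * p t x)"
    by (rule converges_L2_mult_uniform[OF p_conv[OF t]]) (auto intro: uniform_limit_const simp: image_constant_conv)
  have "converges_L2 half (at t within {0..}) (\<lambda>s x. \<i> * p s x + \<i> * p t x) (\<lambda>x. \<i> * p t x + \<i> * p t x)"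
    by (intro converges_L2_add ii_p converges_L2_const square_integrable_intros st)
  from quotient_tendsto[OF t this]
  have 1: "((\<lambda>s. inner_L2 half (\<lambda>x. q s x - q t x) (\<lambda>x. \<i> * p s x + \<i> * p t x) / (s - t)) \<longlongrightarrow> 2 * inner_L2 half (v t) (\<lambda>x. \<i> * p t x)) (at t within {0..})"
    using inner_L2_add_right[OF square_integrable_mult_left[OF st(2)] square_integrable_mult_left[OF st(2)] st(4), of \<i> \<i>] by simp
  have 2: "((\<lambda>s. (\<i> * Q t) \<bullet> ((Q s - Q t) /\<^sub>R (s - t))) \<longlongrightarrow> (\<i> * Q t) \<bullet> Q' t) (at t within {0..})"
    by (intro tendsto_intros Q_quotient t)
  have "inner_L2 half (v t) (\<lambda>x. \<i> * p t x) = - inner_L2 half (\<lambda>x. \<i> * v t x) (p t)"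
    by (simp add: inner_L2_ii_left)
  also have "inner_L2 half (\<lambda>x. \<i> * v t x) (p t) = inner_L2 half (\<lambda>x. (2 * lam) *\<^sub>R cubic t x - h t x) (p t)"
    by (rule inner_L2_cong_AE) (use h_eq_AE[OF t] st in \<open>auto intro!: square_integrable_intros elim: eventually_mono\<close>)
  also have "\<dots> = 2 * lam * inner_L2 half (cubic t) (p t) - inner_L2 half (h t) (p t)"
    by (subst inner_L2_diff_left) (auto intro!: square_integrable_intros st simp: inner_L2_scaleR_left)
  finally have vp1: "inner_L2 half (v t) (\<lambda>x. \<i> * p t x) = - (2 * lam * inner_L2 half (cubic t) (p t) - inner_L2 half (h t) (p t))" .
  have vp2: "2 * inner_L2 half (h t) (p t) = - (norm (P t))\<^sup>2"
    using H1_parts[OF ph[OF t] ph[OF t]] inner_L2_commute[of half "p t" "h t"] by (simp add: P_def power2_norm_eq_inner)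
  have "- 2 * inner_L2 half (v t) (\<lambda>x. \<i> * p t x) = lam * (4 * inner_L2 half (cubic t) (p t)) - 2 * inner_L2 half (h t) (p t)"
    unfolding vp1 by simp
  then have vp: "- 2 * inner_L2 half (v t) (\<lambda>x. \<i> * p t x) = (norm (P t))\<^sup>2 - lam * (norm (Q t)) ^ 4"
    unfolding vp2 cubic_inner_p[OF t] by simp
  have "((\<lambda>s. - (inner_L2 half (\<lambda>x. q s x - q t x) (\<lambda>x. \<i> * p s x + \<i> * p t x) / (s - t)) - (\<i> * Q t) \<bullet> ((Q s - Q t) /\<^sub>R (s - t)))
      \<longlongrightarrow> - (2 * inner_L2 half (v t) (\<lambda>x. \<i> * p t x)) - (\<i> * Q t) \<bullet> Q' t) (at t within {0..})"
    by (intro tendsto_intros 1 2)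
  then show "((\<lambda>s. - (inner_L2 half (\<lambda>x. q s x - q t x) (\<lambda>x. \<i> * p s x + \<i> * p t x) / (s - t)) - (\<i> * Q t) \<bullet> ((Q s - Q t) /\<^sub>R (s - t)))
      \<longlongrightarrow> (norm (P t))\<^sup>2 - lam * (norm (Q t)) ^ 4 - (\<i> * Q t) \<bullet> Q' t) (at t within {0..})"
    using vp by simp
  show "\<forall>\<^sub>F s in at t within {0..}. - (inner_L2 half (\<lambda>x. q s x - q t x) (\<lambda>x. \<i> * p s x + \<i> * p t x) / (s - t)) - (\<i> * Q t) \<bullet> ((Q s - Q t) /\<^sub>R (s - t))
      = (inner_L2 half (\<lambda>x. \<i> * q s x) (p s) - inner_L2 half (\<lambda>x. \<i> * q t x) (p t)) / (s - t)"
    using eventually_at_within_ne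
  proof eventually_elim
    case (elim s)
    then have s: "0 \<le> s" by auto
    note ss = q_L2[OF s] p_L2[OF s]
    \<comment> \<open>The increment p(s) - p(t), which has no controlled quotient, is traded for
      q(s) - q(t) at the price of a boundary term.\<close>
    have "inner_L2 half (\<lambda>x. \<i> * p t x) (\<lambda>x. q s x - q t x) + inner_L2 half (\<lambda>x. \<i> * q t x) (\<lambda>x. p s x - p t x)
        = - ((\<i> * Q t) \<bullet> (Q s - Q t))"
      using H1_parts[OF H1_mult_left[OF qp[OF t], of \<i>] H1_diff[OF qp[OF s] qp[OF t]]] bdry[OF s] bdry[OF t] by simp
    moreover have "inner_L2 half (\<lambda>x. \<i> * q s x) (p s) - inner_L2 half (\<lambda>x. \<i> * q t x) (p t)
        = - inner_L2 half (\<lambda>x. q s x - q t x) (\<lambda>x. \<i> * p s x) + inner_L2 half (\<lambda>x. \<i> * q t x) (\<lambda>x. p s x - p t x)"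
    proof -
      have "inner_L2 half (\<lambda>x. \<i> * q s x) (p s) - inner_L2 half (\<lambda>x. \<i> * q t x) (p s)
          = - inner_L2 half (\<lambda>x. q s x - q t x) (\<lambda>x. \<i> * p s x)"
        by (simp add: inner_L2_ii_left inner_L2_diff_left ss st square_integrable_intros)
      moreover have "inner_L2 half (\<lambda>x. \<i> * q t x) (\<lambda>x. p s x - p t x)
          = inner_L2 half (\<lambda>x. \<i> * q t x) (p s) - inner_L2 half (\<lambda>x. \<i> * q t x) (p t)"
        by (simp add: inner_L2_diff_right ss st square_integrable_intros)
      ultimately show ?thesis by simp
    qed
    moreover have "inner_L2 half (\<lambda>x. q s x - q t x) (\<lambda>x. \<i> * p s x + \<i> * p t x)
        = inner_L2 half (\<lambda>x. q s x - q t x) (\<lambda>x. \<i> * p s x) + inner_L2 half (\<lambda>x. \<i> * p t x) (\<lambda>x. q s x - q t x)"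
      by (simp add: inner_L2_add_right ss st square_integrable_intros inner_L2_commute[of half "\<lambda>x. \<i> * p t x"])
    ultimately have "inner_L2 half (\<lambda>x. \<i> * q s x) (p s) - inner_L2 half (\<lambda>x. \<i> * q t x) (p t)
        = - inner_L2 half (\<lambda>x. q s x - q t x) (\<lambda>x. \<i> * p s x + \<i> * p t x) - (\<i> * Q t) \<bullet> (Q s - Q t)"
      by simp
    then show ?case by (simp add: divide_inverse_commute right_diff_distrib)
  qed
qed

lemma initial_norms:
  shows "norm_L2 half (q 0) = 0" "norm_L2 half (p 0) = 0" "inner_L2 half (cubic 0) (q 0) = 0"
    "inner_L2 half (\<lambda>x. \<i> * q 0 x) (p 0) = 0"
proof -
  have z: "(\<integral>x. f (q 0 x) x \<partial>half) = 0" if "\<And>x. f 0 x = 0" for f :: "complex \<Rightarrow> real \<Rightarrow> real"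
  proof -
    have "(\<integral>x. f (q 0 x) x \<partial>half) = (\<integral>x. 0 \<partial>half)"
      by (rule Bochner_Integration.integral_cong) (use that init in auto)
    then show ?thesis by simp
  qed
  have iz: "inner_L2 half (q 0) g = 0" for g
    unfolding inner_L2_def by (rule z) simp
  show "norm_L2 half (q 0) = 0" using iz[of "q 0"] by (simp add: inner_L2_self)
  show "inner_L2 half (cubic 0) (q 0) = 0" using iz[of "cubic 0"] by (simp add: inner_L2_commute)
  show "inner_L2 half (\<lambda>x. \<i> * q 0 x) (p 0) = 0" using iz by (simp add: inner_L2_ii_left)
  \<comment> \<open>The initial condition concerns \<open>q 0\<close> only; integrating |p(0)|^2 by
    parts moves everything onto it.\<close>
  have "inner_L2 half (p 0) (p 0) = 0"
    using H1_parts[OF qp ph, of 0 0] iz[of "h 0"] init[of 0] by simp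
  then show "norm_L2 half (p 0) = 0" by (simp add: inner_L2_self)
qed

lemma has_integral_derivative:
  fixes f g :: "real \<Rightarrow> real"
  assumes "\<And>t. 0 \<le> t \<Longrightarrow> (f has_real_derivative g t) (at t within {0..})" "0 \<le> T"
  shows "(g has_integral f T - f 0) {0..T}"
  by (rule fundamental_theorem_of_calculus[OF assms(2)])
     (auto intro!: has_vector_derivative_within_subset[OF assms(1)[unfolded has_real_derivative_iff_has_vector_derivative]])

end

section \<open>Integration in time and the algebra of the boundary estimate\<close>

definition slab :: "real \<Rightarrow> real measure" where
  "slab T = restrict_space lborel {0<..<T}"

lemma continuous_on_slab:
  fixes f :: "real \<Rightarrow> 'a :: euclidean_space"
  assumes f: "continuous_on {0..} f"
  shows "integrable (slab T) f"
    and "(f has_integral I) {0..T} \<Longrightarrow> I = (\<integral>t. f t \<partial>slab T)"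
proof -
  have "set_integrable lborel {0..T} f"
    by (rule borel_integrable_atLeastAtMost') (rule continuous_on_subset[OF f], auto)
  then have s: "set_integrable lborel {0<..<T} f"
    by (rule set_integrable_subset) auto
  then show "integrable (slab T) f"
    by (simp add: slab_def integrable_restrict_space set_integrable_def)
  assume "(f has_integral I) {0..T}"
  then have "(f has_integral I) {0<..<T}"
    using has_integral_Icc_iff_Ioo by blast
  moreover have "(f has_integral (LBINT t:{0<..<T}. f t)) {0<..<T}"
    using set_borel_integral_eq_integral[OF s] by (simp add: has_integral_integral)
  ultimately have "I = (LBINT t:{0<..<T}. f t)" by (rule has_integral_unique)
  then show "I = (\<integral>t. f t \<partial>slab T)"
    by (simp add: slab_def integral_restrict_space set_lebesgue_integral_def)
qed

lemma square_integrable_slab: "continuous_on {0..} f \<Longrightarrow> square_integrable (slab T) f"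
  unfolding square_integrable_def by (intro conjI borel_measurable_integrable continuous_on_slab(1) continuous_intros)

text \<open>If y > a + b, then y > 0 and y^2 > a y + b y \<ge> a^2 + b y.\<close>

lemma le_add_of_square_le:
  fixes y :: real
  assumes "y\<^sup>2 \<le> a\<^sup>2 + b * y" "0 \<le> a" "0 \<le> b"
  shows "y \<le> a + b"
proof (rule ccontr)
  assume "\<not> ?thesis"
  then have y: "a + b < y" by simp
  then have "0 < y" using assms by linarith
  have "a * a \<le> y * a" using y assms by (intro mult_right_mono) auto
  moreover have "y * (a + b) < y * y" using y \<open>0 < y\<close> by simp
  ultimately show False using assms(1) by (simp add: power2_eq_square algebra_simps)
qed

text \<open>The estimate with all analysis removed: a, b, X are the time norms of Q, Q', P; n, m the
  spatial norms of q, q_x; S the integral of |q|^4 dx; A the root of a b; R the root of the integral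
  of |Q|^4 dt. The task is to eliminate n, m and S.\<close>

lemma boundary_inequality:
  fixes a b n m S X A R lam :: real
  assumes "lam \<noteq> 0"
    and nonneg: "0 \<le> a" "0 \<le> b" "0 \<le> n" "0 \<le> m" "0 \<le> S" "0 \<le> X" "0 \<le> A" "0 \<le> R"
    and A: "A\<^sup>2 = a * b"
    and mass: "n\<^sup>2 \<le> 2 * a * X"
    and energy: "m\<^sup>2 + lam * S \<le> 2 * b * X"
    and S: "S \<le> 2 * (n * m) * n\<^sup>2"
    and momentum: "X\<^sup>2 \<le> lam * R\<^sup>2 + A\<^sup>2 + n * m"
    and small: "lam < 0 \<Longrightarrow> a\<^sup>2 \<le> 1 / (16 * \<bar>lam\<bar>)"
  shows "X \<le> 5 * A + (if 0 < lam then sqrt lam else 0) * R"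
proof -
  define y where "y = n * m"
  have y: "0 \<le> y" using nonneg by (simp add: y_def)
  have A2X: "n\<^sup>2 * (2 * b * X) \<le> (2 * A * X)\<^sup>2"
  proof -
    have "n\<^sup>2 * (2 * b * X) \<le> (2 * a * X) * (2 * b * X)"
      using mass nonneg by (intro mult_right_mono) auto
    also have "\<dots> = 4 * A\<^sup>2 * X\<^sup>2" unfolding A by (simp add: power2_eq_square)
    finally show ?thesis by (simp add: power_mult_distrib)
  qed
  have y2: "y\<^sup>2 = n\<^sup>2 * m\<^sup>2" by (simp add: y_def power_mult_distrib)
  show ?thesis
  proof (cases "0 < lam")
    case True
    have "m\<^sup>2 \<le> 2 * b * X" using energy True nonneg(5) mult_nonneg_nonneg[of lam S] by linarith
    then have "y\<^sup>2 \<le> (2 * A * X)\<^sup>2"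
      unfolding y2 using A2X mult_left_mono[of "m\<^sup>2" "2 * b * X" "n\<^sup>2"] by simp
    then have "y \<le> 2 * A * X" by (rule power2_le_imp_le) (use nonneg in simp)
    then have X: "X\<^sup>2 \<le> (sqrt lam * R)\<^sup>2 + A\<^sup>2 + 2 * A * X"
      using momentum True by (simp add: y_def power_mult_distrib)
    have r: "0 \<le> sqrt lam * R" using True nonneg by simp
    \<comment> \<open>Completing the square. The coefficient 4 is generous; it makes the final
      factor of A the same 5 as in the other case.\<close>
    have "(X - A)\<^sup>2 \<le> (sqrt lam * R + 4 * A)\<^sup>2"
    proof -
      have "(X - A)\<^sup>2 \<le> (sqrt lam * R)\<^sup>2 + 2 * A\<^sup>2"
        using X by (simp add: power2_diff algebra_simps)
      also have "\<dots> \<le> (sqrt lam * R + 4 * A)\<^sup>2"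
      proof -
        have "0 \<le> sqrt lam * R * A" using r nonneg by simp
        then show ?thesis
          using zero_le_power2[of A] unfolding power2_sum power_mult_distrib[of 4 A] by simp
      qed
      finally show ?thesis .
    qed
    then have "X - A \<le> sqrt lam * R + 4 * A" by (rule power2_le_imp_le) (use r nonneg in simp)
    then show ?thesis using True by simp
  next
    case False
    define l where "l = - lam"
    have l: "0 < l" "lam = - l" using False \<open>lam \<noteq> 0\<close> by (auto simp: l_def)
    have al: "16 * l * a\<^sup>2 \<le> 1" using small l by (simp add: field_simps)
    have "n\<^sup>2 * m\<^sup>2 \<le> n\<^sup>2 * (2 * b * X + l * (2 * y * n\<^sup>2))"
    proof (rule mult_left_mono)
      have "m\<^sup>2 - l * S \<le> 2 * b * X" using energy l by simp
      moreover have "l * S \<le> l * (2 * y * n\<^sup>2)" using S l unfolding y_def by simp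
      ultimately show "m\<^sup>2 \<le> 2 * b * X + l * (2 * y * n\<^sup>2)" by linarith
    qed simp
    \<comment> \<open>The bound for S contains y itself, so the result is a quadratic inequality in
      y that has to be solved.\<close>
    then have "y\<^sup>2 \<le> (2 * A * X)\<^sup>2 + (2 * l * (n\<^sup>2)\<^sup>2) * y"
      unfolding y2 using A2X by (simp add: algebra_simps power2_eq_square)
    then have "y \<le> 2 * A * X + 2 * l * (n\<^sup>2)\<^sup>2"
      by (rule le_add_of_square_le) (use nonneg l in auto)
    also have "2 * l * (n\<^sup>2)\<^sup>2 \<le> 2 * l * (2 * a * X)\<^sup>2"
      using mass l by (intro mult_left_mono power_mono) auto
    \<comment> \<open>Grouped so that the smallness of \<open>a\<close> caps the first factor by 1;
      half of X^2 then survives in the momentum inequality.\<close>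
    also have "2 * l * (2 * a * X)\<^sup>2 = (16 * l * a\<^sup>2) * (X\<^sup>2 / 2)"
      by (simp add: power_mult_distrib)
    also have "\<dots> \<le> 1 * (X\<^sup>2 / 2)" by (rule mult_right_mono[OF al]) simp
    finally have "y \<le> 2 * A * X + X\<^sup>2 / 2" by simp
    moreover have "lam * R\<^sup>2 \<le> 0" using l by simp
    ultimately have "X\<^sup>2 \<le> 2 * A\<^sup>2 + 4 * A * X" using momentum by (simp add: y_def)
    \<comment> \<open>Completing the square again; 6 \<le> 3^2 yields X \<le> 2 A + 3 A, the origin
      of the constant 5.\<close>
    then have "(X - 2 * A)\<^sup>2 \<le> 6 * A\<^sup>2" by (simp add: power2_diff power_mult_distrib algebra_simps)
    also have "\<dots> \<le> (3 * A)\<^sup>2" by (simp add: power_mult_distrib)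
    finally have "X - 2 * A \<le> 3 * A" by (rule power2_le_imp_le) (use nonneg in simp)
    then show ?thesis using False by simp
  qed
qed

context nls_half_line
begin

theorem boundary_estimate:
  assumes "lam \<noteq> 0" and T: "0 \<le> T" and small: "lam < 0 \<Longrightarrow> (norm_L2 (slab T) Q)\<^sup>2 \<le> 1 / (16 * \<bar>lam\<bar>)"
  shows "norm_L2 (slab T) P \<le> 5 * sqrt (norm_L2 (slab T) Q * norm_L2 (slab T) Q')
    + (if 0 < lam then sqrt lam else 0) * sqrt (\<integral>t. norm (Q t) ^ 4 \<partial>slab T)"
proof -
  let ?M = "slab T"
  note c = P_cont Q_cont Q'_cont
  have s: "square_integrable ?M P" "square_integrable ?M Q" "square_integrable ?M Q'" "square_integrable ?M (\<lambda>t. \<i> * P t)" "square_integrable ?M (\<lambda>t. \<i> * Q t)"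
    by (intro square_integrable_slab continuous_intros c)+
  have ci: "continuous_on {0..} (\<lambda>t. - 2 * ((\<i> * P t) \<bullet> Q t))" "continuous_on {0..} (\<lambda>t. - 2 * (Q' t \<bullet> P t))"
    "continuous_on {0..} (\<lambda>t. (norm (P t))\<^sup>2 - lam * (norm (Q t)) ^ 4 - (\<i> * Q t) \<bullet> Q' t)"
    by (intro continuous_intros c)+
  have i4: "integrable ?M (\<lambda>t. norm (Q t) ^ 4)"
    by (intro continuous_on_slab(1) continuous_intros c)
  have nii: "norm_L2 M (\<lambda>t. \<i> * f t) = norm_L2 M f" for M :: "real measure" and f
    by (simp add: norm_L2_def norm_mult)
  have mass: "(norm_L2 half (q T))\<^sup>2 = - 2 * inner_L2 ?M (\<lambda>t. \<i> * P t) Q"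
    using continuous_on_slab(2)[OF ci(1) has_integral_derivative[OF mass_derivative T]]
    by (simp add: initial_norms inner_L2_def)
  have energy: "(norm_L2 half (p T))\<^sup>2 + lam * inner_L2 half (cubic T) (q T) = - 2 * inner_L2 ?M Q' P"
    using continuous_on_slab(2)[OF ci(2) has_integral_derivative[OF energy_derivative T]] initial_norms(2,3)
    by (simp add: inner_L2_def)
  have "inner_L2 half (\<lambda>x. \<i> * q T x) (p T) = (\<integral>t. (norm (P t))\<^sup>2 - lam * (norm (Q t)) ^ 4 - (\<i> * Q t) \<bullet> Q' t \<partial>?M)"
    using continuous_on_slab(2)[OF ci(3) has_integral_derivative[OF momentum_derivative T]]
    by (simp add: initial_norms)
  also have "\<dots> = (norm_L2 ?M P)\<^sup>2 - lam * (\<integral>t. norm (Q t) ^ 4 \<partial>?M) - inner_L2 ?M (\<lambda>t. \<i> * Q t) Q'"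
    using s i4 square_integrable_integrable_inner[OF s(5,3)] by (simp add: norm_L2_power2 inner_L2_def square_integrable_def)
  finally have momentum: "(norm_L2 ?M P)\<^sup>2 = lam * (\<integral>t. norm (Q t) ^ 4 \<partial>?M) + inner_L2 ?M (\<lambda>t. \<i> * Q t) Q'
      + inner_L2 half (\<lambda>x. \<i> * q T x) (p T)" by simp
  note sT = q_L2[OF T] p_L2[OF T] cubic_L2[OF T]
  \<comment> \<open>The lower bound lets the quartic term be dropped for \<lambda> > 0. The upper
    bound, used for \<lambda> < 0, takes the supremum of |q|^2 out of the integral.\<close>
  have S: "0 \<le> inner_L2 half (cubic T) (q T)"
    "inner_L2 half (cubic T) (q T) \<le> 2 * (norm_L2 half (q T) * norm_L2 half (p T)) * (norm_L2 half (q T))\<^sup>2"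
  proof -
    have e: "cubic T x \<bullet> q T x = (norm (q T x))\<^sup>2 * (norm (q T x))\<^sup>2" for x
      by (simp add: cubic_def power2_norm_eq_inner flip: scaleR_conv_of_real)
    show "0 \<le> inner_L2 half (cubic T) (q T)" unfolding inner_L2_def e by simp
    have "inner_L2 half (cubic T) (q T) \<le> (\<integral>x. (2 * (norm_L2 half (q T) * norm_L2 half (p T))) * (norm (q T x))\<^sup>2 \<partial>half)"
      unfolding inner_L2_def
    proof (rule integral_mono)
      show "integrable half (\<lambda>x. cubic T x \<bullet> q T x)" by (intro square_integrable_integrable_inner sT)
      show "integrable half (\<lambda>x. (2 * (norm_L2 half (q T) * norm_L2 half (p T))) * (norm (q T x))\<^sup>2)"
        using sT(1) by (simp add: square_integrable_def)
      fix x assume "x \<in> space half"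
      then show "cubic T x \<bullet> q T x \<le> (2 * (norm_L2 half (q T) * norm_L2 half (p T))) * (norm (q T x))\<^sup>2"
        unfolding e using H1_sup_bound[OF qp[OF T], of x] by (intro mult_right_mono) auto
    qed
    then show "inner_L2 half (cubic T) (q T) \<le> 2 * (norm_L2 half (q T) * norm_L2 half (p T)) * (norm_L2 half (q T))\<^sup>2"
      by (simp add: norm_L2_power2)
  qed
  have i4nn: "0 \<le> (\<integral>t. norm (Q t) ^ 4 \<partial>?M)" by simp
  show ?thesis
  proof (rule boundary_inequality[OF \<open>lam \<noteq> 0\<close>])
    show "(norm_L2 half (q T))\<^sup>2 \<le> 2 * norm_L2 ?M Q * norm_L2 ?M P"
    proof -
      have "(norm_L2 half (q T))\<^sup>2 \<le> 2 * (norm_L2 ?M P * norm_L2 ?M Q)"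
        using mass abs_le_D2[OF inner_L2_le[OF s(4,2)]] unfolding nii by linarith
      then show ?thesis by (simp only: mult_ac)
    qed
    show "(norm_L2 half (p T))\<^sup>2 + lam * inner_L2 half (cubic T) (q T) \<le> 2 * norm_L2 ?M Q' * norm_L2 ?M P"
      using energy abs_le_D2[OF inner_L2_le[OF s(3,1)]] by linarith
    show "(norm_L2 ?M P)\<^sup>2 \<le> lam * (sqrt (\<integral>t. norm (Q t) ^ 4 \<partial>?M))\<^sup>2 + (sqrt (norm_L2 ?M Q * norm_L2 ?M Q'))\<^sup>2
        + norm_L2 half (q T) * norm_L2 half (p T)"
    proof -
      have e: "(sqrt (\<integral>t. norm (Q t) ^ 4 \<partial>?M))\<^sup>2 = (\<integral>t. norm (Q t) ^ 4 \<partial>?M)"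
        "(sqrt (norm_L2 ?M Q * norm_L2 ?M Q'))\<^sup>2 = norm_L2 ?M Q * norm_L2 ?M Q'"
        using i4nn by simp_all
      show ?thesis
        using momentum abs_le_D1[OF inner_L2_le[OF s(5,3)]]
          abs_le_D1[OF inner_L2_le[OF square_integrable_mult_left[OF sT(1), of \<i>] sT(2)]]
        unfolding nii e by linarith
    qed
    show "lam < 0 \<Longrightarrow> (norm_L2 ?M Q)\<^sup>2 \<le> 1 / (16 * \<bar>lam\<bar>)" by (rule small)
  qed (use S in \<open>auto simp: i4nn\<close>)
qed

end


section \<open>Transfer to the initial-boundary value problem\<close>

text \<open>The functions \<open>p t\<close> and \<open>h t\<close> are chosen separately for each
  t, so at first nothing relates different times. Their continuity in time comes from the H2 norm of
  q(s) - q(t), which may be computed with p(s) - p(t) and h(s) - h(t).\<close>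

lemma classical_solution_nls_half_line:
  assumes Q1: "\<And>t. 0 \<le> t \<Longrightarrow> (Q has_vector_derivative Q1 t) (at t within {0..})" "continuous_on {0..} Q1"
    and sol: "classical_solution lam Q q"
  obtains p h v where "nls_half_line lam (\<lambda>t x. q x t) p h v Q Q1"
proof -
  have cont: "continuous_on {0..} (\<lambda>x. q x t)" if "0 \<le> t" for t
    using sol that by (simp add: classical_solution_def)
  have H2: "(\<lambda>x. q x t) \<in> H2_halfline"
    "((\<lambda>s. H2_norm (\<lambda>x. q x s - q x t)) \<longlongrightarrow> 0) (at t within {0..})" if "0 \<le> t" for t
    using sol that by (auto simp: classical_solution_def C0_H2_def)
  obtain v where v: "C1_L2 (\<lambda>t x. q x t) v"
    and eq: "\<And>t. 0 \<le> t \<Longrightarrow> AE x in lborel. 0 < x \<longrightarrow>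
      \<i> * v t x + weak_deriv (weak_deriv (\<lambda>y. q y t)) x
        - 2 * complex_of_real lam * complex_of_real ((norm (q x t))\<^sup>2) * q x t = 0"
    using sol by (auto simp: classical_solution_def)
  have "\<exists>p h. H1 (\<lambda>x. q x t) p \<and> H1 p h" if "0 \<le> t" for t
    using H2_halfline_H1[OF H2(1) cont, of t] that by metis
  then obtain p h where ph: "\<And>t. 0 \<le> t \<Longrightarrow> H1 (\<lambda>x. q x t) (p t)" "\<And>t. 0 \<le> t \<Longrightarrow> H1 (p t) (h t)"
    by metis
  have s: "square_integrable half (\<lambda>x. q x t)" "square_integrable half (p t)" "square_integrable half (h t)" "square_integrable half (v t)" if "0 \<le> t" for t
    using ph[OF that] v that by (auto simp: H1_def C1_L2_def C0_L2_def L2_halfline_iff)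
  have ev: "\<forall>\<^sub>F s in at t within {0..}. 0 \<le> s" for t :: real
    using eventually_at_within_ne by eventually_elim auto
  \<comment> \<open>The real form of that H2 norm; it dominates the L2 norm of each of the three
    differences.\<close>
  let ?N = "\<lambda>t s. sqrt ((norm_L2 half (\<lambda>x. q x s - q x t))\<^sup>2 + (norm_L2 half (\<lambda>x. p s x - p t x))\<^sup>2
    + (norm_L2 half (\<lambda>x. h s x - h t x))\<^sup>2)"
  have N: "(?N t \<longlongrightarrow> 0) (at t within {0..})" if t: "0 \<le> t" for t
  proof (rule tendsto_ennrealD)
    show "((\<lambda>s. ennreal (?N t s)) \<longlongrightarrow> ennreal 0) (at t within {0..})"
      unfolding ennreal_0
    proof (rule Lim_transform_eventually[OF H2(2)[OF t]])
      show "\<forall>\<^sub>F s in at t within {0..}. H2_norm (\<lambda>x. q x s - q x t) = ennreal (?N t s)"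
        using ev by eventually_elim (intro H2_norm_H1 H1_diff ph t)
    qed
  qed auto
  have conv: "converges_L2 half (at t within {0..}) f (f t)"
    if "0 \<le> t" and f: "\<And>s. 0 \<le> s \<Longrightarrow> square_integrable half (f s)"
      and le: "\<And>s. norm_L2 half (\<lambda>x. f s x - f t x) \<le> ?N t s" for f t
    unfolding converges_L2_def
  proof (intro conjI f that)
    show "\<forall>\<^sub>F s in at t within {0..}. square_integrable half (f s)" using ev by eventually_elim (rule f)
    show "((\<lambda>s. norm_L2 half (\<lambda>x. f s x - f t x)) \<longlongrightarrow> 0) (at t within {0..})"
      by (rule Lim_null_comparison[OF _ N[OF \<open>0 \<le> t\<close>]]) (auto intro!: always_eventually le)
  qed
  have "nls_half_line lam (\<lambda>t x. q x t) p h v Q Q1"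
  proof
    fix t :: real assume t: "0 \<le> t"
    show "H1 (\<lambda>x. q x t) (p t)" "H1 (p t) (h t)" by (rule ph[OF t])+
    show "converges_L2 half (at t within {0..}) (\<lambda>t x. q x t) (\<lambda>x. q x t)"
      "converges_L2 half (at t within {0..}) p (p t)" "converges_L2 half (at t within {0..}) h (h t)"
      by (rule conv[OF t], simp add: s, intro real_le_rsqrt, simp)+
    show "converges_L2 half (at t within {0..}) (\<lambda>s x. (q x s - q x t) /\<^sub>R (s - t)) (v t)"
      unfolding converges_L2_def
    proof (intro conjI s t)
      show "\<forall>\<^sub>F s in at t within {0..}. square_integrable half (\<lambda>x. (q x s - q x t) /\<^sub>R (s - t))"
        using ev by eventually_elim (intro square_integrable_intros s t)
      show "((\<lambda>s. norm_L2 half (\<lambda>x. (q x s - q x t) /\<^sub>R (s - t) - v t x)) \<longlongrightarrow> 0) (at t within {0..})"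
      proof (rule tendsto_ennrealD)
        have "((\<lambda>s. Lp_norm 2 {0<..} (\<lambda>x. (q x s - q x t) /\<^sub>R (s - t) - v t x)) \<longlongrightarrow> 0) (at t within {0..})"
          using v t by (simp add: C1_L2_def)
        then show "((\<lambda>s. ennreal (norm_L2 half (\<lambda>x. (q x s - q x t) /\<^sub>R (s - t) - v t x))) \<longlongrightarrow> ennreal 0) (at t within {0..})"
          unfolding ennreal_0
        proof (rule Lim_transform_eventually)
          show "\<forall>\<^sub>F s in at t within {0..}. Lp_norm 2 {0<..} (\<lambda>x. (q x s - q x t) /\<^sub>R (s - t) - v t x)
              = ennreal (norm_L2 half (\<lambda>x. (q x s - q x t) /\<^sub>R (s - t) - v t x))"
            using ev by eventually_elim (intro Lp_norm_half square_integrable_intros s t)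
        qed
      qed auto
    qed
    show "AE x in half. \<i> * v t x + h t x - 2 * complex_of_real lam * complex_of_real ((norm (q x t))\<^sup>2) * q x t = 0"
      using eq[OF t, folded AE_half_iff] weak_deriv_H1(2)[OF ph(1)[OF t] ph(2)[OF t]]
      by eventually_elim simp
    show "q 0 t = Q t" using sol t by (simp add: classical_solution_def)
    show "(Q has_vector_derivative Q1 t) (at t within {0..})" by (rule Q1(1)[OF t])
  next
    show "0 \<le> x \<Longrightarrow> q x 0 = 0" for x using sol by (simp add: classical_solution_def)
    show "continuous_on {0..} Q1" by (rule Q1(2))
  qed
  then show ?thesis by (rule that)
qed

text \<open>One-sided derivatives are unique, and \<open>vector_derivative\<close> is determined,
  only along a nontrivial filter; t = 0 is included.\<close>

lemma at_within_atLeast_neq_bot: "0 \<le> t \<Longrightarrow> at t within {0..} \<noteq> (bot :: real filter)"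
proof -
  assume "0 \<le> t"
  then have "at t within {0..} = at t within {0..t + 1}"
    by (intro at_within_nhd[where S = "{..<t + 1}"]) auto
  then show ?thesis using islimpt_Icc[of 0 "t + 1" t] \<open>0 \<le> t\<close> by (simp add: trivial_limit_within)
qed

section \<open>Lebesgue norms over time intervals and the passage to infinite time\<close>

lemma Lp_norm_cong:
  assumes "\<And>x. x \<in> A \<Longrightarrow> f x = g x"
  shows "Lp_norm p A f = Lp_norm p A g"
proof -
  have "(\<integral>\<^sup>+x\<in>A. ennreal (norm (f x) powr p) \<partial>lborel) = (\<integral>\<^sup>+x\<in>A. ennreal (norm (g x) powr p) \<partial>lborel)"
    by (rule nn_integral_cong) (use assms in \<open>auto simp: indicator_def\<close>)
  then show ?thesis by (simp add: Lp_norm_def)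
qed

text \<open>The exponents that occur, 2 and 4, are natural numbers, so \<open>powr\<close> can give
  way to ordinary powers. The two differ for n = 0, where \<open>0 powr 0\<close> is 0 and
  \<open>0 ^ 0\<close> is 1.\<close>

lemma Lp_norm_slab:
  assumes f: "continuous_on {0..} f" and n: "n \<noteq> 0"
  shows "Lp_norm (real n) {0<..<T} f = ennreal ((\<integral>t. norm (f t) ^ n \<partial>slab T) powr (1 / real n))"
proof -
  have "(\<integral>\<^sup>+x\<in>{0<..<T}. ennreal (norm (f x) powr real n) \<partial>lborel) = (\<integral>\<^sup>+x. ennreal (norm (f x) ^ n) \<partial>slab T)"
    unfolding slab_def using n by (subst nn_integral_restrict_space) (auto simp: powr_realpow')
  also have "\<dots> = ennreal (\<integral>t. norm (f t) ^ n \<partial>slab T)"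
    by (intro nn_integral_eq_integral continuous_on_slab(1) continuous_intros f) auto
  finally show ?thesis by (simp add: Lp_norm_def epowr_def)
qed

lemma Lp_norm_2_slab: "continuous_on {0..} f \<Longrightarrow> Lp_norm 2 {0<..<T} f = ennreal (norm_L2 (slab T) f)"
  using Lp_norm_slab[of f 2 T] by (simp add: norm_L2_def powr_half_sqrt)

lemma Lp_norm_4_slab:
  assumes "continuous_on {0..} f"
  shows "(Lp_norm 4 {0<..<T} f)\<^sup>2 = ennreal (sqrt (\<integral>t. norm (f t) ^ 4 \<partial>slab T))"
proof -
  have "0 \<le> (\<integral>t. norm (f t) ^ 4 \<partial>slab T)" (is "0 \<le> ?I") by simp
  then have "(?I powr (1 / 4))\<^sup>2 = sqrt ?I"
    by (simp add: power2_eq_square powr_half_sqrt flip: powr_add)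
  then show ?thesis
    using Lp_norm_slab[OF assms, of 4 T] by (simp add: ennreal_power)
qed

lemma epowr_mono: "x \<le> y \<Longrightarrow> 0 \<le> a \<Longrightarrow> epowr x a \<le> epowr y a"
  by (auto simp: epowr_def top.not_eq_extremum top_unique intro!: ennreal_leI powr_mono2 enn2real_mono)

lemma Lp_norm_mono: "A \<subseteq> B \<Longrightarrow> 0 \<le> p \<Longrightarrow> Lp_norm p A f \<le> Lp_norm p B f"
  unfolding Lp_norm_def by (intro epowr_mono nn_set_integral_set_mono) auto

lemma epowr_half_le_iff: "0 \<le> b \<Longrightarrow> epowr x (1 / 2) \<le> ennreal b \<longleftrightarrow> x \<le> ennreal (b\<^sup>2)"
proof (cases x)
  case (real r)
  assume "0 \<le> b"
  then show ?thesis using real by (simp add: epowr_half ennreal_le_iff real_sqrt_le_iff' real_le_lsqrt sqrt_le_D)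
qed (simp add: epowr_def top_unique)

text \<open>Monotone convergence over (0,n). The bound \<open>B\<close> is independent of n, so it
  may itself contain norms over the whole half line; for infinite \<open>B\<close> there is nothing
  to show.\<close>

lemma Lp_norm_halfline_le:
  assumes f: "continuous_on {0..} f"
    and le: "\<And>n::nat. Lp_norm 2 {0<..<real n} f \<le> B"
  shows "Lp_norm 2 {0<..} f \<le> B"
proof (cases B)
  case (real b)
  let ?g = "\<lambda>n x. ennreal (norm (f x) powr 2) * indicator {0<..<real n} x"
  have [measurable]: "(\<lambda>x. indicator {0<..} x *\<^sub>R f x) \<in> borel_measurable borel"
    by (rule borel_measurable_continuous_on_indicator) (auto intro: continuous_on_subset[OF f])
  have g: "?g n = (\<lambda>x. ennreal (norm (indicator {0<..} x *\<^sub>R f x) powr 2) * indicator {0<..<real n} x)" for n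
    by (auto simp: indicator_def)
  have sup: "(SUP n. ?g n x) = ennreal (norm (f x) powr 2) * indicator {0<..} x" for x
  proof -
    obtain N where N: "x < real N" using reals_Archimedean2 by blast
    have "(SUP n. ?g n x) \<le> ennreal (norm (f x) powr 2) * indicator {0<..} x"
      by (intro SUP_least mult_left_mono) (simp_all add: indicator_def)
    moreover have "ennreal (norm (f x) powr 2) * indicator {0<..} x = ?g N x"
      using N by (auto simp: indicator_def)
    moreover have "?g N x \<le> (SUP n. ?g n x)" by (rule SUP_upper) simp
    ultimately show ?thesis by (simp add: antisym)
  qed
  have "(\<integral>\<^sup>+x\<in>{0<..}. ennreal (norm (f x) powr 2) \<partial>lborel) = (\<integral>\<^sup>+x. (SUP n. ?g n x) \<partial>lborel)"
    by (simp only: sup)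
  also have "\<dots> = (SUP n. \<integral>\<^sup>+x. ?g n x \<partial>lborel)"
  proof (rule nn_integral_monotone_convergence_SUP)
    show "incseq ?g" by (auto simp: incseq_def le_fun_def indicator_def)
    show "?g n \<in> borel_measurable lborel" for n unfolding g by measurable
  qed
  also have "\<dots> \<le> ennreal (b\<^sup>2)"
    by (rule SUP_least) (use le real in \<open>simp add: Lp_norm_def epowr_half_le_iff\<close>)
  finally show ?thesis using real by (simp add: Lp_norm_def epowr_half_le_iff)
qed simp

theorem theorem2p1:
  fixes lam :: real
  assumes "lam \<noteq> 0"
  shows "\<exists>\<delta>>0. \<forall>(c\<^sub>2::real) (Q :: real \<Rightarrow> complex) (q :: real \<Rightarrow> real \<Rightarrow> complex).
    0 < c\<^sub>2 \<longrightarrow> c\<^sub>2 \<le> \<delta> \<longrightarrow>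
    C2_halfline Q \<longrightarrow> Q 0 = 0 \<longrightarrow> classical_solution lam Q q \<longrightarrow>
    (lam < 0 \<longrightarrow> (\<forall>t\<ge>0. (Lp_norm 2 {0<..<t} (\<lambda>s. q 0 s))\<^sup>2 \<le> ennreal c\<^sub>2)) \<longrightarrow>
    (\<exists>c c\<^sub>1 :: real. 0 < c \<and> 0 \<le> c\<^sub>1 \<and> (lam < 0 \<longrightarrow> c\<^sub>1 = 0) \<and> (lam > 0 \<longrightarrow> 0 < c\<^sub>1) \<and>
      (\<forall>t::ereal. 0 \<le> t \<longrightarrow>
         Lp_norm 2 (einterval 0 t) (bdry_dx q)
           \<le> ennreal c * epowr (Lp_norm 2 (einterval 0 t) (\<lambda>s. q 0 s)) (1 / 2)
                       * epowr (Lp_norm 2 (einterval 0 t) (bdry_dt q)) (1 / 2)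
             + ennreal c\<^sub>1 * (Lp_norm 4 (einterval 0 t) (\<lambda>s. q 0 s))\<^sup>2))"
proof (rule exI[of _ "1 / (16 * \<bar>lam\<bar>)"], intro conjI allI impI)
  show "0 < 1 / (16 * \<bar>lam\<bar>)" using assms by simp
next
  fix c2 :: real and Q :: "real \<Rightarrow> complex" and q :: "real \<Rightarrow> real \<Rightarrow> complex"
  assume c2: "0 < c2" "c2 \<le> 1 / (16 * \<bar>lam\<bar>)"
    and "C2_halfline Q" and sol: "classical_solution lam Q q"
    and small: "lam < 0 \<longrightarrow> (\<forall>t\<ge>0. (Lp_norm 2 {0<..<t} (\<lambda>s. q 0 s))\<^sup>2 \<le> ennreal c2)"
  \<comment> \<open>Continuity of the first derivative comes from the existence of the
    second.\<close>
  obtain Q1 where Q1: "\<And>t. 0 \<le> t \<Longrightarrow> (Q has_vector_derivative Q1 t) (at t within {0..})" "continuous_on {0..} Q1"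
    using \<open>C2_halfline Q\<close> unfolding C2_halfline_def continuous_on_eq_continuous_within
    by (metis atLeast_iff has_vector_derivative_continuous)
  obtain p h v where "nls_half_line lam (\<lambda>t x. q x t) p h v Q Q1"
    using classical_solution_nls_half_line[OF Q1 sol] by blast
  then interpret nls_half_line lam "\<lambda>t x. q x t" p h v Q Q1 .
  \<comment> \<open>The root of the coefficient \<lambda> of |Q|^4 in the momentum law; for
    \<lambda> < 0 that term has a favourable sign.\<close>
  define c1 where "c1 = (if 0 < lam then sqrt lam else 0)"
  let ?R = "\<lambda>A. ennreal 5 * epowr (Lp_norm 2 A (\<lambda>s. q 0 s)) (1 / 2) * epowr (Lp_norm 2 A (bdry_dt q)) (1 / 2)
             + ennreal c1 * (Lp_norm 4 A (\<lambda>s. q 0 s))\<^sup>2"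
  have dx: "bdry_dx q t = P t" if "0 \<le> t" for t
    unfolding bdry_dx_def P_def
  proof (rule vector_derivative_within)
    have "continuous_on {0..} (p t)" using ph[OF that] by (auto simp: H1_def intro: antideriv_continuous)
    then show "((\<lambda>x. q x t) has_vector_derivative p t 0) (at 0 within {0..})"
      using qp[OF that] by (auto simp: H1_def intro: antideriv_has_vector_derivative_0)
  qed (simp add: at_within_atLeast_neq_bot)
  have dt: "bdry_dt q t = Q1 t" if "0 \<le> t" for t
    unfolding bdry_dt_def
  proof (rule vector_derivative_within)
    show "(q 0 has_vector_derivative Q1 t) (at t within {0..})"
      by (rule has_vector_derivative_transform[OF _ _ Q'[OF that]]) (use that bdry in auto)
  qed (simp add: at_within_atLeast_neq_bot that)
  have cong: "Lp_norm r A (bdry_dx q) = Lp_norm r A P" "Lp_norm r A (bdry_dt q) = Lp_norm r A Q1"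
    "Lp_norm r A (\<lambda>s. q 0 s) = Lp_norm r A Q" if "A \<subseteq> {0<..}" for A r
    using that by (auto intro!: Lp_norm_cong dx dt bdry)
  have finite: "Lp_norm 2 {0<..<T} (bdry_dx q) \<le> ?R {0<..<T}" if T: "0 \<le> T" for T
  proof -
    have sub: "{0<..<T} \<subseteq> {0<..}" by auto
    have "(norm_L2 (slab T) Q)\<^sup>2 \<le> 1 / (16 * \<bar>lam\<bar>)" if "lam < 0"
    proof -
      have "ennreal ((norm_L2 (slab T) Q)\<^sup>2) \<le> ennreal c2"
      proof -
        have "(Lp_norm 2 {0<..<T} (\<lambda>s. q 0 s))\<^sup>2 \<le> ennreal c2" using small that T by blast
        then show ?thesis
          unfolding cong(3)[OF sub] Lp_norm_2_slab[OF Q_cont] by (simp add: ennreal_power)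
      qed
      then show ?thesis using c2 by (simp add: ennreal_le_iff)
    qed
    from boundary_estimate[OF assms T this]
    have "ennreal (norm_L2 (slab T) P) \<le> ennreal (5 * sqrt (norm_L2 (slab T) Q * norm_L2 (slab T) Q1)
        + c1 * sqrt (\<integral>t. norm (Q t) ^ 4 \<partial>slab T))"
      unfolding c1_def by (rule ennreal_leI)
    also have "\<dots> = ?R {0<..<T}"
      by (simp add: cong[OF sub] Lp_norm_2_slab Lp_norm_4_slab Q_cont Q'_cont epowr_half c1_def real_sqrt_mult
          ennreal_plus ennreal_mult mult.assoc)
    finally show ?thesis by (simp add: cong[OF sub] Lp_norm_2_slab P_cont)
  qed
  show "\<exists>c c\<^sub>1 :: real. 0 < c \<and> 0 \<le> c\<^sub>1 \<and> (lam < 0 \<longrightarrow> c\<^sub>1 = 0) \<and> (lam > 0 \<longrightarrow> 0 < c\<^sub>1) \<and>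
      (\<forall>t::ereal. 0 \<le> t \<longrightarrow>
         Lp_norm 2 (einterval 0 t) (bdry_dx q)
           \<le> ennreal c * epowr (Lp_norm 2 (einterval 0 t) (\<lambda>s. q 0 s)) (1 / 2)
                       * epowr (Lp_norm 2 (einterval 0 t) (bdry_dt q)) (1 / 2)
             + ennreal c\<^sub>1 * (Lp_norm 4 (einterval 0 t) (\<lambda>s. q 0 s))\<^sup>2)"
  proof (rule exI[of _ 5], rule exI[of _ c1], intro conjI allI impI)
    fix t :: ereal assume "0 \<le> t"
    then consider T where "t = ereal T" "0 \<le> T" | "t = \<infinity>" by (cases t) auto
    then show "Lp_norm 2 (einterval 0 t) (bdry_dx q) \<le> ?R (einterval 0 t)"
    proof cases
      case 1
      then show ?thesis using finite[of T] by (simp add: zero_ereal_def)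
    next
      case 2
      \<comment> \<open>Only the left side needs a limit: each norm on the right over (0,n) is at
        most the one over (0,\<infinity>).\<close>
      have "Lp_norm 2 {0<..} P \<le> ?R {0<..}"
      proof (rule Lp_norm_halfline_le[OF P_cont])
        fix n :: nat
        have sub: "{0<..<real n} \<subseteq> {0<..}" by auto
        have "Lp_norm 2 {0<..<real n} P \<le> ?R {0<..<real n}"
          using finite[of "real n"] cong(1)[OF sub, of 2] by simp
        also have "\<dots> \<le> ?R {0<..}"
          by (intro add_mono mult_mono power_mono epowr_mono Lp_norm_mono sub) auto
        finally show "Lp_norm 2 {0<..<real n} P \<le> ?R {0<..}" .
      qed
      then show ?thesis using 2 cong(1)[of "{0<..}" 2] by (simp add: zero_ereal_def)
    qed
  qed (auto simp: c1_def)
qed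


end
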